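(* Let $\alpha,\beta>0$, $T_{\mathrm m}\in\mathbb R$. Consider the one-phase Stefan problem with boundary temperature actuation $$T_t(x,t)=\alpha T_{xx}(x,t)\ (0\le x\le s(t)),\quad T(0,t)=T_{\mathrm m}+T_{\mathrm c}(t),\quad T(s(t),t)=T_{\mathrm m},\quad \dot s(t)=-\beta T_x(s(t),t),$$ with $T(x,0)=T_0(x)$, $s(0)=s_0>0$, where for some constant $H$ one has $0\le T_0(x)-T_{\mathrm m}\le H(s_0-x)$ on $[0,s_0]$, with measurement $Y(t)=s(t)$, and the observer, for $x\in[0,s(t)]$, $$\hat T_t(x,t)=\alpha\hat T_{xx}(x,t)-p_2(x,s(t))\left(\frac{\dot Y(t)}{\beta}+\hat T_x(s(t),t)\right),\quad \hat T(0,t)=T_{\mathrm m}+T_{\mathrm c}(t),\quad \hat T(s(t),t)=T_{\mathrm m},$$ with observer gain $$p_2(x,s(t))=-\lambda x\,\frac{I_1\!\left(\sqrt{\frac{\lambda}{\alpha}(s(t)^2-x^2)}\right)}{\sqrt{\frac{\lambda}{\alpha}(s(t)^2-x^2)}},\qquad\lambda>0.$$ Let $s_{\mathrm r}$ be the setpoint and assume that $$T_{\mathrm c}(t)>0\quad\text{and}\quad s(t)<s_{\mathrm r}\qquad\text{for all }t>0.$$ Then, for all $\lambda>0$, the observer error system is exponentially stable in the sense of the norm $\|T-\hat T\|_{\mathcal H_1}^2$.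
   Context: $I_1$ is the modified Bessel function of the first kind of order 1; the quotient $I_1(z)/z$ is extended continuously by $1/2$ at $z=0$. $(T,s)$ and $\hat T$ denote (classical) solutions for $t\ge0$ with $s(t)>0$; $\hat T$ has an initial condition $\hat T(x,0)=\hat T_0(x)$ on $[0,s_0]$. The observer error is $\tilde T=T-\hat T$. $T_{\mathrm c}(t)$ is the controlled boundary temperature measured relative to the melting temperature $T_{\mathrm m}$. Norms at time $t$: $\|u\|_{\mathcal L_2}^2=\int_0^{s(t)}u(x,t)^2dx$ and $\|u\|_{\mathcal H_1}^2=\|u\|_{\mathcal L_2}^2+\|u_x\|_{\mathcal L_2}^2$. "Exponentially stable in the sense of the norm $\Phi(t)$" means: there exist constants $D,b>0$, depending only on the system parameters, the gain parameter and the setpoint (not on the particular solution), such that $\Phi(t)\le D\,\Phi(0)e^{-bt}$ for all $t\ge0$. *)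

theory Defs
  imports "HOL-Analysis.Analysis"
begin

definition bessel_I :: "nat \<Rightarrow> real \<Rightarrow> real" where
  "bessel_I n z = (\<Sum>m. (z / 2) ^ (2 * m + n) / (fact m * fact (m + n)))"

definition bessel_I1_quot :: "real \<Rightarrow> real" where
  "bessel_I1_quot z = (if z = 0 then 1 / 2 else bessel_I 1 z / z)"

definition observer_gain :: "real \<Rightarrow> real \<Rightarrow> real \<Rightarrow> real \<Rightarrow> real" where
  "observer_gain \<alpha> lam x l =
     - lam * x * bessel_I1_quot (sqrt (lam / \<alpha> * (l\<^sup>2 - x\<^sup>2)))"

text \<open>Functions of position and time are written \<open>u x t\<close>. Classical regularity: \<open>u\<close> is
  continuous up to time 0, and for positive times its derivatives are continuous up to the lateral
  boundaries \<open>x = 0\<close> and \<open>x = s t\<close>. The space derivatives are one-sided there. A vertical time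
  slice through a point of the free boundary may degenerate to a single point, so the time
  derivative is asked for in the interior only; on the lateral boundaries \<open>ut\<close> is its continuous
  extension.\<close>

definition classical_on ::
  "(real \<Rightarrow> real) \<Rightarrow> (real \<Rightarrow> real \<Rightarrow> real) \<Rightarrow> (real \<Rightarrow> real \<Rightarrow> real) \<Rightarrow>
   (real \<Rightarrow> real \<Rightarrow> real) \<Rightarrow> (real \<Rightarrow> real \<Rightarrow> real) \<Rightarrow> bool" where
  "classical_on s u ux uxx ut \<longleftrightarrow>
     continuous_on {(x, t). 0 \<le> t \<and> 0 \<le> x \<and> x \<le> s t} (\<lambda>(x, t). u x t) \<and>
     continuous_on {(x, t). 0 < t \<and> 0 \<le> x \<and> x \<le> s t} (\<lambda>(x, t). ux x t) \<and>
     continuous_on {(x, t). 0 < t \<and> 0 \<le> x \<and> x \<le> s t} (\<lambda>(x, t). uxx x t) \<and>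
     continuous_on {(x, t). 0 < t \<and> 0 \<le> x \<and> x \<le> s t} (\<lambda>(x, t). ut x t) \<and>
     (\<forall>t>0. \<forall>x\<in>{0..s t}.
        ((\<lambda>y. u y t) has_real_derivative ux x t) (at x within {0..s t}) \<and>
        ((\<lambda>y. ux y t) has_real_derivative uxx x t) (at x within {0..s t})) \<and>
     (\<forall>t>0. \<forall>x\<in>{0<..<s t}. ((\<lambda>r. u x r) has_real_derivative ut x t) (at t))"

text \<open>Boundary values at time 0 are not prescribed separately: they follow by continuity.\<close>

definition stefan_solution ::
  "real \<Rightarrow> real \<Rightarrow> real \<Rightarrow> (real \<Rightarrow> real) \<Rightarrow> real \<Rightarrow> (real \<Rightarrow> real) \<Rightarrow>
   (real \<Rightarrow> real) \<Rightarrow> (real \<Rightarrow> real \<Rightarrow> real) \<Rightarrow> bool" where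
  "stefan_solution \<alpha> \<beta> Tm Tc s0 T0 s T \<longleftrightarrow>
     continuous_on {0..} s \<and> (\<forall>t\<ge>0. 0 < s t) \<and> s 0 = s0 \<and> (\<forall>x\<in>{0..s0}. T x 0 = T0 x) \<and>
     (\<exists>Tx Txx Tt. classical_on s T Tx Txx Tt \<and>
       (\<forall>t>0. (\<forall>x\<in>{0..s t}. Tt x t = \<alpha> * Txx x t) \<and>
              T 0 t = Tm + Tc t \<and> T (s t) t = Tm \<and>
              (s has_real_derivative - \<beta> * Tx (s t) t) (at t)))"

text \<open>The argument \<open>Y\<close> is the measured interface position; the observer lives on \<open>{0..Y t}\<close>.\<close>

definition observer_solution ::
  "real \<Rightarrow> real \<Rightarrow> real \<Rightarrow> real \<Rightarrow> (real \<Rightarrow> real) \<Rightarrow> (real \<Rightarrow> real) \<Rightarrow>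
   (real \<Rightarrow> real) \<Rightarrow> (real \<Rightarrow> real \<Rightarrow> real) \<Rightarrow> bool" where
  "observer_solution \<alpha> \<beta> lam Tm Tc Y Th0 Th \<longleftrightarrow>
     (\<forall>x\<in>{0..Y 0}. Th x 0 = Th0 x) \<and>
     (\<exists>Thx Thxx Tht. classical_on Y Th Thx Thxx Tht \<and>
       (\<forall>t>0. (\<forall>x\<in>{0..Y t}. Tht x t =
                 \<alpha> * Thxx x t - observer_gain \<alpha> lam x (Y t) * (deriv Y t / \<beta> + Thx (Y t) t)) \<and>
              Th 0 t = Tm + Tc t \<and> Th (Y t) t = Tm))"

definition weak_deriv_on :: "real \<Rightarrow> (real \<Rightarrow> real) \<Rightarrow> (real \<Rightarrow> real) \<Rightarrow> bool" where
  "weak_deriv_on l u g \<longleftrightarrow>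
     set_integrable lborel {0..l} g \<and> (\<forall>x\<in>{0..l}. u x = u 0 + (LINT y:{0..x}|lborel. g y))"

definition L2_sqnorm :: "real \<Rightarrow> (real \<Rightarrow> real) \<Rightarrow> ennreal" where
  "L2_sqnorm l u = (\<integral>\<^sup>+x\<in>{0..l}. ennreal ((u x)\<^sup>2) \<partial>lborel)"

text \<open>The weak derivative is unique almost everywhere, so the infimum below runs over at most one
  value; it is \<open>\<infinity>\<close> if there is no weak derivative. Hence the norm is finite exactly on
  the Sobolev space, and for continuously differentiable \<open>u\<close> it uses the classical derivative.\<close>

definition H1_sqnorm :: "real \<Rightarrow> (real \<Rightarrow> real) \<Rightarrow> ennreal" where
  "H1_sqnorm l u = L2_sqnorm l u + (INF g\<in>{g. weak_deriv_on l u g}. L2_sqnorm l g)"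

end

theory Submission
  imports Defs
begin

text \<open>
  Write \<open>u = T - Th\<close> and \<open>c = lam / \<alpha>\<close>. The error satisfies
  \<open>u\<^sub>t = \<alpha> (u\<^sub>x\<^sub>x + P(x, s) u\<^sub>x(s))\<close> with zero boundary values, where the gain is \<open>- \<alpha> P\<close>. The Volterra
  transformation \<open>w(x) = u(x) - \<integral>\<^sub>x\<^sup>s q(x, y) u(y) dy\<close>, whose kernel \<open>q\<close> is the resolvent kernel of \<open>P\<close>, turns this
  into \<open>w\<^sub>t = \<alpha> w\<^sub>x\<^sub>x - lam w\<close>, and it is bounded with bounded inverse in the Sobolev norm, uniformly for
  interfaces below the setpoint. By the maximum principle the interface does not recede.

  Only continuity of \<open>u\<close> is available as \<open>t\<close> tends to \<open>0\<close>, and no mixed derivative for \<open>t > 0\<close>, so the Dirichlet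
  energy \<open>\<integral> w\<^sub>x\<^sup>2 / 2\<close> is replaced by its Moreau-Yosida regularization
  \<open>E\<^sub>\<mu>(w) = min\<^sub>z \<integral> z\<^sub>x\<^sup>2 / 2 + \<integral> (z - w)\<^sup>2 / (2 \<mu>)\<close> over functions \<open>z\<close> vanishing at both ends. It is continuous in
  the mean square norm and increases to the Dirichlet energy as \<open>\<mu>\<close> tends to \<open>0\<close>. As the interface moves
  outwards, the zero extension of the minimizer at time \<open>t\<close> is a competitor at later times, which gives
  \<open>D\<^sup>+ E\<^sub>\<mu> \<le> - 2 lam E\<^sub>\<mu>\<close> from \<open>w\<^sub>t\<close> alone.
\<close>

subsection \<open>Bessel series and Volterra kernels\<close>

text \<open>The right-hand side of the claim sees only a weak derivative of the initial error, and
  nothing is known about u_x as t tends to 0, so an identity for the Dirichlet energy cannot be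
  started at t = 0. The regularized energy can: for every \<mu> its value at time 0 is at most half
  the integral of the squared weak derivative of w, a bound free of \<mu>. The limit \<mu> -> 0 is
  taken only at a fixed later time, where w is twice differentiable.

  The rate comes from the damping alone; diffusion enters through its sign. The mean square part of
  the norm needs no decay estimate of its own: q vanishes at x = 0, hence w(0) = 0, and the
  Dirichlet energy of w controls sup |w|, then sup |u|, then u_x. The moving upper limit s(t) adds
  no term to w_t because u(s) = 0. All constants come from bounds of the kernels on a square
  \<open>{0..R}\<close> x \<open>{0..R}\<close> with R fixed by the setpoint, hence they are the
  same for all solutions.\<close>

definition bess :: "nat \<Rightarrow> real \<Rightarrow> real" where
  "bess k a = (\<Sum>m. a ^ m / (fact m * fact (m + k)))"

lemma summable_bess: "summable (\<lambda>m. (a::real) ^ m / (fact m * fact (m + k)))"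
proof (rule summable_comparison_test)
  show "\<exists>N. \<forall>n\<ge>N. norm (a ^ n / (fact n * fact (n + k))) \<le> norm a ^ n / fact n"
  proof (intro exI allI impI)
    fix n :: nat
    have "(1::real) \<le> fact (n + k)" by (rule fact_ge_1)
    then have "norm a ^ n / fact n * 1 / fact (n + k) \<le> norm a ^ n / fact n * 1 / 1"
      by (intro divide_left_mono) auto
    then show "norm (a ^ n / (fact n * fact (n + k))) \<le> norm a ^ n / fact n"
      by (simp add: power_abs abs_mult)
  qed
  show "summable (\<lambda>n. norm a ^ n / fact n)"
    using summable_exp[of "norm a"] by (simp add: field_simps)
qed

lemma bess_0 [simp]: "bess k 0 = 1 / fact k"
proof -
  have "bess k 0 = (\<Sum>m. 1 / (fact m * fact (m + k)) * 0 ^ m)" by (simp add: bess_def)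
  also have "\<dots> = 1 / fact k" by (subst powser_zero) simp
  finally show ?thesis .
qed

text \<open>\<open>bess k a\<close> is I_k(z) / (z/2)^k at a = z^2/4, and the same with J_k at a = -
  z^2/4. In this variable differentiation only raises the index, and neither square roots nor a
  special case z = 0 appear.\<close>

lemma DERIV_bess: "(bess k has_real_derivative bess (Suc k) a) (at a)"
proof -
  define c :: "nat \<Rightarrow> real" where "c = (\<lambda>m. 1 / (fact m * fact (m + k)))"
  have "summable (\<lambda>n. c n * y ^ n)" for y
    using summable_bess[of y k] by (simp add: c_def)
  then have "((\<lambda>x. \<Sum>n. c n * x ^ n) has_field_derivative (\<Sum>n. diffs c n * a ^ n)) (at a)"
    by (rule termdiffs_strong_converges_everywhere)
  moreover have "diffs c n = 1 / (fact n * fact (n + Suc k))" for n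
  proof -
    have "diffs c n = real (Suc n) / (real (Suc n) * (fact n * fact (n + Suc k)))"
      by (simp add: diffs_def c_def algebra_simps)
    then show ?thesis by (simp del: of_nat_Suc)
  qed
  moreover have "(\<lambda>x. \<Sum>n. c n * x ^ n) = bess k"
    by (simp add: bess_def c_def fun_eq_iff)
  ultimately show ?thesis by (simp add: bess_def)
qed

text \<open>Since 1/(m+k)! = (m+k+1)/(m+k+1)!, each coefficient splits into a multiple k+1 and a
  multiple m; the latter cancels against m! and shifts the series. As \<open>bess (k + 1)\<close>
  and \<open>bess (k + 2)\<close> are the first two derivatives, this is Bessel's equation.\<close>

lemma bess_recurrence: "bess k a = real (k + 1) * bess (k + 1) a + a * bess (k + 2) a"
proof -
  define f where "f m = a ^ m * real m / (fact m * fact (m + k + 1))" for m :: nat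
  have f0: "f 0 = 0" by (simp add: f_def)
  have fS: "f (Suc m) = a * (a ^ m / (fact m * fact (m + (k + 2))))" for m
  proof -
    have "f (Suc m) = a * a ^ m * real (Suc m) / (real (Suc m) * fact m * fact (m + (k + 2)))"
      by (simp add: f_def)
    then show ?thesis by (simp del: of_nat_Suc)
  qed
  have sf': "(\<lambda>m. f (Suc m)) sums (a * bess (k + 2) a)"
    unfolding fS bess_def by (intro sums_mult summable_sums summable_bess)
  then have sf: "f sums (a * bess (k + 2) a)"
    using sums_Suc_iff[of f] f0 by simp
  have "(\<lambda>m. real (k + 1) * (a ^ m / (fact m * fact (m + (k + 1)))) + f m) sums
      (real (k + 1) * bess (k + 1) a + a * bess (k + 2) a)"
    unfolding bess_def by (intro sums_add sums_mult summable_sums summable_bess sf[unfolded bess_def])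
  moreover have "real (k + 1) * (a ^ m / (fact m * fact (m + (k + 1)))) + f m
      = a ^ m / (fact m * fact (m + k))" for m
  proof -
    have "real (k + 1) * (a ^ m / (fact m * fact (m + (k + 1)))) + f m
       = real (m + k + 1) * a ^ m / (fact m * (real (m + k + 1) * fact (m + k)))"
      by (simp add: f_def add_divide_distrib [symmetric] algebra_simps)
    then show ?thesis by (simp del: of_nat_Suc of_nat_add)
  qed
  ultimately have "(\<lambda>m. a ^ m / (fact m * fact (m + k))) sums
      (real (k + 1) * bess (k + 1) a + a * bess (k + 2) a)" by simp
  then show ?thesis by (simp add: bess_def sums_iff)
qed

lemma DERIV_bess_chain [derivative_intros]:
  assumes "(g has_real_derivative g') (at x within S)"
  shows "((\<lambda>x. bess k (g x)) has_real_derivative bess (Suc k) (g x) * g') (at x within S)"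
  using DERIV_chain2[OF DERIV_bess assms] .

lemma continuous_on_bess [continuous_intros]:
  assumes "continuous_on S g"
  shows "continuous_on S (\<lambda>x. bess k (g x))"
proof -
  have "continuous_on UNIV (bess k)"
    using DERIV_bess DERIV_isCont by (blast intro: continuous_at_imp_continuous_on)
  from continuous_on_compose2[OF this assms] show ?thesis by simp
qed

lemma bessel_I1_quot_eq: "bessel_I1_quot z = bess 1 (z\<^sup>2 / 4) / 2"
proof (cases "z = 0")
  case True
  then show ?thesis by (simp add: bessel_I1_quot_def)
next
  case False
  have "bessel_I 1 z = (\<Sum>m. z / 2 * ((z\<^sup>2 / 4) ^ m / (fact m * fact (m + 1))))"
    by (simp add: bessel_I_def power_mult power_divide mult.assoc)
  also have "\<dots> = z / 2 * bess 1 (z\<^sup>2 / 4)"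
    unfolding bess_def by (intro suminf_mult summable_bess)
  finally show ?thesis using False by (simp add: bessel_I1_quot_def)
qed

lemma observer_gain_eq:
  assumes "\<alpha> > 0" "lam > 0" "0 \<le> x" "x \<le> l"
  shows "observer_gain \<alpha> lam x l = - (lam * x / 2 * bess 1 (lam / \<alpha> * (l\<^sup>2 - x\<^sup>2) / 4))"
proof -
  have "0 \<le> lam / \<alpha> * (l\<^sup>2 - x\<^sup>2)"
    using assms by (intro mult_nonneg_nonneg) (auto intro: power_mono)
  then show ?thesis by (simp add: observer_gain_def bessel_I1_quot_eq)
qed

section \<open>The kernels of the transformation and the equations they satisfy\<close>

text \<open>The kernel q of the overview. For x < y it is c x J_1(r)/r with r = sqrt(c (y^2 - x^2));
  the kernel P is the same expression with I_1.\<close>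

definition kern :: "real \<Rightarrow> real \<Rightarrow> real \<Rightarrow> real" where
  "kern c x y = c * x / 2 * bess 1 (c * (x\<^sup>2 - y\<^sup>2) / 4)"

definition kern_x :: "real \<Rightarrow> real \<Rightarrow> real \<Rightarrow> real" where
  "kern_x c x y = c / 2 * bess 1 (c * (x\<^sup>2 - y\<^sup>2) / 4)
     + (c * x / 2)\<^sup>2 * bess 2 (c * (x\<^sup>2 - y\<^sup>2) / 4)"

definition kern_xx :: "real \<Rightarrow> real \<Rightarrow> real \<Rightarrow> real" where
  "kern_xx c x y = 3 * c / 2 * (c * x / 2) * bess 2 (c * (x\<^sup>2 - y\<^sup>2) / 4)
     + (c * x / 2) ^ 3 * bess 3 (c * (x\<^sup>2 - y\<^sup>2) / 4)"

definition kern_y :: "real \<Rightarrow> real \<Rightarrow> real \<Rightarrow> real" where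
  "kern_y c x y = - (c * x / 2 * (c * y / 2) * bess 2 (c * (x\<^sup>2 - y\<^sup>2) / 4))"

definition kern_yy :: "real \<Rightarrow> real \<Rightarrow> real \<Rightarrow> real" where
  "kern_yy c x y = - (c * x / 2 * (c / 2) * bess 2 (c * (x\<^sup>2 - y\<^sup>2) / 4))
     + c * x / 2 * (c * y / 2)\<^sup>2 * bess 3 (c * (x\<^sup>2 - y\<^sup>2) / 4)"

text \<open>The kernel P: by \<open>observer_gain_eq\<close> the observer gain is
  \<open>- (\<alpha> * kern_inv (lam / \<alpha>) x s)\<close>.\<close>

definition kern_inv :: "real \<Rightarrow> real \<Rightarrow> real \<Rightarrow> real" where
  "kern_inv c x y = c * x / 2 * bess 1 (c * (y\<^sup>2 - x\<^sup>2) / 4)"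

lemma DERIV_kern_x: "((\<lambda>x. kern c x y) has_real_derivative kern_x c x y) (at x within S)"
  unfolding kern_def kern_x_def
  by (auto intro!: derivative_eq_intros simp: field_simps power2_eq_square numeral_2_eq_2)

lemma DERIV_kern_xx: "((\<lambda>x. kern_x c x y) has_real_derivative kern_xx c x y) (at x within S)"
  unfolding kern_x_def kern_xx_def
  by (auto intro!: derivative_eq_intros simp: field_simps power2_eq_square power3_eq_cube numeral_2_eq_2 numeral_3_eq_3)

lemma DERIV_kern_y: "((\<lambda>y. kern c x y) has_real_derivative kern_y c x y) (at y within S)"
  unfolding kern_def kern_y_def
  by (auto intro!: derivative_eq_intros simp: field_simps power2_eq_square numeral_2_eq_2)

lemma DERIV_kern_yy: "((\<lambda>y. kern_y c x y) has_real_derivative kern_yy c x y) (at y within S)"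
  unfolding kern_y_def kern_yy_def
  by (auto intro!: derivative_eq_intros simp: field_simps power2_eq_square power3_eq_cube numeral_2_eq_2 numeral_3_eq_3)

text \<open>Both second derivatives are combinations of \<open>bess 2\<close> and
  \<open>bess 3\<close>; Bessel's equation of index 1 collects their difference into
  \<open>bess 1\<close>. This equation produces the nonlocal part of the damping in
  \<open>volt_intertwines\<close>.\<close>

lemma kern_pde: "kern_xx c x y - kern_yy c x y = c * kern c x y"
proof -
  define a where "a = c * (x\<^sup>2 - y\<^sup>2) / 4"
  have r: "bess 1 a = 2 * bess 2 a + a * bess 3 a"
    using bess_recurrence[of 1 a] by (simp add: numeral_3_eq_3 numeral_2_eq_2)
  show ?thesis
    unfolding kern_xx_def kern_yy_def kern_def a_def[symmetric] r
    by (simp add: a_def field_simps power2_eq_square power3_eq_cube)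
qed

text \<open>The derivative c / 2 of q along the diagonal enters \<open>volt_intertwines\<close>
  twice and so yields the local part c u(x) of the damping.\<close>

lemma kern_diag: "kern c x x = c * x / 2" "kern_x c x x + kern_y c x x = c / 2"
  by (simp_all add: kern_def kern_x_def kern_y_def power2_eq_square)

lemma kern_0 [simp]: "kern c 0 y = 0"
  by (simp add: kern_def)

lemma continuous_on_kern [continuous_intros]:
  assumes "continuous_on S f" "continuous_on S g"
  shows "continuous_on S (\<lambda>z. kern c (f z) (g z))"
    "continuous_on S (\<lambda>z. kern_x c (f z) (g z))"
    "continuous_on S (\<lambda>z. kern_xx c (f z) (g z))"
    "continuous_on S (\<lambda>z. kern_y c (f z) (g z))"
    "continuous_on S (\<lambda>z. kern_yy c (f z) (g z))"
    "continuous_on S (\<lambda>z. kern_inv c (f z) (g z))"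
  unfolding kern_def kern_x_def kern_xx_def kern_y_def kern_yy_def kern_inv_def
  by (intro continuous_intros assms; simp)+

text \<open>With \<open>\<eta> = c (y\<^sup>2 - x\<^sup>2) / 4\<close> and \<open>A = c (s\<^sup>2 - x\<^sup>2) / 4\<close> the recurrence gives
  \<open>d/d\<eta> (\<eta> F\<^sub>1(-\<eta>) F\<^sub>0(A - \<eta>) + (A - \<eta>) F\<^sub>0(-\<eta>) F\<^sub>1(A - \<eta>)) = - A F\<^sub>1(-\<eta>) F\<^sub>1(A - \<eta>)\<close>,
  where \<open>F\<^sub>k\<close> stands for \<open>bess k\<close>.\<close>

lemma kern_resolvent:
  assumes c: "c > 0" and x: "0 \<le> x" "x \<le> s"
  shows "((\<lambda>y. kern c x y * kern_inv c y s) has_integral (kern_inv c x s - kern c x s)) {x..s}"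
proof (cases "x = s")
  \<comment> \<open>The primitive \<open>G\<close> used in the other case divides by
    \<open>A\<close>, which vanishes here; the interval is a point and the two kernels
    agree.\<close>
  case True
  then show ?thesis
    using has_integral_null_real[of x s] by (simp add: kern_def kern_inv_def)
next
  case False
  define A where "A = c * (s\<^sup>2 - x\<^sup>2) / 4"
  have A: "A > 0"
    using c x False by (auto simp: A_def intro!: mult_pos_pos power_strict_mono)
  define G where "G y = - (c * x / 2) / A * (c * (y\<^sup>2 - x\<^sup>2) / 4 * bess 1 (c * (x\<^sup>2 - y\<^sup>2) / 4)
       * bess 0 (c * (s\<^sup>2 - y\<^sup>2) / 4)
     + c * (s\<^sup>2 - y\<^sup>2) / 4 * bess 0 (c * (x\<^sup>2 - y\<^sup>2) / 4) * bess 1 (c * (s\<^sup>2 - y\<^sup>2) / 4))" for y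
  have r: "bess 0 a = bess 1 a + a * bess 2 a" for a
    using bess_recurrence[of 0 a] by (simp add: numeral_2_eq_2)
  have "(G has_real_derivative kern c x y * kern_inv c y s) (at y within {x..s})" for y
  proof -
    define p where "p = c * (x\<^sup>2 - y\<^sup>2) / 4"
    define m where "m = c * (s\<^sup>2 - y\<^sup>2) / 4"
    have e: "c * (y\<^sup>2 - x\<^sup>2) / 4 = - p" by (simp add: p_def field_simps)
    have Am: "A = m - p" by (simp add: A_def m_def p_def field_simps)
    have d: "((\<lambda>y. c * (a - y\<^sup>2) / 4) has_real_derivative - (c * y / 2)) (at y within {x..s})"
      "((\<lambda>y. c * (y\<^sup>2 - a) / 4) has_real_derivative c * y / 2) (at y within {x..s})" for a
      by (auto intro!: derivative_eq_intros)
    have "(G has_real_derivative - (c * x / 2) / A * (c * y / 2 * bess 1 p * bess 0 m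
        + (- p) * (bess 2 p * (- (c * y / 2))) * bess 0 m + (- p) * bess 1 p * (bess 1 m * (- (c * y / 2)))
        + (- (c * y / 2)) * bess 0 p * bess 1 m + m * (bess 1 p * (- (c * y / 2))) * bess 1 m
        + m * bess 0 p * (bess 2 m * (- (c * y / 2))))) (at y within {x..s})"
      unfolding G_def
      apply (rule DERIV_cong)
       apply (rule DERIV_cmult DERIV_add DERIV_mult DERIV_bess_chain d)+
      apply (rule arg_cong[where f="\<lambda>z. - (c * x / 2) / A * z"])
      unfolding p_def [symmetric] m_def [symmetric] e
      apply (simp add: numeral_2_eq_2 algebra_simps)
      done
    also have "- (c * x / 2) / A * (c * y / 2 * bess 1 p * bess 0 m
        + (- p) * (bess 2 p * (- (c * y / 2))) * bess 0 m + (- p) * bess 1 p * (bess 1 m * (- (c * y / 2)))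
        + (- (c * y / 2)) * bess 0 p * bess 1 m + m * (bess 1 p * (- (c * y / 2))) * bess 1 m
        + m * bess 0 p * (bess 2 m * (- (c * y / 2))))
      = - (c * x / 2) / A * (- (c * y / 2) * (m - p) * bess 1 p * bess 1 m)"
      unfolding r
      by (rule arg_cong[where f="\<lambda>z. - (c * x / 2) / A * z"]) (simp add: field_simps)
    also have "\<dots> = c * x / 2 * bess 1 p * (c * y / 2 * bess 1 m)"
      using A unfolding Am by (simp add: field_simps)
    also have "\<dots> = kern c x y * kern_inv c y s"
      by (simp add: kern_def kern_inv_def p_def m_def)
    finally show ?thesis .
  qed
  then have "((\<lambda>y. kern c x y * kern_inv c y s) has_integral (G s - G x)) {x..s}"
    using x by (intro fundamental_theorem_of_calculus)
      (auto simp: has_real_derivative_iff_has_vector_derivative[symmetric])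
  moreover have "G s - G x = kern_inv c x s - kern c x s"
  proof -
    have "c * (x\<^sup>2 - s\<^sup>2) / 4 = - A" "c * (s\<^sup>2 - x\<^sup>2) / 4 = A" by (simp_all add: A_def field_simps)
    then have "G s = - (c * x / 2) * bess 1 (- A)" "G x = - (c * x / 2) * bess 1 A"
      unfolding G_def using A by simp_all
    then show ?thesis
      by (simp add: kern_def kern_inv_def \<open>c * (x\<^sup>2 - s\<^sup>2) / 4 = - A\<close> A_def [symmetric])
  qed
  ultimately show ?thesis by simp
qed

subsection \<open>The Volterra transformation\<close>

text \<open>The integral over \<open>{x..b}\<close> is the one over \<open>{a..b}\<close> minus the
  one over \<open>{a..x}\<close>. The first is differentiated under the integral sign, the second by
  the chain rule, since x occurs both in its integrand and in its limit.\<close>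

lemma DERIV_integral_lower_limit:
  fixes h hx :: "real \<Rightarrow> real \<Rightarrow> real" and u :: "real \<Rightarrow> real"
  assumes h: "\<And>x y. ((\<lambda>x. h x y) has_real_derivative hx x y) (at x within {a..b})"
    and conth: "continuous_on UNIV (\<lambda>(x, y). h x y)"
    and conthx: "continuous_on UNIV (\<lambda>(x, y). hx x y)"
    and u: "continuous_on {a..b} u" and x: "x \<in> {a..b}"
  shows "((\<lambda>x. integral {x..b} (\<lambda>y. h x y * u y)) has_real_derivative
     integral {x..b} (\<lambda>y. hx x y * u y) - h x x * u x) (at x within {a..b})"
proof -
  have ch [continuous_intros]: "continuous_on S (\<lambda>z. h (f z) (g z))"
    if "continuous_on S f" "continuous_on S g" for S :: "'z::topological_space set" and f g
    using continuous_on_compose2[OF conth continuous_on_Pair[OF that]] by simp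
  have chx [continuous_intros]: "continuous_on S (\<lambda>z. hx (f z) (g z))"
    if "continuous_on S f" "continuous_on S g" for S :: "'z::topological_space set" and f g
    using continuous_on_compose2[OF conthx continuous_on_Pair[OF that]] by simp
  have cu [continuous_intros]: "continuous_on S (\<lambda>z. u (f z))"
    if "continuous_on S f" "f ` S \<subseteq> {a..b}" for S :: "'z::topological_space set" and f
    using continuous_on_compose2[OF u that] by simp
  have cu': "continuous_on S u" if "S \<subseteq> {a..b}" for S
    using u that by (rule continuous_on_subset)
  have int: "(\<lambda>y. h z y * u y) integrable_on {c..d}" if "a \<le> c" "d \<le> b" for z c d
    using that by (intro integrable_continuous_interval continuous_intros) auto
  have int': "(\<lambda>y. hx z y * u y) integrable_on {c..d}" if "a \<le> c" "d \<le> b" for z c d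
    using that by (intro integrable_continuous_interval continuous_intros) auto
  have leib: "((\<lambda>x. integral {a..d} (\<lambda>y. h x y * u y)) has_real_derivative
      integral {a..d} (\<lambda>y. hx z y * u y)) (at z within {a..b})" if "d \<le> b" "z \<in> {a..b}" for z d
    unfolding box_real(2)[symmetric]
  proof (rule leibniz_rule_field_derivative)
    show "((\<lambda>x. h x t * u t) has_real_derivative hx x t * u t) (at x within cbox a b)" for x t
      using DERIV_cmult_right[OF h[of t x], of "u t"] by simp
    show "continuous_on (cbox a b \<times> cbox a d) (\<lambda>(x, t). hx x t * u t)"
      unfolding split_beta using that by (intro continuous_intros) auto
  qed (use that int[of a d] in \<open>auto simp: convex_real_interval\<close>)
  \<comment> \<open>The two occurrences of x become separate variables; with continuous partial
    derivatives \<Phi> is differentiable on the square, and the derivative is then restricted to the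
    diagonal.\<close>
  define \<Phi> where "\<Phi> x1 x2 = integral {a..x2} (\<lambda>y. h x1 y * u y)" for x1 x2
  have "((\<lambda>(x, y). \<Phi> x y) has_derivative
     (\<lambda>(tx, ty). integral {a..x} (\<lambda>y. hx x y * u y) * tx
        + blinfun_apply (blinfun_mult_right (h x x * u x)) ty)) (at (x, x) within {a..b} \<times> {a..b})"
  proof (rule has_derivative_partialsI[where f=\<Phi> and fy="\<lambda>x y. blinfun_mult_right (h x y * u y)"])
    show "((\<lambda>z. \<Phi> z x) has_derivative (*) (integral {a..x} (\<lambda>y. hx x y * u y))) (at x within {a..b})"
      using leib[of x x] x by (simp add: \<Phi>_def has_field_derivative_def)
    show "(\<Phi> z has_derivative blinfun_apply (blinfun_mult_right (h z y * u y))) (at y within {a..b})"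
      if "z \<in> {a..b}" "y \<in> {a..b}" for z y
    proof -
      have "(\<Phi> z has_real_derivative h z y * u y) (at y within {a..b})"
        unfolding \<Phi>_def has_real_derivative_iff_has_vector_derivative
        using that by (intro integral_has_vector_derivative continuous_intros cu') auto
      then show ?thesis by (simp add: has_field_derivative_def)
    qed
    have "continuous_on ({a..b} \<times> {a..b}) (\<lambda>z. blinfun_mult_right (h (fst z) (snd z) * u (snd z)))"
      by (intro bounded_linear.continuous_on[OF bounded_linear_blinfun_mult_right] continuous_intros) auto
    then have "continuous (at (x, x) within {a..b} \<times> {a..b})
        (\<lambda>z. blinfun_mult_right (h (fst z) (snd z) * u (snd z)))"
      unfolding continuous_on_eq_continuous_within using x by blast
    then show "continuous (at (x, x) within {a..b} \<times> {a..b})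
        (\<lambda>(x, y). blinfun_mult_right (h x y * u y))"
      by (simp only: case_prod_beta')
  qed (use x in auto)
  then have 1: "((\<lambda>(x, y). \<Phi> x y) has_derivative
     (\<lambda>(tx, ty). integral {a..x} (\<lambda>y. hx x y * u y) * tx
        + blinfun_apply (blinfun_mult_right (h x x * u x)) ty)) (at (x, x) within (\<lambda>z. (z, z)) ` {a..b})"
    by (rule has_derivative_subset) auto
  have "((\<lambda>z. (z, z)) has_derivative (\<lambda>t. (t, t))) (at x within {a..b})"
    by (intro has_derivative_Pair has_derivative_ident)
  from has_derivative_in_compose[OF this 1]
  have "((\<lambda>z. \<Phi> z z) has_derivative
      (\<lambda>t. integral {a..x} (\<lambda>y. hx x y * u y) * t + h x x * u x * t)) (at x within {a..b})"
    by simp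
  then have "((\<lambda>z. \<Phi> z z) has_real_derivative integral {a..x} (\<lambda>y. hx x y * u y) + h x x * u x)
      (at x within {a..b})"
    by (rule has_derivative_imp_has_field_derivative) (auto simp: algebra_simps)
  from DERIV_diff[OF leib[of b x] this]
  have "((\<lambda>z. integral {a..b} (\<lambda>y. h z y * u y) - \<Phi> z z) has_real_derivative
      integral {a..b} (\<lambda>y. hx x y * u y) - (integral {a..x} (\<lambda>y. hx x y * u y) + h x x * u x))
      (at x within {a..b})" using x by auto
  moreover have "integral {a..b} (\<lambda>y. hx x y * u y) - integral {a..x} (\<lambda>y. hx x y * u y)
      = integral {x..b} (\<lambda>y. hx x y * u y)"
    using Henstock_Kurzweil_Integration.integral_combine[of a x b "\<lambda>y. hx x y * u y"] int'[of a b] x by simp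
  moreover have "integral {a..b} (\<lambda>y. h z y * u y) - \<Phi> z z = integral {z..b} (\<lambda>y. h z y * u y)"
    if "z \<in> {a..b}" for z
    using Henstock_Kurzweil_Integration.integral_combine[of a z b "\<lambda>y. h z y * u y"] int[of a b z] that
    by (simp add: \<Phi>_def)
  ultimately show ?thesis
    using has_field_derivative_transform_within[of _ _ x "{a..b}" 1] x
    by (simp add: algebra_simps)
qed

definition volt :: "real \<Rightarrow> real \<Rightarrow> (real \<Rightarrow> real) \<Rightarrow> real \<Rightarrow> real" where
  "volt c s u x = u x - integral {x..s} (\<lambda>y. kern c x y * u y)"

definition volt_x :: "real \<Rightarrow> real \<Rightarrow> (real \<Rightarrow> real) \<Rightarrow> (real \<Rightarrow> real) \<Rightarrow> real \<Rightarrow> real" where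
  "volt_x c s u u' x = u' x + kern c x x * u x - integral {x..s} (\<lambda>y. kern_x c x y * u y)"

text \<open>The terms with factors c / 2 and c x / 2 come from differentiating
  \<open>kern c x x * u x\<close>, whose first factor equals c x / 2.\<close>

definition volt_xx :: "real \<Rightarrow> real \<Rightarrow> (real \<Rightarrow> real) \<Rightarrow> (real \<Rightarrow> real) \<Rightarrow> (real \<Rightarrow> real) \<Rightarrow> real \<Rightarrow> real" where
  "volt_xx c s u u' u'' x = u'' x + c / 2 * u x + c * x / 2 * u' x + kern_x c x x * u x
     - integral {x..s} (\<lambda>y. kern_xx c x y * u y)"

lemma DERIV_kern_integral:
  assumes "continuous_on {0..s} u" "x \<in> {0..s}"
  shows "((\<lambda>x. integral {x..s} (\<lambda>y. kern c x y * u y)) has_real_derivative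
     integral {x..s} (\<lambda>y. kern_x c x y * u y) - kern c x x * u x) (at x within {0..s})"
    "((\<lambda>x. integral {x..s} (\<lambda>y. kern_x c x y * u y)) has_real_derivative
     integral {x..s} (\<lambda>y. kern_xx c x y * u y) - kern_x c x x * u x) (at x within {0..s})"
  unfolding split_beta
  by (rule DERIV_integral_lower_limit[OF DERIV_kern_x _ _ assms],
      (simp add: split_beta, intro continuous_intros)+,
      rule DERIV_integral_lower_limit[OF DERIV_kern_xx _ _ assms],
      (simp add: split_beta, intro continuous_intros)+)

lemma continuous_on_kern_integral:
  assumes "continuous_on {0..s} u"
  shows "continuous_on {0..s} (\<lambda>x. integral {x..s} (\<lambda>y. kern c x y * u y))"
    "continuous_on {0..s} (\<lambda>x. integral {x..s} (\<lambda>y. kern_x c x y * u y))"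
  by (rule DERIV_continuous_on, erule DERIV_kern_integral[OF assms])+

lemma DERIV_volt:
  assumes "continuous_on {0..s} u" "x \<in> {0..s}"
    and "(u has_real_derivative u' x) (at x within {0..s})"
  shows "(volt c s u has_real_derivative volt_x c s u u' x) (at x within {0..s})"
  unfolding volt_def[abs_def] volt_x_def
  by (auto intro!: derivative_eq_intros DERIV_kern_integral assms)

lemma DERIV_volt_x:
  assumes "continuous_on {0..s} u" "x \<in> {0..s}"
    and "(u has_real_derivative u' x) (at x within {0..s})"
    and "(u' has_real_derivative u'' x) (at x within {0..s})"
  shows "(volt_x c s u u' has_real_derivative volt_xx c s u u' u'' x) (at x within {0..s})"
  unfolding volt_x_def[abs_def] volt_xx_def kern_diag
  by (auto intro!: derivative_eq_intros DERIV_kern_integral assms)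

text \<open>Two integrations by parts move the derivatives from u'' to the kernel. At y = s only
  q(x, s) u'(s) survives because u(s) = 0, and the gain term is built to remove it: the resolvent
  identity turns the transform of P(., s) u'(s) into exactly this boundary term. The diagonal terms
  and \<open>kern_pde\<close> leave c times the transform.\<close>

lemma volt_intertwines:
  assumes c: "c > 0" and x: "x \<in> {0..s}"
    and u': "\<And>x. x \<in> {0..s} \<Longrightarrow> (u has_real_derivative u' x) (at x within {0..s})"
    and u'': "\<And>x. x \<in> {0..s} \<Longrightarrow> (u' has_real_derivative u'' x) (at x within {0..s})"
    and cu'': "continuous_on {0..s} u''" and us: "u s = 0"
  shows "volt c s (\<lambda>x. u'' x + kern_inv c x s * u' s) x = volt_xx c s u u' u'' x - c * volt c s u x"
proof -
  have cu: "continuous_on {0..s} u" and cu': "continuous_on {0..s} u'"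
    using u' u'' by (blast intro: DERIV_continuous_on)+
  have sub: "continuous_on {x..s} u" "continuous_on {x..s} u'" "continuous_on {x..s} u''"
    using cu cu' cu'' x by (auto elim!: continuous_on_subset)
  \<comment> \<open>Both integrations by parts at once (Green's identity): the integrand is the
    derivative of q u' - q_y u.\<close>
  have "((\<lambda>y. kern c x y * u'' y - kern_yy c x y * u y) has_integral
      (kern c x s * u' s - kern_y c x s * u s) - (kern c x x * u' x - kern_y c x x * u x)) {x..s}"
  proof (rule fundamental_theorem_of_calculus)
    fix y assume y: "y \<in> {x..s}"
    have "(u has_real_derivative u' y) (at y within {x..s})" "(u' has_real_derivative u'' y) (at y within {x..s})"
      using x y u'[of y] u''[of y] by (auto elim!: DERIV_subset)
    then show "((\<lambda>y. kern c x y * u' y - kern_y c x y * u y) has_vector_derivative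
        kern c x y * u'' y - kern_yy c x y * u y) (at y within {x..s})"
      unfolding has_real_derivative_iff_has_vector_derivative[symmetric]
      by (auto intro!: derivative_eq_intros DERIV_kern_y DERIV_kern_yy)
  qed (use x in auto)
  moreover have iyy: "((\<lambda>y. kern_yy c x y * u y) has_integral integral {x..s} (\<lambda>y. kern_yy c x y * u y)) {x..s}"
    by (intro integrable_integral integrable_continuous_interval continuous_intros sub)
  \<comment> \<open>The part - q(x, s) u'(s) cancels the boundary term above, the part with P
    cancels the undifferentiated gain term.\<close>
  moreover have "((\<lambda>y. kern c x y * kern_inv c y s * u' s) has_integral
      (kern_inv c x s - kern c x s) * u' s) {x..s}"
    using has_integral_mult_left[OF kern_resolvent[OF c, of x s], of "u' s"] x by simp
  ultimately have "((\<lambda>y. (kern c x y * u'' y - kern_yy c x y * u y) + kern_yy c x y * u y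
      + kern c x y * kern_inv c y s * u' s) has_integral
      ((kern c x s * u' s - kern_y c x s * u s) - (kern c x x * u' x - kern_y c x x * u x)
        + integral {x..s} (\<lambda>y. kern_yy c x y * u y) + (kern_inv c x s - kern c x s) * u' s)) {x..s}"
    by (intro has_integral_add)
  then have 1: "integral {x..s} (\<lambda>y. kern c x y * (u'' y + kern_inv c y s * u' s)) =
     - (c * x / 2 * u' x) + kern_y c x x * u x + integral {x..s} (\<lambda>y. kern_yy c x y * u y) + kern_inv c x s * u' s"
    using us by (intro integral_unique) (simp add: algebra_simps kern_diag)
  have "((\<lambda>y. kern_xx c x y * u y) has_integral integral {x..s} (\<lambda>y. kern_xx c x y * u y)) {x..s}"
    "((\<lambda>y. kern c x y * u y) has_integral integral {x..s} (\<lambda>y. kern c x y * u y)) {x..s}"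
    by (intro integrable_integral integrable_continuous_interval continuous_intros sub)+
  from has_integral_diff[OF this(1) has_integral_mult_right[OF this(2), of c]]
  have "((\<lambda>y. kern_yy c x y * u y) has_integral
      integral {x..s} (\<lambda>y. kern_xx c x y * u y) - c * integral {x..s} (\<lambda>y. kern c x y * u y)) {x..s}"
  proof (rule has_integral_eq[rotated])
    show "kern_xx c x y * u y - c * (kern c x y * u y) = kern_yy c x y * u y" for y
      using arg_cong[OF kern_pde[of c x y], of "\<lambda>z. z * u y"] by (simp add: algebra_simps)
  qed
  then have 2: "integral {x..s} (\<lambda>y. kern_yy c x y * u y) =
      integral {x..s} (\<lambda>y. kern_xx c x y * u y) - c * integral {x..s} (\<lambda>y. kern c x y * u y)"
    by (rule integral_unique)
  have 3: "kern_y c x x = c / 2 - kern_x c x x" using kern_diag(2)[of c x] by simp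
  show ?thesis
    unfolding volt_def[of c s "\<lambda>x. u'' x + kern_inv c x s * u' s"] 1 2 3 volt_xx_def volt_def
    by (simp add: algebra_simps)
qed

subsection \<open>Moreau-Yosida regularization of the Dirichlet energy\<close>

lemma continuous_on_Icc_bounded:
  fixes f :: "real \<Rightarrow> real"
  assumes "continuous_on {a..b} f"
  obtains K where "K > 0" "\<And>x. x \<in> {a..b} \<Longrightarrow> \<bar>f x\<bar> \<le> K"
proof -
  have "compact (f ` {a..b})" by (intro compact_continuous_image assms) simp
  then obtain K where "\<forall>y \<in> f ` {a..b}. norm y \<le> K" using compact_imp_bounded bounded_iff by blast
  then have "\<bar>f x\<bar> \<le> max K 1" if "x \<in> {a..b}" for x using that by force
  then show ?thesis using that[of "max K 1"] by simp
qed

lemma integral_by_parts: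
  fixes f g f' g' :: "real \<Rightarrow> real"
  assumes "a \<le> b"
    and f: "\<And>x. x \<in> {a..b} \<Longrightarrow> (f has_real_derivative f' x) (at x within {a..b})"
    and g: "\<And>x. x \<in> {a..b} \<Longrightarrow> (g has_real_derivative g' x) (at x within {a..b})"
    and cf: "continuous_on {a..b} f'" and cg: "continuous_on {a..b} g'"
  shows "integral {a..b} (\<lambda>x. f' x * g x) = f b * g b - f a * g a - integral {a..b} (\<lambda>x. f x * g' x)"
proof -
  have cf0: "continuous_on {a..b} f" "continuous_on {a..b} g"
    by (blast intro: DERIV_continuous_on f g)+
  have "((\<lambda>x. f' x * g x + f x * g' x) has_integral f b * g b - f a * g a) {a..b}"
  proof (rule fundamental_theorem_of_calculus)
    show "((\<lambda>x. f x * g x) has_vector_derivative f' x * g x + f x * g' x) (at x within {a..b})"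
      if "x \<in> {a..b}" for x
      unfolding has_real_derivative_iff_has_vector_derivative[symmetric]
      using DERIV_mult[OF f[OF that] g[OF that]] by (simp add: algebra_simps)
  qed (rule assms)
  moreover have "(\<lambda>x. f' x * g x) integrable_on {a..b}" "(\<lambda>x. f x * g' x) integrable_on {a..b}"
    by (intro integrable_continuous_interval continuous_intros cf cg cf0)+
  ultimately show ?thesis
    by (simp add: Henstock_Kurzweil_Integration.integral_add[symmetric] integral_unique eq_diff_eq)
qed

text \<open>The Euler-Lagrange equation z - \<mu> z'' = w of the minimization, written as a
  first-order system so that it makes sense for continuous w.\<close>

definition yosida_resolvent ::
  "real \<Rightarrow> real \<Rightarrow> (real \<Rightarrow> real) \<Rightarrow> (real \<Rightarrow> real) \<Rightarrow> (real \<Rightarrow> real) \<Rightarrow> bool" where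
  "yosida_resolvent \<mu> s w z zx \<longleftrightarrow> z 0 = 0 \<and> z s = 0 \<and>
     (\<forall>x\<in>{0..s}. (z has_real_derivative zx x) (at x within {0..s}) \<and>
       (zx has_real_derivative (z x - w x) / \<mu>) (at x within {0..s}))"

text \<open>The value of the minimum at the minimizer z. Testing the Euler-Lagrange equation with z
  turns the sum of two squares into this pairing; \<open>yosida_energy\<close> is the
  translation.\<close>

definition yosida :: "real \<Rightarrow> real \<Rightarrow> (real \<Rightarrow> real) \<Rightarrow> (real \<Rightarrow> real) \<Rightarrow> real" where
  "yosida \<mu> s w z = integral {0..s} (\<lambda>x. w x * (w x - z x)) / (2 * \<mu>)"

lemma yosida_resolvent_exists:
  assumes "s > 0" "\<mu> > 0" and w: "continuous_on {0..s} w"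
  obtains z zx where "yosida_resolvent \<mu> s w z zx"
proof -
  define k where "k = 1 / sqrt \<mu>"
  have k: "k > 0" "k * k = 1 / \<mu>" using \<open>\<mu> > 0\<close> by (auto simp: k_def)
  define A where "A x = integral {0..x} (\<lambda>y. cosh (k * y) * w y)" for x
  define B where "B x = integral {0..x} (\<lambda>y. sinh (k * y) * w y)" for x
  have A: "(A has_real_derivative cosh (k * x) * w x) (at x within {0..s})"
    and B: "(B has_real_derivative sinh (k * x) * w x) (at x within {0..s})" if "x \<in> {0..s}" for x
    unfolding A_def[abs_def] B_def[abs_def] has_real_derivative_iff_has_vector_derivative
    using that by (auto intro!: integral_has_vector_derivative continuous_intros w)
  \<comment> \<open>Variation of constants: p is - k times the integral of sinh (k (x - y)) w(y)
    over \<open>{0..x}\<close>, split by the addition theorem so that x leaves the integrand. It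
    solves p'' = k^2 (p - w) with p(0) = 0.\<close>
  define p where "p x = - k * (sinh (k * x) * A x - cosh (k * x) * B x)" for x
  define px where "px x = - k * k * (cosh (k * x) * A x - sinh (k * x) * B x)" for x
  \<comment> \<open>Subtracting this multiple of the homogeneous solution sinh (k x) gives the value
    0 at s and keeps the one at 0.\<close>
  define d where "d = p s / sinh (k * s)"
  have ks: "sinh (k * s) \<noteq> 0" using k \<open>s > 0\<close> by simp
  have "yosida_resolvent \<mu> s w (\<lambda>x. p x - d * sinh (k * x)) (\<lambda>x. px x - d * k * cosh (k * x))"
    unfolding yosida_resolvent_def
  proof (intro conjI ballI)
    show "p 0 - d * sinh (k * 0) = 0" by (simp add: p_def A_def B_def)
    show "p s - d * sinh (k * s) = 0" using ks by (simp add: d_def)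
    fix x assume x: "x \<in> {0..s}"
    have sh: "((\<lambda>x. sinh (k * x)) has_real_derivative cosh (k * x) * k) (at x within {0..s})"
      and ch: "((\<lambda>x. cosh (k * x)) has_real_derivative sinh (k * x) * k) (at x within {0..s})"
      by (auto intro!: derivative_eq_intros)
    have "(p has_real_derivative px x) (at x within {0..s})"
      unfolding p_def[abs_def] px_def
      by (rule DERIV_cong[OF DERIV_cmult[OF DERIV_diff[OF DERIV_mult[OF sh A[OF x]] DERIV_mult[OF ch B[OF x]]]]])
        (simp add: algebra_simps)
    then show "((\<lambda>x. p x - d * sinh (k * x)) has_real_derivative px x - d * k * cosh (k * x))
        (at x within {0..s})"
      by (rule DERIV_cong[OF DERIV_diff[OF _ DERIV_cmult[OF sh]]]) (auto simp: mult_ac)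
    have "(px has_real_derivative k * k * p x - k * k * (cosh (k * x) ^ 2 - sinh (k * x) ^ 2) * w x)
        (at x within {0..s})"
      unfolding p_def px_def[abs_def]
      by (rule DERIV_cong[OF DERIV_cmult[OF DERIV_diff[OF DERIV_mult[OF ch A[OF x]] DERIV_mult[OF sh B[OF x]]]]])
        (simp add: algebra_simps power2_eq_square)
    then have "(px has_real_derivative k * k * p x - k * k * w x) (at x within {0..s})"
      by (simp add: hyperbolic_pythagoras)
    then have "((\<lambda>x. px x - d * k * cosh (k * x)) has_real_derivative
        k * k * p x - k * k * w x - d * k * (sinh (k * x) * k)) (at x within {0..s})"
      by (rule DERIV_diff[OF _ DERIV_cmult[OF ch]])
    also have "k * k * p x - k * k * w x - d * k * (sinh (k * x) * k)
      = k * k * (p x - d * sinh (k * x) - w x)" by (simp add: algebra_simps)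
    finally show "((\<lambda>x. px x - d * k * cosh (k * x)) has_real_derivative
        (p x - d * sinh (k * x) - w x) / \<mu>) (at x within {0..s})"
      unfolding k by simp
  qed
  then show ?thesis by (rule that)
qed

context
  fixes \<mu> s :: real and w z zx :: "real \<Rightarrow> real"
  assumes mu: "\<mu> > 0" and s: "s \<ge> 0" and cw: "continuous_on {0..s} w"
    and res: "yosida_resolvent \<mu> s w z zx"
begin

lemma yosida_resolvent_DERIV:
  assumes "x \<in> {0..s}"
  shows "(z has_real_derivative zx x) (at x within {0..s})"
    "(zx has_real_derivative (z x - w x) / \<mu>) (at x within {0..s})"
  using res assms by (auto simp: yosida_resolvent_def)

lemma yosida_resolvent_ends: "z 0 = 0" "z s = 0"
  using res by (auto simp: yosida_resolvent_def)

lemma yosida_resolvent_continuous_on: "continuous_on {0..s} z" "continuous_on {0..s} zx"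
  by (rule DERIV_continuous_on, erule yosida_resolvent_DERIV)+

lemmas yosida_cont = cw yosida_resolvent_continuous_on

text \<open>The weak form of the resolvent equation. The test function z gives the energy identity,
  w - z the sign of the dissipation, and w the comparison with the Dirichlet energy.\<close>

lemma yosida_resolvent_weak:
  assumes f: "\<And>x. x \<in> {0..s} \<Longrightarrow> (f has_real_derivative f' x) (at x within {0..s})"
    and cf: "continuous_on {0..s} f'" and "f 0 = 0" "f s = 0"
  shows "\<mu> * integral {0..s} (\<lambda>x. f' x * zx x) = integral {0..s} (\<lambda>x. f x * (w x - z x))"
proof -
  have "integral {0..s} (\<lambda>x. f' x * zx x) = - integral {0..s} (\<lambda>x. f x * ((z x - w x) / \<mu>))"
    using integral_by_parts[OF s f yosida_resolvent_DERIV(2) cf, simplified] assms mu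
    by (simp add: continuous_intros yosida_cont)
  also have "\<dots> = integral {0..s} (\<lambda>x. f x * (w x - z x)) / \<mu>"
  proof -
    have "integral {0..s} (\<lambda>x. f x * (w x - z x)) = integral {0..s} (\<lambda>x. - \<mu> * (f x * ((z x - w x) / \<mu>)))"
      using mu by (intro arg_cong[where f="integral {0..s}"] ext) (simp add: field_simps)
    then show ?thesis using mu by simp
  qed
  finally show ?thesis using mu by simp
qed

lemma yosida_energy:
  "2 * \<mu> * yosida \<mu> s w z = \<mu> * integral {0..s} (\<lambda>x. (zx x)\<^sup>2) + integral {0..s} (\<lambda>x. (w x - z x)\<^sup>2)"
proof -
  have "integral {0..s} (\<lambda>x. w x * (w x - z x))
      = integral {0..s} (\<lambda>x. z x * (w x - z x) + (w x - z x)\<^sup>2)"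
    by (intro arg_cong[where f="integral {0..s}"] ext) (simp add: algebra_simps power2_eq_square)
  also have "\<dots> = integral {0..s} (\<lambda>x. z x * (w x - z x)) + integral {0..s} (\<lambda>x. (w x - z x)\<^sup>2)"
    by (intro Henstock_Kurzweil_Integration.integral_add integrable_continuous_interval continuous_intros yosida_cont)
  also have "integral {0..s} (\<lambda>x. z x * (w x - z x)) = \<mu> * integral {0..s} (\<lambda>x. zx x * zx x)"
    by (rule yosida_resolvent_weak[symmetric])
      (auto intro: yosida_resolvent_DERIV yosida_cont simp: yosida_resolvent_ends)
  finally show ?thesis using mu by (simp add: yosida_def power2_eq_square)
qed

lemma yosida_nonneg: "0 \<le> yosida \<mu> s w z"
  and yosida_dist: "integral {0..s} (\<lambda>x. (w x - z x)\<^sup>2) \<le> 2 * \<mu> * yosida \<mu> s w z"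
  and yosida_deriv: "integral {0..s} (\<lambda>x. (zx x)\<^sup>2) \<le> 2 * yosida \<mu> s w z"
proof -
  have "0 \<le> integral {0..s} (\<lambda>x. (zx x)\<^sup>2)" "0 \<le> integral {0..s} (\<lambda>x. (w x - z x)\<^sup>2)"
    by (intro Henstock_Kurzweil_Integration.integral_nonneg integrable_continuous_interval continuous_intros yosida_cont; simp)+
  moreover have "0 \<le> \<mu> * integral {0..s} (\<lambda>x. (zx x)\<^sup>2)" using calculation mu by simp
  ultimately have "0 \<le> \<mu> * (2 * yosida \<mu> s w z)"
    "\<mu> * integral {0..s} (\<lambda>x. (zx x)\<^sup>2) \<le> \<mu> * (2 * yosida \<mu> s w z)"
    "integral {0..s} (\<lambda>x. (w x - z x)\<^sup>2) \<le> 2 * \<mu> * yosida \<mu> s w z"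
    using yosida_energy by linarith+
  then show "0 \<le> yosida \<mu> s w z" "integral {0..s} (\<lambda>x. (zx x)\<^sup>2) \<le> 2 * yosida \<mu> s w z"
    "integral {0..s} (\<lambda>x. (w x - z x)\<^sup>2) \<le> 2 * \<mu> * yosida \<mu> s w z"
    using mu by (simp_all add: zero_le_mult_iff)
qed

text \<open>The bound that the competitor 0 gives in the minimization. It uses no derivative of w,
  hence is available at time 0 as well.\<close>

lemma yosida_le_L2: "2 * \<mu> * yosida \<mu> s w z \<le> integral {0..s} (\<lambda>x. (w x)\<^sup>2)"
proof -
  have "2 * (2 * \<mu> * yosida \<mu> s w z) = integral {0..s} (\<lambda>x. 2 * (w x * (w x - z x)))"
    using mu by (simp add: yosida_def)
  also have "\<dots> \<le> integral {0..s} (\<lambda>x. (w x)\<^sup>2 + (w x - z x)\<^sup>2)"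
    by (intro integral_le integrable_continuous_interval continuous_intros yosida_cont) (rule sum_squares_bound[simplified mult.assoc])
  also have "\<dots> = integral {0..s} (\<lambda>x. (w x)\<^sup>2) + integral {0..s} (\<lambda>x. (w x - z x)\<^sup>2)"
    by (intro Henstock_Kurzweil_Integration.integral_add integrable_continuous_interval continuous_intros yosida_cont)
  finally show ?thesis using yosida_dist by simp
qed

text \<open>Multiplying \<open>w''\<close> by \<open>w - z = - \<mu> z''\<close> gives a dissipative term.\<close>

lemma yosida_dissipation:
  assumes w: "\<And>x. x \<in> {0..s} \<Longrightarrow> (w has_real_derivative w' x) (at x within {0..s})"
    and w': "\<And>x. x \<in> {0..s} \<Longrightarrow> (w' has_real_derivative w'' x) (at x within {0..s})"
    and cw'': "continuous_on {0..s} w''" and w0: "w 0 = 0" "w s = 0"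
  shows "integral {0..s} (\<lambda>x. w'' x * (w x - z x)) \<le> 0"
proof -
  have cw': "continuous_on {0..s} w'" by (rule DERIV_continuous_on, erule w')
  have d: "((\<lambda>x. w x - z x) has_real_derivative w' x - zx x) (at x within {0..s})" if "x \<in> {0..s}" for x
    using that by (auto intro!: derivative_eq_intros w yosida_resolvent_DERIV)
  have "integral {0..s} (\<lambda>x. w'' x * (w x - z x)) = - integral {0..s} (\<lambda>x. w' x * (w' x - zx x))"
    using integral_by_parts[OF s w' d cw''] w0 yosida_resolvent_ends
    by (simp add: continuous_intros yosida_cont cw')
  \<comment> \<open>Both summands are nonnegative: the first is a square, and by the weak form with
    test function w - z the second is the integral of (w - z)^2 divided by \<mu>.\<close>
  also have "integral {0..s} (\<lambda>x. w' x * (w' x - zx x))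
     = integral {0..s} (\<lambda>x. (w' x - zx x)\<^sup>2) + integral {0..s} (\<lambda>x. (w' x - zx x) * zx x)"
  proof -
    have "integral {0..s} (\<lambda>x. w' x * (w' x - zx x))
        = integral {0..s} (\<lambda>x. (w' x - zx x)\<^sup>2 + (w' x - zx x) * zx x)"
      by (intro arg_cong[where f="integral {0..s}"] ext) (simp add: algebra_simps power2_eq_square)
    also have "\<dots> = integral {0..s} (\<lambda>x. (w' x - zx x)\<^sup>2) + integral {0..s} (\<lambda>x. (w' x - zx x) * zx x)"
      by (intro Henstock_Kurzweil_Integration.integral_add integrable_continuous_interval continuous_intros yosida_cont cw')
    finally show ?thesis .
  qed
  finally have 1: "integral {0..s} (\<lambda>x. w'' x * (w x - z x))
     = - integral {0..s} (\<lambda>x. (w' x - zx x)\<^sup>2) - integral {0..s} (\<lambda>x. (w' x - zx x) * zx x)" by simp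
  have "\<mu> * integral {0..s} (\<lambda>x. (w' x - zx x) * zx x) = integral {0..s} (\<lambda>x. (w x - z x) * (w x - z x))"
    by (rule yosida_resolvent_weak[OF d]) (auto intro!: continuous_intros yosida_cont cw' simp: w0 yosida_resolvent_ends)
  also have "\<dots> \<ge> 0"
    by (intro Henstock_Kurzweil_Integration.integral_nonneg integrable_continuous_interval continuous_intros yosida_cont) simp
  finally have 2: "0 \<le> integral {0..s} (\<lambda>x. (w' x - zx x) * zx x)"
    using mu by (simp add: zero_le_mult_iff)
  have "0 \<le> integral {0..s} (\<lambda>x. (w' x - zx x)\<^sup>2)"
    by (intro Henstock_Kurzweil_Integration.integral_nonneg integrable_continuous_interval continuous_intros yosida_cont cw') simp
  with 1 2 show ?thesis by linarith
qed

text \<open>The Dirichlet integral exceeds twice the regularized energy by the integral of w'' (z -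
  w), and z - w is of order sqrt \<mu> in mean square by \<open>yosida_dist\<close>. Young's
  inequality with a free parameter e separates the errors, so that \<mu> can tend to 0 before e
  does.\<close>

lemma dirichlet_le_yosida:
  assumes w: "\<And>x. x \<in> {0..s} \<Longrightarrow> (w has_real_derivative w' x) (at x within {0..s})"
    and w': "\<And>x. x \<in> {0..s} \<Longrightarrow> (w' has_real_derivative w'' x) (at x within {0..s})"
    and cw'': "continuous_on {0..s} w''" and w0: "w 0 = 0" "w s = 0"
    and K: "\<And>x. x \<in> {0..s} \<Longrightarrow> \<bar>w'' x\<bar> \<le> K" and e: "e > 0" and B: "yosida \<mu> s w z \<le> B"
  shows "integral {0..s} (\<lambda>x. (w' x)\<^sup>2) \<le> 2 * B + e * s + K\<^sup>2 * B / (2 * e) * \<mu>"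
proof -
  have cw': "continuous_on {0..s} w'" by (rule DERIV_continuous_on, erule w')
  have "integral {0..s} (\<lambda>x. w'' x * w x) = - integral {0..s} (\<lambda>x. w' x * w' x)"
    using integral_by_parts[OF s w' w cw'' cw'] w0 by simp
  moreover have "integral {0..s} (\<lambda>x. w'' x * z x) = - integral {0..s} (\<lambda>x. w' x * zx x)"
    using integral_by_parts[OF s w' yosida_resolvent_DERIV(1) cw'' yosida_cont(3)] yosida_resolvent_ends by simp
  moreover have "integral {0..s} (\<lambda>x. w' x * zx x) = 2 * yosida \<mu> s w z"
    using yosida_resolvent_weak[OF w cw' w0] mu by (simp add: yosida_def field_simps)
  moreover have "integral {0..s} (\<lambda>x. w'' x * z x - w'' x * w x)
      = integral {0..s} (\<lambda>x. w'' x * z x) - integral {0..s} (\<lambda>x. w'' x * w x)"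
    by (intro Henstock_Kurzweil_Integration.integral_diff integrable_continuous_interval continuous_intros yosida_cont cw'')
  ultimately have "integral {0..s} (\<lambda>x. (w' x)\<^sup>2)
     = 2 * yosida \<mu> s w z + integral {0..s} (\<lambda>x. w'' x * z x - w'' x * w x)"
    by (simp add: power2_eq_square)
  also have "integral {0..s} (\<lambda>x. w'' x * z x - w'' x * w x)
      \<le> integral {0..s} (\<lambda>x. e + K\<^sup>2 / (4 * e) * (w x - z x)\<^sup>2)"
  proof (intro integral_le integrable_continuous_interval continuous_intros yosida_cont cw'')
    fix x assume x: "x \<in> {0..s}"
    define d where "d = \<bar>w x - z x\<bar>"
    have "w'' x * z x - w'' x * w x \<le> \<bar>w'' x * (w x - z x)\<bar>" by (simp add: right_diff_distrib)
    also have "\<dots> \<le> K * d" unfolding d_def abs_mult using K[OF x] by (intro mult_right_mono) auto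
    also have "K * d \<le> e + K\<^sup>2 / (4 * e) * d\<^sup>2"
      using e sum_squares_bound[of "2 * e" "K * d"] by (simp add: field_simps power2_eq_square)
    finally show "w'' x * z x - w'' x * w x \<le> e + K\<^sup>2 / (4 * e) * (w x - z x)\<^sup>2" by (simp add: d_def)
  qed
  also have "\<dots> = e * s + K\<^sup>2 / (4 * e) * integral {0..s} (\<lambda>x. (w x - z x)\<^sup>2)"
  proof -
    have "integral {0..s} (\<lambda>x. e + K\<^sup>2 / (4 * e) * (w x - z x)\<^sup>2)
        = integral {0..s} (\<lambda>x. e) + integral {0..s} (\<lambda>x. K\<^sup>2 / (4 * e) * (w x - z x)\<^sup>2)"
      by (intro Henstock_Kurzweil_Integration.integral_add integrable_continuous_interval continuous_intros yosida_cont)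
    then show ?thesis using s by simp
  qed
  also have "\<dots> \<le> e * s + K\<^sup>2 / (4 * e) * (2 * \<mu> * B)"
  proof -
    have "2 * \<mu> * yosida \<mu> s w z \<le> 2 * \<mu> * B" using B mu by simp
    with yosida_dist have "integral {0..s} (\<lambda>x. (w x - z x)\<^sup>2) \<le> 2 * \<mu> * B" by linarith
    then show ?thesis using e by (intro add_left_mono mult_left_mono) auto
  qed
  also have "K\<^sup>2 / (4 * e) * (2 * \<mu> * B) = K\<^sup>2 * B / (2 * e) * \<mu>" by simp
  finally show ?thesis using B by linarith
qed

text \<open>The zero extension of \<open>z\<close> competes with \<open>y\<close> in the variational problem on \<open>{0..s'}\<close>.\<close>

lemma yosida_compare:
  assumes ss': "s \<le> s'" and cw': "continuous_on {0..s'} w'" and res': "yosida_resolvent \<mu> s' w' y yx"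
    and E': "2 * \<mu> * yosida \<mu> s' w' y
       = \<mu> * integral {0..s'} (\<lambda>x. (yx x)\<^sup>2) + integral {0..s'} (\<lambda>x. (w' x - y x)\<^sup>2)"
  shows "2 * \<mu> * yosida \<mu> s' w' y - 2 * \<mu> * yosida \<mu> s w z
     \<le> integral {0..s} (\<lambda>x. (w' x - w x) * (w' x - w x + 2 * (w x - z x))) + integral {s..s'} (\<lambda>x. (w' x)\<^sup>2)"
proof -
  have d: "(y has_real_derivative yx x) (at x within {0..s'})"
    "(yx has_real_derivative (y x - w' x) / \<mu>) (at x within {0..s'})" if "x \<in> {0..s'}" for x
    using that res' by (auto simp: yosida_resolvent_def)
  have cy: "continuous_on {0..s'} y" "continuous_on {0..s'} yx"
    by (rule DERIV_continuous_on, erule d)+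
  have sub: "{0..s} \<subseteq> {0..s'}" "{s..s'} \<subseteq> {0..s'}" using s ss' by auto
  note c = cw' cy continuous_on_subset[OF cw' sub(1)] continuous_on_subset[OF cw' sub(2)]
    continuous_on_subset[OF cy(1) sub(1)] continuous_on_subset[OF cy(1) sub(2)]
    continuous_on_subset[OF cy(2) sub(1)] continuous_on_subset[OF cy(2) sub(2)] yosida_cont
  \<comment> \<open>As y solves its Euler-Lagrange equation, p, which equals w'^2 - y^2 - \<mu>
    yx^2, integrates to 2 \<mu> times the energy. Unlike the minimization this form can be cut at s:
    to the right p is at most w'^2, to the left completing squares brings in z.\<close>
  define p where "p x = (w' x - y x)\<^sup>2 + 2 * (w' x - y x) * y x - \<mu> * (yx x)\<^sup>2" for x
  have cp: "continuous_on S p" if "S = {0..s} \<or> S = {s..s'} \<or> S = {0..s'}" for S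
    unfolding p_def[abs_def] using that by (auto intro!: continuous_intros c)
  \<comment> \<open>z vanishes at both ends of \<open>{0..s}\<close>, so testing the equation of y
    with z leaves no boundary term although y need not vanish at s.\<close>
  have "integral {0..s} (\<lambda>x. zx x * yx x) = - integral {0..s} (\<lambda>x. z x * ((y x - w' x) / \<mu>))"
    using integral_by_parts[OF s yosida_resolvent_DERIV(1), of yx "\<lambda>x. (y x - w' x) / \<mu>"] mu sub(1)
    by (simp add: yosida_resolvent_ends continuous_intros c d(2)[THEN DERIV_subset] subset_iff)
  then have 1: "\<mu> * integral {0..s} (\<lambda>x. zx x * yx x) + integral {0..s} (\<lambda>x. z x * (y x - w' x)) = 0"
    using mu by simp
  have "integral {0..s'} (\<lambda>x. yx x * yx x) = - integral {0..s'} (\<lambda>x. y x * ((y x - w' x) / \<mu>))"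
    using integral_by_parts[of 0 s' y yx yx "\<lambda>x. (y x - w' x) / \<mu>"] mu d s ss' res'
    by (simp add: yosida_resolvent_def continuous_intros c)
  then have 2: "\<mu> * integral {0..s'} (\<lambda>x. yx x * yx x) + integral {0..s'} (\<lambda>x. y x * (y x - w' x)) = 0"
    using mu by simp
  have 3: "integral {0..s'} p = 2 * \<mu> * yosida \<mu> s' w' y"
  proof -
    have "integral {0..s'} p = integral {0..s'} (\<lambda>x. w' x * (w' x - y x) - (\<mu> * (yx x * yx x) + y x * (y x - w' x)))"
      by (intro arg_cong[where f="integral {0..s'}"] ext) (simp add: p_def algebra_simps power2_eq_square)
    also have "\<dots> = integral {0..s'} (\<lambda>x. w' x * (w' x - y x))
        - (\<mu> * integral {0..s'} (\<lambda>x. yx x * yx x) + integral {0..s'} (\<lambda>x. y x * (y x - w' x)))"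
      by (simp add: Henstock_Kurzweil_Integration.integral_add Henstock_Kurzweil_Integration.integral_diff
          integrable_continuous_interval continuous_intros c)
    finally show ?thesis using 2 mu by (simp add: yosida_def)
  qed
  have "integral {0..s'} p = integral {0..s} p + integral {s..s'} p"
    using s ss' by (intro Henstock_Kurzweil_Integration.integral_combine[symmetric]
        integrable_continuous_interval cp) auto
  moreover have "integral {s..s'} p \<le> integral {s..s'} (\<lambda>x. (w' x)\<^sup>2)"
  proof (intro integral_le integrable_continuous_interval continuous_intros cp c)
    show "p x \<le> (w' x)\<^sup>2" for x
    proof -
      have "(w' x)\<^sup>2 - p x = (y x)\<^sup>2 + \<mu> * (yx x)\<^sup>2" by (simp add: p_def algebra_simps power2_eq_square)
      moreover have "0 \<le> \<mu> * (yx x)\<^sup>2" "0 \<le> (y x)\<^sup>2" using mu by simp_all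
      ultimately show ?thesis by linarith
    qed
  qed auto
  moreover have "integral {0..s} p \<le> integral {0..s} (\<lambda>x. \<mu> * (zx x)\<^sup>2 + (w' x - z x)\<^sup>2
      - 2 * (\<mu> * (zx x * yx x) + z x * (y x - w' x)))"
  proof (intro integral_le integrable_continuous_interval continuous_intros cp c)
    show "p x \<le> \<mu> * (zx x)\<^sup>2 + (w' x - z x)\<^sup>2 - 2 * (\<mu> * (zx x * yx x) + z x * (y x - w' x))" for x
    proof -
      have "\<mu> * (zx x)\<^sup>2 + (w' x - z x)\<^sup>2 - 2 * (\<mu> * (zx x * yx x) + z x * (y x - w' x)) - p x
        = \<mu> * (zx x - yx x)\<^sup>2 + (z x - y x)\<^sup>2"
        by (simp add: p_def algebra_simps power2_eq_square)
      moreover have "0 \<le> \<mu> * (zx x - yx x)\<^sup>2" "0 \<le> (z x - y x)\<^sup>2" using mu by simp_all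
      ultimately show ?thesis by linarith
    qed
  qed auto
  moreover have 4: "integral {0..s} (\<lambda>x. \<mu> * (zx x)\<^sup>2 + (w' x - z x)\<^sup>2
      - 2 * (\<mu> * (zx x * yx x) + z x * (y x - w' x)))
     = \<mu> * integral {0..s} (\<lambda>x. (zx x)\<^sup>2) + integral {0..s} (\<lambda>x. (w' x - z x)\<^sup>2)
       - 2 * (\<mu> * integral {0..s} (\<lambda>x. zx x * yx x) + integral {0..s} (\<lambda>x. z x * (y x - w' x)))"
    by (simp add: Henstock_Kurzweil_Integration.integral_add Henstock_Kurzweil_Integration.integral_diff
          integrable_continuous_interval continuous_intros c)
  moreover have "integral {0..s} (\<lambda>x. (w' x - z x)\<^sup>2)
     = integral {0..s} (\<lambda>x. (w' x - w x) * (w' x - w x + 2 * (w x - z x))) + integral {0..s} (\<lambda>x. (w x - z x)\<^sup>2)"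
  proof -
    have "integral {0..s} (\<lambda>x. (w' x - z x)\<^sup>2)
        = integral {0..s} (\<lambda>x. (w' x - w x) * (w' x - w x + 2 * (w x - z x)) + (w x - z x)\<^sup>2)"
      by (intro arg_cong[where f="integral {0..s}"] ext) (simp add: algebra_simps power2_eq_square)
    also have "\<dots> = integral {0..s} (\<lambda>x. (w' x - w x) * (w' x - w x + 2 * (w x - z x)))
        + integral {0..s} (\<lambda>x. (w x - z x)\<^sup>2)"
      by (intro Henstock_Kurzweil_Integration.integral_add integrable_continuous_interval continuous_intros c)
    finally show ?thesis .
  qed
  moreover note 3 yosida_energy
  moreover define X Y where "X = 2 * \<mu> * yosida \<mu> s' w' y" and "Y = 2 * \<mu> * yosida \<mu> s w z"
  ultimately have "X - Y \<le> integral {0..s} (\<lambda>x. (w' x - w x) * (w' x - w x + 2 * (w x - z x))) + integral {s..s'} (\<lambda>x. (w' x)\<^sup>2)"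
    unfolding 1 by linarith
  then show ?thesis by (simp only: X_def Y_def)
qed

end

subsection \<open>Decay of the regularized energy on a growing interval\<close>

text \<open>Continuity of \<open>g\<close> is replaced by one-sided estimates, which is all that the variational
  comparison of energies at different times provides.\<close>

lemma dini_nonincreasing:
  fixes g :: "real \<Rightarrow> real"
  assumes dini: "\<And>t e. a < t \<Longrightarrow> 0 < e \<Longrightarrow> \<exists>\<delta>>0. \<forall>h. 0 < h \<and> h < \<delta> \<longrightarrow> g (t + h) \<le> g t + e * h"
    and left: "\<And>t e. a < t \<Longrightarrow> 0 < e \<Longrightarrow> \<exists>\<delta>>0. \<forall>r. a \<le> r \<and> t - \<delta> < r \<and> r < t \<longrightarrow> g t \<le> g r + e"
    and right: "\<And>e. 0 < e \<Longrightarrow> \<exists>\<delta>>0. \<forall>h. 0 < h \<and> h < \<delta> \<longrightarrow> g (a + h) \<le> g a + e"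
    and "a \<le> b"
  shows "g b \<le> g a"
proof -
  have interior: "g d \<le> g c" if "a < c" "c \<le> d" for c d
  proof -
    have *: "g d \<le> g c + e * (d - c)" if e: "e > 0" for e
    proof -
      \<comment> \<open>Continuous induction: the times up to which growth is at most linear with
        slope e. The estimate passes to the supremum by \<open>left\<close> and beyond it by
        \<open>dini\<close>.\<close>
      define S where "S = {\<tau>\<in>{c..d}. \<forall>r\<in>{c..\<tau>}. g r \<le> g c + e * (r - c)}"
      define m where "m = Sup S"
      have cS: "c \<in> S" using \<open>c \<le> d\<close> by (auto simp: S_def)
      have bdd: "bdd_above S" by (auto simp: S_def intro: bdd_aboveI[of _ d])
      have m: "c \<le> m" "m \<le> d"
      proof -
        show "c \<le> m" unfolding m_def by (rule cSup_upper[OF cS bdd])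
        show "m \<le> d" unfolding m_def by (rule cSup_least) (use cS in \<open>auto simp: S_def\<close>)
      qed
      have below: "g r \<le> g c + e * (r - c)" if r: "c \<le> r" "r < m" for r
      proof -
        obtain \<tau> where "\<tau> \<in> S" "r < \<tau>" using r less_cSup_iff[OF _ bdd] cS unfolding m_def by blast
        then show ?thesis using r by (auto simp: S_def)
      qed
      have atm: "g m \<le> g c + e * (m - c)"
      proof (cases "c = m")
        case False
        with m have cm: "c < m" by simp
        show ?thesis
        proof (rule field_le_epsilon)
          fix e' :: real assume "e' > 0"
          then obtain \<delta> where \<delta>: "\<delta> > 0" "\<And>r. a \<le> r \<Longrightarrow> m - \<delta> < r \<Longrightarrow> r < m \<Longrightarrow> g m \<le> g r + e'"
            using left[of m e'] \<open>a < c\<close> cm by (smt (verit))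
          define r where "r = max c (m - \<delta> / 2)"
          have r: "c \<le> r" "r < m" "m - \<delta> < r" using cm \<delta>(1) by (auto simp: r_def)
          then have "g m \<le> g r + e'" using \<delta>(2) \<open>a < c\<close> by simp
          also have "g r \<le> g c + e * (r - c)" using below r by simp
          also have "e * (r - c) \<le> e * (m - c)" using e r by simp
          finally show "g m \<le> g c + e * (m - c) + e'" by simp
        qed
      qed simp
      have "m = d"
      proof (rule ccontr)
        assume "m \<noteq> d"
        with m have md: "m < d" by simp
        obtain \<delta> where \<delta>: "\<delta> > 0" "\<And>h. 0 < h \<Longrightarrow> h < \<delta> \<Longrightarrow> g (m + h) \<le> g m + e * h"
          using dini[of m e] \<open>a < c\<close> m e by auto
        define n where "n = min d (m + \<delta> / 2)"
        have n: "m < n" "n \<le> d" "n < m + \<delta>" using md \<delta>(1) by (auto simp: n_def)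
        have "n \<in> S"
          unfolding S_def
        proof safe
          fix r assume r: "r \<in> {c..n}"
          consider "r < m" | "r = m" | "m < r" by linarith
          then show "g r \<le> g c + e * (r - c)"
          proof cases
            case 3
            then have "g r \<le> g m + e * (r - m)" using \<delta>(2)[of "r - m"] r n by simp
            with atm show ?thesis by (simp add: algebra_simps)
          qed (use below atm r in auto)
        qed (use n m in auto)
        then show False using cSup_upper[OF _ bdd] n by (force simp: m_def)
      qed
      then show ?thesis using atm by simp
    qed
    show ?thesis
    proof (cases "c = d")
      case False
      then have cd: "d - c > 0" using that by simp
      show ?thesis
      proof (rule field_le_epsilon)
        fix e :: real assume "e > 0"
        then show "g d \<le> g c + e" using *[of "e / (d - c)"] cd by simp
      qed
    qed simp
  qed
  \<comment> \<open>The Dini estimate is assumed for times after a only; \<open>right\<close>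
    attaches the initial point.\<close>
  show ?thesis
  proof (cases "a = b")
    case False
    with \<open>a \<le> b\<close> have ab: "a < b" by simp
    show ?thesis
    proof (rule field_le_epsilon)
      fix e :: real assume "e > 0"
      then obtain \<delta> where \<delta>: "\<delta> > 0" "\<And>h. 0 < h \<Longrightarrow> h < \<delta> \<Longrightarrow> g (a + h) \<le> g a + e"
        using right[of e] by auto
      define h where "h = min (b - a) (\<delta> / 2)"
      have "0 < h" "h < \<delta>" "a + h \<le> b" using ab \<delta>(1) by (auto simp: h_def)
      then show "g b \<le> g a + e" using \<delta>(2)[of h] interior[of "a + h" b] by simp
    qed
  qed simp
qed

text \<open>Extension by 0 to the fixed interval \<open>{0..R}\<close> makes profiles at different
  times comparable. \<open>W_step\<close> takes the place of the equation for w_t: a forward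
  expansion, uniform in x, on the old interval, and o(h) of mass on the newly covered strip.\<close>

locale growing_flow =
  fixes s :: "real \<Rightarrow> real" and W W' W'' :: "real \<Rightarrow> real \<Rightarrow> real" and \<alpha> lam R :: real
  assumes \<alpha>: "\<alpha> > 0" and lam: "lam > 0"
    and s_pos: "\<And>t. 0 \<le> t \<Longrightarrow> 0 < s t"
    and s_mono: "\<And>r t. 0 \<le> r \<Longrightarrow> r \<le> t \<Longrightarrow> s r \<le> s t"
    and s_le: "\<And>t. 0 \<le> t \<Longrightarrow> s t \<le> R"
    and W_cont: "\<And>t. 0 \<le> t \<Longrightarrow> continuous_on {0..R} (W t)"
    and W_outside: "\<And>t x. 0 \<le> t \<Longrightarrow> s t \<le> x \<Longrightarrow> x \<le> R \<Longrightarrow> W t x = 0"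
    and W_time_cont: "\<And>t e. 0 \<le> t \<Longrightarrow> 0 < e \<Longrightarrow>
      \<exists>\<delta>>0. \<forall>r. 0 \<le> r \<and> \<bar>r - t\<bar> < \<delta> \<longrightarrow> (\<forall>x\<in>{0..R}. \<bar>W r x - W t x\<bar> \<le> e)"
    and W_0: "\<And>t. 0 < t \<Longrightarrow> W t 0 = 0"
    and W': "\<And>t x. 0 < t \<Longrightarrow> x \<in> {0..s t} \<Longrightarrow> (W t has_real_derivative W' t x) (at x within {0..s t})"
    and W'': "\<And>t x. 0 < t \<Longrightarrow> x \<in> {0..s t} \<Longrightarrow> (W' t has_real_derivative W'' t x) (at x within {0..s t})"
    and W''_cont: "\<And>t. 0 < t \<Longrightarrow> continuous_on {0..s t} (W'' t)"
    and W_step: "\<And>t e. 0 < t \<Longrightarrow> 0 < e \<Longrightarrow> \<exists>\<delta>>0. \<forall>h. 0 < h \<and> h < \<delta> \<longrightarrow>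
      (\<forall>x\<in>{0..s t}. \<bar>W (t + h) x - W t x - h * (\<alpha> * W'' t x - lam * W t x)\<bar> \<le> e * h) \<and>
      integral {s t..s (t + h)} (\<lambda>x. (W (t + h) x)\<^sup>2) \<le> e * h"
begin

lemma W_cont_sub: "0 \<le> t \<Longrightarrow> S \<subseteq> {0..R} \<Longrightarrow> continuous_on S (W t)"
  using W_cont continuous_on_subset by blast

lemma R_pos: "R > 0"
  using s_pos[of 0] s_le[of 0] by simp

lemma W_dom:
  assumes "0 \<le> t"
  shows "continuous_on {0..s t} (W t)" "0 \<le> s t"
  using assms s_pos[of t] s_le[of t] by (auto intro!: W_cont_sub)

lemma W_bound:
  assumes "0 \<le> t"
  obtains N where "N > 0" "\<And>x. x \<in> {0..R} \<Longrightarrow> \<bar>W t x\<bar> \<le> N"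
  using continuous_on_Icc_bounded[OF W_cont[OF assms]] that by blast

context
  fixes \<mu> :: real and Z Zx :: "real \<Rightarrow> real \<Rightarrow> real"
  assumes mu: "\<mu> > 0" and Z: "\<And>t. 0 \<le> t \<Longrightarrow> yosida_resolvent \<mu> (s t) (W t) (Z t) (Zx t)"
begin

definition E :: "real \<Rightarrow> real" where "E t = yosida \<mu> (s t) (W t) (Z t)"

lemmas E_facts = yosida_energy[OF mu W_dom(2) W_dom(1) Z] yosida_nonneg[OF mu W_dom(2) W_dom(1) Z]
  yosida_dist[OF mu W_dom(2) W_dom(1) Z] yosida_le_L2[OF mu W_dom(2) W_dom(1) Z]

lemma Z_cont: "0 \<le> t \<Longrightarrow> continuous_on {0..s t} (Z t)"
  by (rule yosida_resolvent_continuous_on(1)[OF mu W_dom(2) W_dom(1) Z])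

lemma E_increment:
  assumes "0 \<le> r" "r \<le> t"
  shows "2 * \<mu> * (E t - E r) \<le> integral {0..s r} (\<lambda>x. (W t x - W r x) * (W t x - W r x + 2 * (W r x - Z r x)))
     + integral {s r..s t} (\<lambda>x. (W t x)\<^sup>2)"
proof -
  have t: "0 \<le> t" using assms by simp
  show ?thesis
    using yosida_compare[OF mu W_dom(2,1)[OF assms(1)] Z[OF assms(1)] s_mono[OF assms] W_dom(1)[OF t] Z[OF t]
        E_facts(1)[OF t t t]] by (simp add: E_def right_diff_distrib)
qed

lemma integral_sq_le:
  assumes "0 \<le> r" and N: "\<And>x. x \<in> {0..R} \<Longrightarrow> \<bar>W r x\<bar> \<le> N"
  shows "integral {0..s r} (\<lambda>x. (W r x - Z r x)\<^sup>2) \<le> R * N\<^sup>2" "2 * \<mu> * E r \<le> R * N\<^sup>2"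
proof -
  have N0: "0 \<le> N" using N[of 0] R_pos by auto
  have "integral {0..s r} (\<lambda>x. (W r x)\<^sup>2) \<le> integral {0..s r} (\<lambda>x. N\<^sup>2)"
  proof (intro integral_le integrable_continuous_interval continuous_intros W_dom assms)
    fix x assume "x \<in> {0..s r}"
    then have "\<bar>W r x\<bar> \<le> N" using N s_le[of r] assms by auto
    then show "(W r x)\<^sup>2 \<le> N\<^sup>2" using N0 by (simp add: abs_le_square_iff[symmetric])
  qed
  also have "\<dots> \<le> R * N\<^sup>2" using s_le[of r] s_pos[of r] assms by (simp add: mult_right_mono)
  finally show "integral {0..s r} (\<lambda>x. (W r x - Z r x)\<^sup>2) \<le> R * N\<^sup>2" "2 * \<mu> * E r \<le> R * N\<^sup>2"
    using E_facts(3,4)[of r, OF assms(1) assms(1) assms(1)] by (simp_all add: E_def)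
qed

text \<open>Only increases of E are estimated, since the comparison of energies runs forward in
  time; \<open>dini_nonincreasing\<close> asks for no more. In the constant,
  \<open>2 + N\<^sup>2\<close> comes from the old interval and 1 from the strip.\<close>

lemma E_modulus:
  assumes r: "0 \<le> r" "r \<le> t" and e: "0 < e" "e \<le> 1"
    and close: "\<And>x. x \<in> {0..R} \<Longrightarrow> \<bar>W t x - W r x\<bar> \<le> e"
    and N: "\<And>x. x \<in> {0..R} \<Longrightarrow> \<bar>W r x\<bar> \<le> N"
  shows "2 * \<mu> * (E t - E r) \<le> e * (R * (3 + N\<^sup>2))"
proof -
  have t: "0 \<le> t" using r by simp
  have sub: "{0..s r} \<subseteq> {0..R}" "{s r..s t} \<subseteq> {0..R}" "s r \<le> s t"
    using s_le[of r] s_le[of t] s_pos[of r] s_mono[of r t] r t by auto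
  note c = W_cont_sub[OF t sub(1)] W_cont_sub[OF t sub(2)] W_dom(1)[OF r(1)] Z_cont[OF r(1)]
  have ee: "e * e \<le> e" using mult_left_mono[of e 1 e] e by simp
  have "integral {0..s r} (\<lambda>x. (W t x - W r x) * (W t x - W r x + 2 * (W r x - Z r x)))
     \<le> integral {0..s r} (\<lambda>x. 2 * e + e * (W r x - Z r x)\<^sup>2)"
  proof (intro integral_le integrable_continuous_interval continuous_intros c)
    fix x assume "x \<in> {0..s r}"
    then have d: "\<bar>W t x - W r x\<bar> \<le> e" using close sub by blast
    define d where "d = W t x - W r x"
    define v where "v = W r x - Z r x"
    have "d * (d + 2 * v) \<le> \<bar>d\<bar> * \<bar>d\<bar> + \<bar>d\<bar> * (2 * \<bar>v\<bar>)"
      using abs_ge_self[of "d * (2 * v)"] by (simp add: distrib_left abs_mult)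
    also have "\<dots> \<le> e * e + e * (1 + v\<^sup>2)"
      using d e sum_squares_bound[of 1 "\<bar>v\<bar>"] unfolding d_def[symmetric]
      by (intro add_mono mult_mono) auto
    also have "\<dots> \<le> 2 * e + e * v\<^sup>2" using ee by (simp add: distrib_left)
    finally show "(W t x - W r x) * (W t x - W r x + 2 * (W r x - Z r x)) \<le> 2 * e + e * (W r x - Z r x)\<^sup>2"
      by (simp add: d_def v_def)
  qed
  also have "\<dots> = integral {0..s r} (\<lambda>x. 2 * e) + integral {0..s r} (\<lambda>x. e * (W r x - Z r x)\<^sup>2)"
    by (intro Henstock_Kurzweil_Integration.integral_add integrable_continuous_interval continuous_intros c)
  also have "\<dots> \<le> 2 * e * R + e * (R * N\<^sup>2)"
    using integral_sq_le(1)[OF r(1) N] s_le[OF r(1)] W_dom(2)[OF r(1)] e by (auto intro!: add_mono)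
  finally have 1: "integral {0..s r} (\<lambda>x. (W t x - W r x) * (W t x - W r x + 2 * (W r x - Z r x)))
    \<le> 2 * e * R + e * (R * N\<^sup>2)" .
  have "integral {s r..s t} (\<lambda>x. (W t x)\<^sup>2) \<le> integral {s r..s t} (\<lambda>x. e)"
  proof (intro integral_le integrable_continuous_interval continuous_intros c)
    fix x assume x: "x \<in> {s r..s t}"
    then have "W r x = 0" using W_outside[OF r(1)] s_le[OF t] by auto
    then have "\<bar>W t x\<bar> \<le> e" using close[of x] x sub by auto
    then have "\<bar>W t x\<bar> * \<bar>W t x\<bar> \<le> e * e" by (intro mult_mono) (use e in auto)
    then show "(W t x)\<^sup>2 \<le> e" using ee by (simp add: power2_eq_square)
  qed
  also have "\<dots> \<le> e * R" using sub(3) s_le[OF t] s_pos[OF r(1)] e by (simp add: mult.commute)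
  finally show ?thesis using E_increment[OF r] 1 by (simp add: algebra_simps)
qed

lemma E_nonneg: "0 \<le> t \<Longrightarrow> 0 \<le> E t"
  using E_facts(2) by (simp add: E_def)

text \<open>To first order in h the comparison leaves 2 h times the pairing of \<alpha> w'' - lam w
  with w - z. The part with w'' is at most 0 by \<open>yosida_dissipation\<close>; the part with w
  is - 2 lam \<mu> E by the definition of the energy.\<close>

lemma E_step:
  assumes t: "0 < t" and e: "0 < e"
  shows "\<exists>\<delta>>0. \<forall>h. 0 < h \<and> h < \<delta> \<longrightarrow> E (t + h) \<le> (1 - 2 * lam * h) * E t + e * h"
proof -
  have t0: "0 \<le> t" using t by simp
  obtain N where N: "N > 0" "\<And>x. x \<in> {0..R} \<Longrightarrow> \<bar>W t x\<bar> \<le> N" using W_bound[OF t0] by blast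
  define F where "F x = \<alpha> * W'' t x - lam * W t x" for x
  have cF: "continuous_on {0..s t} F"
    unfolding F_def[abs_def] by (intro continuous_intros W''_cont t W_dom t0)
  obtain M where M: "M > 0" "\<And>x. x \<in> {0..s t} \<Longrightarrow> \<bar>F x\<bar> \<le> M"
    using continuous_on_Icc_bounded[OF cF] by blast
  \<comment> \<open>Collects the errors proportional to e1: R from the constant part of the
    pointwise bound, \<open>R * N\<^sup>2\<close> from the square of w - z, and 1 from the strip.
    The choice of e1 makes them at most \<mu> e h, and \<delta>' does the same for the term
    quadratic in h.\<close>
  define C where "C = R + R * N\<^sup>2 + 1"
  have C: "C > 0" using R_pos by (simp add: C_def add_nonneg_pos)
  define e1 where "e1 = min 1 (\<mu> * e / C)"
  have e1: "0 < e1" "e1 \<le> 1" "e1 * C \<le> \<mu> * e"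
  proof -
    show "0 < e1" "e1 \<le> 1" using mu e C by (auto simp: e1_def)
    have "e1 * C \<le> \<mu> * e / C * C" using C by (intro mult_right_mono) (auto simp: e1_def)
    then show "e1 * C \<le> \<mu> * e" using C by simp
  qed
  obtain \<delta> where \<delta>: "\<delta> > 0"
    "\<And>h x. 0 < h \<Longrightarrow> h < \<delta> \<Longrightarrow> x \<in> {0..s t} \<Longrightarrow> \<bar>W (t + h) x - W t x - h * F x\<bar> \<le> e1 * h"
    "\<And>h. 0 < h \<Longrightarrow> h < \<delta> \<Longrightarrow> integral {s t..s (t + h)} (\<lambda>x. (W (t + h) x)\<^sup>2) \<le> e1 * h"
    using W_step[OF t e1(1)] unfolding F_def by blast
  define \<delta>' where "\<delta>' = min \<delta> (\<mu> * e / (R * (M + 1)\<^sup>2))"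
  have RM: "R * (M + 1)\<^sup>2 > 0" using R_pos M by simp
  show ?thesis
  proof (intro exI[of _ \<delta>'] conjI allI impI)
    show "0 < \<delta>'" using \<delta>(1) RM mu e by (simp add: \<delta>'_def)
    fix h assume "0 < h \<and> h < \<delta>'"
    then have h: "0 < h" "h < \<delta>" "h * (R * (M + 1)\<^sup>2) \<le> \<mu> * e"
      using RM by (auto simp: \<delta>'_def pos_less_divide_eq less_imp_le)
    have th: "0 \<le> t + h" "t \<le> t + h" using t h by auto
    have sub: "{0..s t} \<subseteq> {0..R}" using s_le[OF t0] by auto
    note c = W_cont_sub[OF th(1) sub] W_dom(1)[OF t0] Z_cont[OF t0] cF
    have "integral {0..s t} (\<lambda>x. (W (t + h) x - W t x) * (W (t + h) x - W t x + 2 * (W t x - Z t x)))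
       \<le> integral {0..s t} (\<lambda>x. h\<^sup>2 * (M + 1)\<^sup>2 + e1 * h + 2 * h * (F x * (W t x - Z t x)) + e1 * h * (W t x - Z t x)\<^sup>2)"
    proof (intro integral_le integrable_continuous_interval continuous_intros c)
      fix x assume x: "x \<in> {0..s t}"
      define d where "d = W (t + h) x - W t x"
      define v where "v = W t x - Z t x"
      have d: "\<bar>d - h * F x\<bar> \<le> e1 * h" using \<delta>(2)[OF h(1,2) x] by (simp add: d_def)
      have "\<bar>h * F x\<bar> \<le> h * M" using M(2)[OF x] h by (simp add: abs_mult)
      moreover have "e1 * h \<le> h * 1" using e1 h by simp
      ultimately have dM: "\<bar>d\<bar> \<le> h * (M + 1)" using d by (simp add: distrib_left)
      have "d\<^sup>2 \<le> (h * (M + 1))\<^sup>2" using dM h M by (intro power2_le_iff_abs_le[THEN iffD2]) auto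
      moreover have "(d - h * F x) * (2 * v) \<le> e1 * h * (1 + v\<^sup>2)"
      proof -
        have "(d - h * F x) * (2 * v) \<le> \<bar>d - h * F x\<bar> * (2 * \<bar>v\<bar>)"
          using abs_ge_self[of "(d - h * F x) * (2 * v)"] by (simp add: abs_mult)
        also have "\<dots> \<le> e1 * h * (1 + v\<^sup>2)"
          using d sum_squares_bound[of 1 "\<bar>v\<bar>"] e1 h by (intro mult_mono) auto
        finally show ?thesis .
      qed
      ultimately have "d * (d + 2 * v) \<le> h\<^sup>2 * (M + 1)\<^sup>2 + e1 * h + 2 * h * (F x * v) + e1 * h * v\<^sup>2"
        by (simp add: algebra_simps power2_eq_square)
      then show "(W (t + h) x - W t x) * (W (t + h) x - W t x + 2 * (W t x - Z t x))
        \<le> h\<^sup>2 * (M + 1)\<^sup>2 + e1 * h + 2 * h * (F x * (W t x - Z t x)) + e1 * h * (W t x - Z t x)\<^sup>2"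
        by (simp add: d_def v_def)
    qed
    also have "\<dots> = (h\<^sup>2 * (M + 1)\<^sup>2 + e1 * h) * s t + 2 * h * integral {0..s t} (\<lambda>x. F x * (W t x - Z t x))
        + e1 * h * integral {0..s t} (\<lambda>x. (W t x - Z t x)\<^sup>2)"
      using W_dom(2)[OF t0]
      by (simp add: Henstock_Kurzweil_Integration.integral_add integrable_continuous_interval continuous_intros c)
    also have "\<dots> \<le> (h\<^sup>2 * (M + 1)\<^sup>2 + e1 * h) * R + 2 * h * (- lam * (2 * \<mu> * E t)) + e1 * h * (R * N\<^sup>2)"
    proof (intro add_mono mult_left_mono)
      have "integral {0..s t} (\<lambda>x. F x * (W t x - Z t x))
         = integral {0..s t} (\<lambda>x. \<alpha> * (W'' t x * (W t x - Z t x)) - lam * (W t x * (W t x - Z t x)))"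
        by (intro arg_cong[where f="integral {0..s t}"] ext) (simp add: F_def algebra_simps)
      also have "\<dots> = \<alpha> * integral {0..s t} (\<lambda>x. W'' t x * (W t x - Z t x))
          - lam * integral {0..s t} (\<lambda>x. W t x * (W t x - Z t x))"
        by (simp add: Henstock_Kurzweil_Integration.integral_diff integrable_continuous_interval continuous_intros c
            W''_cont[OF t])
      also have "integral {0..s t} (\<lambda>x. W'' t x * (W t x - Z t x)) \<le> 0"
        by (rule yosida_dissipation[OF mu W_dom(2,1)[OF t0] Z[OF t0] W'[OF t] W''[OF t] W''_cont[OF t] W_0[OF t]
            W_outside[OF t0 order_refl s_le[OF t0]]])
      also have "lam * integral {0..s t} (\<lambda>x. W t x * (W t x - Z t x)) = lam * (2 * \<mu> * E t)"
        using mu by (simp add: E_def yosida_def)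
      finally show "integral {0..s t} (\<lambda>x. F x * (W t x - Z t x)) \<le> - lam * (2 * \<mu> * E t)"
        using \<alpha> by (simp add: mult_left_mono)
    qed (use h e1 s_le[OF t0] integral_sq_le(1)[OF t0 N(2)] in auto)
    finally have "2 * \<mu> * (E (t + h) - E t)
       \<le> (h\<^sup>2 * (M + 1)\<^sup>2 + e1 * h) * R + 2 * h * (- lam * (2 * \<mu> * E t)) + e1 * h * (R * N\<^sup>2) + e1 * h"
      using E_increment[OF t0 th(2)] \<delta>(3)[OF h(1,2)] by linarith
    also have "\<dots> = h * (h * (R * (M + 1)\<^sup>2)) + h * (e1 * C) - 2 * \<mu> * (2 * lam * h * E t)"
      by (simp add: C_def algebra_simps power2_eq_square)
    also have "\<dots> \<le> h * (\<mu> * e) + h * (\<mu> * e) - 2 * \<mu> * (2 * lam * h * E t)"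
      using h e1 by (intro diff_right_mono add_mono mult_left_mono) auto
    also have "\<dots> = 2 * \<mu> * (e * h - 2 * lam * h * E t)" by (simp add: algebra_simps)
    finally have "E (t + h) - E t \<le> e * h - 2 * lam * h * E t"
      by (rule mult_left_le_imp_le) (use mu in simp)
    then show "E (t + h) \<le> (1 - 2 * lam * h) * E t + e * h"
      by (simp add: algebra_simps)
  qed
qed

text \<open>With the integrating factor exp (2 lam t), \<open>E_step\<close> becomes the Dini
  estimate of \<open>dini_nonincreasing\<close>. The local one-sided modulus derived from
  \<open>E_modulus\<close> serves both for the approach from the left and for the initial
  time.\<close>

lemma E_decay:
  assumes "0 \<le> t"
  shows "E t \<le> E 0 * exp (- 2 * lam * t)"
proof -
  define g where "g t = exp (2 * lam * t) * E t" for t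
  have modulus: "\<exists>\<delta>>0. \<forall>r t. 0 \<le> r \<and> r \<le> t \<and> \<bar>r - \<tau>\<bar> < \<delta> \<and> \<bar>t - \<tau>\<bar> < \<delta> \<longrightarrow> g t \<le> g r + e"
    if \<tau>: "0 \<le> \<tau>" and e: "0 < e" for \<tau> e
  proof -
    obtain N where N: "N > 0" "\<And>x. x \<in> {0..R} \<Longrightarrow> \<bar>W \<tau> x\<bar> \<le> N" using W_bound[OF \<tau>] by blast
    define G where "G = exp (2 * lam * (\<tau> + 1))"
    have G: "G > 0" by (simp add: G_def)
    \<comment> \<open>One constant for two purposes: it bounds E near \<tau>, and e1 C bounds its
      increase. N + 1 appears because nearby profiles differ from the one at \<tau> by at most
      1.\<close>
    define C where "C = R * (3 + (N + 1)\<^sup>2) / (2 * \<mu>)"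
    have C: "C > 0" using R_pos mu by (simp add: C_def add_pos_nonneg)
    have C2: "2 * \<mu> * C = R * (3 + (N + 1)\<^sup>2)" using mu by (simp add: C_def)
    define e1 where "e1 = min 1 (e / (2 * G * C))"
    have e1: "0 < e1" "e1 \<le> 1" "G * (e1 * C) \<le> e / 2"
    proof -
      show "0 < e1" "e1 \<le> 1" using e G C by (auto simp: e1_def)
      have "G * (e1 * C) \<le> G * (e / (2 * G * C) * C)"
        using G C by (intro mult_left_mono mult_right_mono) (auto simp: e1_def)
      then show "G * (e1 * C) \<le> e / 2" using G C by simp
    qed
    obtain \<delta>1 where \<delta>1: "\<delta>1 > 0" "\<And>r x. 0 \<le> r \<Longrightarrow> \<bar>r - \<tau>\<bar> < \<delta>1 \<Longrightarrow> x \<in> {0..R} \<Longrightarrow> \<bar>W r x - W \<tau> x\<bar> \<le> e1 / 2"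
      using W_time_cont[OF \<tau> half_gt_zero[OF e1(1)]] by blast
    have "isCont (\<lambda>t. exp (2 * lam * t)) \<tau>" by simp
    moreover have "0 < e / (4 * C)" using e C by simp
    ultimately have "\<exists>\<delta>2>0. \<forall>r. dist r \<tau> < \<delta>2 \<longrightarrow> dist (exp (2 * lam * r)) (exp (2 * lam * \<tau>)) < e / (4 * C)"
      unfolding continuous_at_eps_delta by blast
    then obtain \<delta>2 where \<delta>2: "\<delta>2 > 0"
      "\<And>r. \<bar>r - \<tau>\<bar> < \<delta>2 \<Longrightarrow> \<bar>exp (2 * lam * r) - exp (2 * lam * \<tau>)\<bar> < e / (4 * C)"
      unfolding dist_real_def by blast
    show ?thesis
    proof (intro exI[of _ "min 1 (min \<delta>1 \<delta>2)"] conjI allI impI)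
      show "0 < min 1 (min \<delta>1 \<delta>2)" using \<delta>1 \<delta>2 by simp
      fix r t assume "0 \<le> r \<and> r \<le> t \<and> \<bar>r - \<tau>\<bar> < min 1 (min \<delta>1 \<delta>2) \<and> \<bar>t - \<tau>\<bar> < min 1 (min \<delta>1 \<delta>2)"
      then have r: "0 \<le> r" "r \<le> t" "\<bar>r - \<tau>\<bar> < \<delta>1" "\<bar>t - \<tau>\<bar> < \<delta>1" "\<bar>r - \<tau>\<bar> < \<delta>2" "\<bar>t - \<tau>\<bar> < \<delta>2" "t \<le> \<tau> + 1"
        by auto
      have Nr: "\<bar>W r x\<bar> \<le> N + 1" if "x \<in> {0..R}" for x
        using \<delta>1(2)[OF r(1,3) that] N(2)[OF that] e1 by linarith
      have close: "\<bar>W t x - W r x\<bar> \<le> e1" if "x \<in> {0..R}" for x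
        using \<delta>1(2)[OF r(1,3) that] \<delta>1(2)[OF _ r(4) that] r by linarith
      have "2 * \<mu> * (E t - E r) \<le> e1 * (R * (3 + (N + 1)\<^sup>2))"
        by (rule E_modulus[OF r(1,2) e1(1,2) close Nr])
      then have "2 * \<mu> * (E t - E r) \<le> 2 * \<mu> * (e1 * C)" unfolding C2 [symmetric] by (simp add: mult_ac)
      then have 1: "E t - E r \<le> e1 * C" by (rule mult_left_le_imp_le) (use mu in simp)
      have "2 * \<mu> * E r \<le> R * (N + 1)\<^sup>2" by (rule integral_sq_le(2)[OF r(1) Nr])
      also have "\<dots> \<le> R * (3 + (N + 1)\<^sup>2)" using R_pos by simp
      finally have "2 * \<mu> * E r \<le> 2 * \<mu> * C" unfolding C2 .
      then have 2: "E r \<le> C" by (rule mult_left_le_imp_le) (use mu in simp)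
      have "g t - g r = exp (2 * lam * t) * (E t - E r) + (exp (2 * lam * t) - exp (2 * lam * r)) * E r"
        by (simp add: g_def algebra_simps)
      also have "\<dots> \<le> G * (e1 * C) + e / (2 * C) * C"
      proof (rule add_mono)
        have "exp (2 * lam * t) * (E t - E r) \<le> exp (2 * lam * t) * (e1 * C)" using 1 by simp
        also have "\<dots> \<le> G * (e1 * C)"
          using r lam e1 C by (intro mult_right_mono) (auto simp: G_def)
        finally show "exp (2 * lam * t) * (E t - E r) \<le> G * (e1 * C)" .
        have "exp (2 * lam * t) - exp (2 * lam * r) \<le> e / (4 * C) + e / (4 * C)"
          using \<delta>2(2)[OF r(5)] \<delta>2(2)[OF r(6)] by linarith
        also have "\<dots> = e / (2 * C)" by simp
        finally show "(exp (2 * lam * t) - exp (2 * lam * r)) * E r \<le> e / (2 * C) * C"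
          using 2 E_nonneg[OF r(1)] e C by (intro mult_mono) auto
      qed
      also have "\<dots> \<le> e" using e1 C by simp
      finally show "g t \<le> g r + e" by simp
    qed
  qed
  have "g t \<le> g 0"
  proof (rule dini_nonincreasing[where a = 0])
    fix t e :: real assume t: "0 < t" and e: "0 < e"
    define G where "G = exp (2 * lam * (t + 1))"
    have G: "G > 0" by (simp add: G_def)
    obtain \<delta> where \<delta>: "\<delta> > 0" "\<And>h. 0 < h \<Longrightarrow> h < \<delta> \<Longrightarrow> E (t + h) \<le> (1 - 2 * lam * h) * E t + e / G * h"
      using E_step[OF t divide_pos_pos[OF e G]] by blast
    have "g (t + h) \<le> g t + e * h" if h: "0 < h" "h < min 1 \<delta>" for h
    proof -
      have "g (t + h) \<le> exp (2 * lam * (t + h)) * ((1 - 2 * lam * h) * E t + e / G * h)"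
        using \<delta>(2)[of h] h by (simp add: g_def)
      also have "\<dots> = exp (2 * lam * (t + h)) * (1 - 2 * lam * h) * E t + exp (2 * lam * (t + h)) * (e / G * h)"
        by (simp add: algebra_simps)
      also have "\<dots> \<le> exp (2 * lam * t) * E t + G * (e / G * h)"
      proof (intro add_mono mult_right_mono)
        \<comment> \<open>1 - y \<le> exp (- y) lets the integrating factor absorb the contraction
          without a second-order remainder.\<close>
        have "exp (2 * lam * (t + h)) * (1 - 2 * lam * h) \<le> exp (2 * lam * (t + h)) * exp (- (2 * lam * h))"
          using exp_ge_add_one_self[of "- (2 * lam * h)"] by (intro mult_left_mono) auto
        also have "\<dots> = exp (2 * lam * (t + h) + - (2 * lam * h))" by (rule exp_add[symmetric])
        also have "2 * lam * (t + h) + - (2 * lam * h) = 2 * lam * t" by (simp add: distrib_left)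
        finally show "exp (2 * lam * (t + h)) * (1 - 2 * lam * h) \<le> exp (2 * lam * t)" .
        show "exp (2 * lam * (t + h)) \<le> G" using h lam by (simp add: G_def)
      qed (use E_nonneg[of t] t e G h in auto)
      finally show ?thesis using G by (simp add: g_def)
    qed
    moreover have "0 < min 1 \<delta>" using \<delta>(1) by simp
    ultimately show "\<exists>\<delta>>0. \<forall>h. 0 < h \<and> h < \<delta> \<longrightarrow> g (t + h) \<le> g t + e * h"
      by blast
    obtain \<delta>' where \<delta>': "\<delta>' > 0"
      "\<And>r t'. 0 \<le> r \<Longrightarrow> r \<le> t' \<Longrightarrow> \<bar>r - t\<bar> < \<delta>' \<Longrightarrow> \<bar>t' - t\<bar> < \<delta>' \<Longrightarrow> g t' \<le> g r + e"
      using modulus[OF less_imp_le[OF t] e] by blast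
    show "\<exists>\<delta>>0. \<forall>r. 0 \<le> r \<and> t - \<delta> < r \<and> r < t \<longrightarrow> g t \<le> g r + e"
      using \<delta>'(1) by (intro exI[of _ \<delta>'] conjI allI impI \<delta>'(2)) linarith+
  next
    fix e :: real assume e: "0 < e"
    obtain \<delta>' where \<delta>': "\<delta>' > 0"
      "\<And>r t'. 0 \<le> r \<Longrightarrow> r \<le> t' \<Longrightarrow> \<bar>r - 0\<bar> < \<delta>' \<Longrightarrow> \<bar>t' - 0\<bar> < \<delta>' \<Longrightarrow> g t' \<le> g r + e"
      using modulus[OF order_refl e] by blast
    show "\<exists>\<delta>>0. \<forall>h. 0 < h \<and> h < \<delta> \<longrightarrow> g (0 + h) \<le> g 0 + e"
      using \<delta>'(1) by (intro exI[of _ \<delta>'] conjI allI impI \<delta>'(2)) linarith+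
  qed (fact assms)
  then have "exp (2 * lam * t) * E t \<le> E 0" by (simp add: g_def)
  then have "E t \<le> E 0 / exp (2 * lam * t)" by (simp add: pos_le_divide_eq mult.commute)
  then show ?thesis by (simp add: exp_minus divide_inverse)
qed

lemma yosida_decay:
  assumes "0 \<le> t"
  shows "yosida \<mu> (s t) (W t) (Z t) \<le> yosida \<mu> (s 0) (W 0) (Z 0) * exp (- 2 * lam * t)"
  using E_decay[OF assms] unfolding E_def .

end

text \<open>The energy decays for each fixed \<mu>, starting from a bound B that does not involve
  \<mu>; at the fixed time t the regularization is then removed. The bound \<open>K\<close> of w''
  may blow up as t tends to 0, but it does not depend on \<mu>.\<close>

theorem dirichlet_decay:
  assumes B: "\<And>\<mu> z zx. 0 < \<mu> \<Longrightarrow> yosida_resolvent \<mu> (s 0) (W 0) z zx \<Longrightarrow> yosida \<mu> (s 0) (W 0) z \<le> B"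
    and t: "0 < t"
  shows "integral {0..s t} (\<lambda>x. (W' t x)\<^sup>2) \<le> 2 * B * exp (- 2 * lam * t)"
proof -
  define B' where "B' = B * exp (- 2 * lam * t)"
  have t0: "0 \<le> t" using t by simp
  obtain K where K: "\<And>x. x \<in> {0..s t} \<Longrightarrow> \<bar>W'' t x\<bar> \<le> K"
    using continuous_on_Icc_bounded[OF W''_cont[OF t]] by blast
  have main: "integral {0..s t} (\<lambda>x. (W' t x)\<^sup>2) \<le> 2 * B' + e * s t + K\<^sup>2 * B' / (2 * e) * \<mu>"
    if e: "e > 0" and mu: "\<mu> > 0" for e \<mu>
  proof -
    have "\<exists>z zx. yosida_resolvent \<mu> (s r) (W r) z zx" if "0 \<le> r" for r
      using yosida_resolvent_exists[OF s_pos[OF that] mu W_dom(1)[OF that]] by blast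
    then obtain Z Zx where Z: "\<And>r. 0 \<le> r \<Longrightarrow> yosida_resolvent \<mu> (s r) (W r) (Z r) (Zx r)"
      by metis
    have "yosida \<mu> (s t) (W t) (Z t) \<le> yosida \<mu> (s 0) (W 0) (Z 0) * exp (- 2 * lam * t)"
      by (rule yosida_decay[OF mu Z t0])
    also have "\<dots> \<le> B'" unfolding B'_def using B[OF mu Z] by (intro mult_right_mono) auto
    finally have "yosida \<mu> (s t) (W t) (Z t) \<le> B'" .
    from dirichlet_le_yosida[OF mu less_imp_le[OF s_pos[OF t0]] W_dom(1)[OF t0] Z[OF t0]
         W'[OF t] W''[OF t] W''_cont[OF t] W_0[OF t] W_outside[OF t0 order_refl s_le[OF t0]] K e this]
    show ?thesis .
  qed
  have "integral {0..s t} (\<lambda>x. (W' t x)\<^sup>2) \<le> 2 * B' + e" if e: "e > 0" for e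
  proof -
    \<comment> \<open>Scaled so that the error term of \<open>dirichlet_le_yosida\<close> without
      \<mu> becomes e; this is kept while \<mu> tends to 0.\<close>
    define e' where "e' = e / s t"
    have e': "e' > 0" "e' * s t = e" using e s_pos[OF t0] by (auto simp: e'_def)
    have "((\<lambda>\<mu>. 2 * B' + e + K\<^sup>2 * B' / (2 * e') * \<mu>) \<longlongrightarrow> 2 * B' + e + K\<^sup>2 * B' / (2 * e') * 0) (at_right 0)"
      by (intro tendsto_intros)
    moreover have "\<forall>\<^sub>F \<mu> in at_right 0. integral {0..s t} (\<lambda>x. (W' t x)\<^sup>2) \<le> 2 * B' + e + K\<^sup>2 * B' / (2 * e') * \<mu>"
      using main[OF e'(1)] e'(2) by (intro eventually_at_rightI[of 0 1]) auto
    ultimately have "integral {0..s t} (\<lambda>x. (W' t x)\<^sup>2) \<le> 2 * B' + e + K\<^sup>2 * B' / (2 * e') * 0"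
      by (rule tendsto_lowerbound) simp
    then show ?thesis by simp
  qed
  then have "integral {0..s t} (\<lambda>x. (W' t x)\<^sup>2) \<le> 2 * B'" by (rule field_le_epsilon)
  then show ?thesis by (simp add: B'_def)
qed

end

subsection \<open>Weakly differentiable functions\<close>

text \<open>G is merely integrable, so w has no pointwise derivative to differentiate a product
  with. Inserting the integral representation of w and exchanging the order of integration over the
  triangle y \<le> x replaces the product rule.\<close>

lemma weak_integral_by_parts:
  fixes w h h' G :: "real \<Rightarrow> real"
  assumes s: "0 \<le> s" and G: "set_integrable lborel {0..s} G" and cw: "continuous_on {0..s} w"
    and w: "\<And>x. x \<in> {0..s} \<Longrightarrow> w x = w 0 + (LINT y:{0..x}|lborel. G y)"
    and h: "\<And>x. x \<in> {0..s} \<Longrightarrow> (h has_real_derivative h' x) (at x within {0..s})"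
    and ch': "continuous_on {0..s} h'"
  shows "integral {0..s} (\<lambda>x. w x * h' x) = w s * h s - w 0 * h 0 - (LINT x:{0..s}|lborel. G x * h x)"
proof -
  have ch: "continuous_on {0..s} h" by (rule DERIV_continuous_on, erule h)
  define p where "p x = indicator {0..s} x * h' x" for x
  define q where "q y = indicator {0..s} y * G y" for y
  have p: "integrable lborel p"
    using borel_integrable_atLeastAtMost'[OF ch'] by (simp add: set_integrable_def p_def[abs_def])
  have q: "integrable lborel q"
    using G by (simp add: set_integrable_def q_def[abs_def])
  note [measurable] = borel_measurable_integrable[OF p] borel_measurable_integrable[OF q]
  \<comment> \<open>The integrand on the triangle; the integral over y returns w - w(0), the one
    over x returns h(s) - h.\<close>
  define f where "f x y = p x * q y * (if y \<le> x then 1 else 0)" for x y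
  have "integrable (lborel \<Otimes>\<^sub>M lborel) (\<lambda>z. p (fst z) * q (snd z))"
  proof (rule lborel_pair.Fubini_integrable)
    show "(\<lambda>z. p (fst z) * q (snd z)) \<in> borel_measurable (lborel \<Otimes>\<^sub>M lborel)" by measurable
    have "(\<lambda>x. LINT y|lborel. norm (p (fst (x, y)) * q (snd (x, y)))) = (\<lambda>x. norm (p x) * (LINT y|lborel. norm (q y)))"
      by (simp add: abs_mult)
    then show "integrable lborel (\<lambda>x. LINT y|lborel. norm (p (fst (x, y)) * q (snd (x, y))))"
      using p by simp
    show "AE x in lborel. integrable lborel (\<lambda>y. p (fst (x, y)) * q (snd (x, y)))"
      using q by simp
  qed
  then have "integrable (lborel \<Otimes>\<^sub>M lborel) (case_prod f)"
  proof (rule Bochner_Integration.integrable_bound)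
    show "case_prod f \<in> borel_measurable (lborel \<Otimes>\<^sub>M lborel)" unfolding f_def by measurable
    show "AE z in lborel \<Otimes>\<^sub>M lborel. norm (case_prod f z) \<le> norm (p (fst z) * q (snd z))"
      by (auto simp: f_def)
  qed
  from lborel_pair.Fubini_integral[OF this]
  have swap: "(LINT y|lborel. LINT x|lborel. f x y) = (LINT x|lborel. LINT y|lborel. f x y)" .
  have "(LINT y|lborel. f x y) = indicator {0..s} x * (h' x * (w x - w 0))" for x
  proof (cases "x \<in> {0..s}")
    case True
    have "(LINT y|lborel. f x y) = (LINT y|lborel. h' x * (indicator {0..x} y * G y))"
      by (rule Bochner_Integration.integral_cong) (use True in \<open>auto simp: f_def p_def q_def indicator_def\<close>)
    also have "\<dots> = h' x * (w x - w 0)"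
      using w[OF True] by (simp add: set_lebesgue_integral_def)
    finally show ?thesis using True by simp
  qed (simp add: f_def p_def)
  then have "(LINT x|lborel. LINT y|lborel. f x y) = (LINT x:{0..s}|lborel. h' x * (w x - w 0))"
    by (simp add: set_lebesgue_integral_def)
  also have "\<dots> = integral {0..s} (\<lambda>x. h' x * (w x - w 0))"
    by (intro set_borel_integral_eq_integral borel_integrable_atLeastAtMost' continuous_intros ch' cw)
  also have "\<dots> = integral {0..s} (\<lambda>x. w x * h' x - w 0 * h' x)"
    by (simp add: algebra_simps)
  also have "\<dots> = integral {0..s} (\<lambda>x. w x * h' x) - w 0 * integral {0..s} h'"
    by (simp add: Henstock_Kurzweil_Integration.integral_diff integrable_continuous_interval continuous_intros ch' cw)
  also have "integral {0..s} h' = h s - h 0"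
    using s h by (intro integral_unique fundamental_theorem_of_calculus)
      (auto simp: has_real_derivative_iff_has_vector_derivative[symmetric])
  finally have 1: "(LINT x|lborel. LINT y|lborel. f x y)
      = integral {0..s} (\<lambda>x. w x * h' x) - w 0 * (h s - h 0)" .
  have "(LINT x|lborel. f x y) = indicator {0..s} y * (G y * (h s - h y))" for y
  proof (cases "y \<in> {0..s}")
    case True
    have "(LINT x|lborel. f x y) = (LINT x|lborel. G y * (indicator {y..s} x * h' x))"
      by (rule Bochner_Integration.integral_cong) (use True in \<open>auto simp: f_def p_def q_def indicator_def\<close>)
    also have "\<dots> = G y * (LINT x:{y..s}|lborel. h' x)"
      by (simp add: set_lebesgue_integral_def)
    also have "(LINT x:{y..s}|lborel. h' x) = integral {y..s} h'"
      using True by (intro set_borel_integral_eq_integral borel_integrable_atLeastAtMost' continuous_on_subset[OF ch']) auto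
    also have "\<dots> = h s - h y"
    proof (intro integral_unique fundamental_theorem_of_calculus)
      fix x assume "x \<in> {y..s}"
      then show "(h has_vector_derivative h' x) (at x within {y..s})"
        unfolding has_real_derivative_iff_has_vector_derivative[symmetric]
        using True by (intro DERIV_subset[OF h]) auto
    qed (use True in auto)
    finally show ?thesis using True by simp
  qed (simp add: f_def q_def)
  then have 2: "(LINT y|lborel. LINT x|lborel. f x y) = (LINT y:{0..s}|lborel. G y * (h s - h y))"
    by (simp add: set_lebesgue_integral_def)
  have Gh: "set_integrable lborel {0..s} (\<lambda>x. G x * h x)"
  proof -
    obtain K where K: "\<And>x. x \<in> {0..s} \<Longrightarrow> \<bar>h x\<bar> \<le> K" "K > 0"
      using continuous_on_Icc_bounded[OF ch] by blast
    have hm [measurable]: "(\<lambda>x. indicator {0..s} x * h x) \<in> borel_measurable lborel"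
      using borel_measurable_integrable[OF borel_integrable_atLeastAtMost'[OF ch, unfolded set_integrable_def]] by simp
    have "integrable lborel (\<lambda>x. q x * (indicator {0..s} x * h x))"
    proof (rule Bochner_Integration.integrable_bound)
      show "integrable lborel (\<lambda>x. K * q x)" using q by simp
      show "AE x in lborel. norm (q x * (indicator {0..s} x * h x)) \<le> norm (K * q x)"
        using K by (auto simp: abs_mult q_def indicator_def mult.commute[of "K"] intro!: mult_left_mono)
    qed measurable
    moreover have "(\<lambda>x. q x * (indicator {0..s} x * h x)) = (\<lambda>x. indicator {0..s} x *\<^sub>R (G x * h x))"
      by (auto simp: q_def indicator_def)
    ultimately show ?thesis by (simp add: set_integrable_def)
  qed
  have "(LINT y:{0..s}|lborel. G y * (h s - h y)) = (LINT y:{0..s}|lborel. G y * h s - G y * h y)"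
    by (simp add: right_diff_distrib)
  also have "\<dots> = (LINT y:{0..s}|lborel. G y * h s) - (LINT y:{0..s}|lborel. G y * h y)"
    using G Gh by (intro set_integral_diff) auto
  also have "(LINT y:{0..s}|lborel. G y * h s) = (w s - w 0) * h s"
    using w[of s] s by simp
  finally have 3: "(LINT y:{0..s}|lborel. G y * (h s - h y)) = (w s - w 0) * h s - (LINT x:{0..s}|lborel. G x * h x)" .
  from swap[unfolded 1 2 3] show ?thesis by (simp add: algebra_simps)
qed

text \<open>Twice the energy is the integral of G z_x, at most the mean of the integrals of G^2 and
  z_x^2; the latter is again at most twice the energy and is absorbed. The result does not see
  \<mu>.\<close>

lemma yosida_le_weak:
  assumes mu: "\<mu> > 0" and s: "0 \<le> s" and res: "yosida_resolvent \<mu> s w z zx" and cw: "continuous_on {0..s} w"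
    and G: "set_integrable lborel {0..s} G" and G2: "set_integrable lborel {0..s} (\<lambda>x. (G x)\<^sup>2)"
    and w: "\<And>x. x \<in> {0..s} \<Longrightarrow> w x = w 0 + (LINT y:{0..x}|lborel. G y)"
    and w0: "w 0 = 0" "w s = 0"
  shows "2 * yosida \<mu> s w z \<le> (LINT x:{0..s}|lborel. (G x)\<^sup>2)"
proof -
  note d = yosida_resolvent_DERIV[OF mu s cw res]
  note c = yosida_resolvent_continuous_on[OF mu s cw res] cw
  have "2 * yosida \<mu> s w z = - integral {0..s} (\<lambda>x. w x * ((z x - w x) / \<mu>))"
  proof -
    have "integral {0..s} (\<lambda>x. w x * (w x - z x)) = integral {0..s} (\<lambda>x. - \<mu> * (w x * ((z x - w x) / \<mu>)))"
      using mu by (intro arg_cong[where f="integral {0..s}"] ext) (simp add: field_simps)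
    then show ?thesis using mu by (simp add: yosida_def)
  qed
  also have "integral {0..s} (\<lambda>x. w x * ((z x - w x) / \<mu>)) = - (LINT x:{0..s}|lborel. G x * zx x)"
    using weak_integral_by_parts[OF s G cw w d(2)] w0 mu by (simp add: continuous_intros c)
  finally have 1: "2 * yosida \<mu> s w z = (LINT x:{0..s}|lborel. G x * zx x)" by simp
  have zx2: "set_integrable lborel {0..s} (\<lambda>x. (zx x)\<^sup>2)"
    by (intro borel_integrable_atLeastAtMost' continuous_intros c)
  have bnd: "set_integrable lborel {0..s} (\<lambda>x. (G x)\<^sup>2 / 2 + (zx x)\<^sup>2 / 2)"
    using G2 zx2 by auto
  have pw: "\<bar>G x * zx x\<bar> \<le> (G x)\<^sup>2 / 2 + (zx x)\<^sup>2 / 2" for x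
    using sum_squares_bound[of "\<bar>G x\<bar>" "\<bar>zx x\<bar>"] by (simp add: abs_mult)
  have "(LINT x:{0..s}|lborel. G x * zx x) \<le> (LINT x:{0..s}|lborel. (G x)\<^sup>2 / 2 + (zx x)\<^sup>2 / 2)"
    unfolding set_lebesgue_integral_def
  proof (rule integral_mono')
    show "integrable lborel (\<lambda>x. indicat_real {0..s} x *\<^sub>R ((G x)\<^sup>2 / 2 + (zx x)\<^sup>2 / 2))"
      using bnd by (simp add: set_integrable_def)
    show "indicat_real {0..s} x *\<^sub>R (G x * zx x) \<le> indicat_real {0..s} x *\<^sub>R ((G x)\<^sup>2 / 2 + (zx x)\<^sup>2 / 2)" for x
      using pw[of x] by (auto simp: indicator_def)
    show "0 \<le> indicat_real {0..s} x *\<^sub>R ((G x)\<^sup>2 / 2 + (zx x)\<^sup>2 / 2)" for x by simp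
  qed
  also have "\<dots> = (LINT x:{0..s}|lborel. (G x)\<^sup>2) / 2 + (LINT x:{0..s}|lborel. (zx x)\<^sup>2) / 2"
    using G2 zx2 by (subst set_integral_add) auto
  also have "(LINT x:{0..s}|lborel. (zx x)\<^sup>2) = integral {0..s} (\<lambda>x. (zx x)\<^sup>2)"
    using zx2 by (rule set_borel_integral_eq_integral)
  also have "\<dots> \<le> 2 * yosida \<mu> s w z" by (rule yosida_deriv[OF mu s cw res])
  finally show ?thesis using 1 by simp
qed

text \<open>The Cauchy-Schwarz inequality against the constant 1, from the nonnegativity of the
  variance of f.\<close>

lemma integral_square_le:
  fixes f :: "real \<Rightarrow> real"
  assumes "continuous_on {a..b} f" "a \<le> b"
  shows "(integral {a..b} f)\<^sup>2 \<le> (b - a) * integral {a..b} (\<lambda>x. (f x)\<^sup>2)"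
proof (cases "a = b")
  case False
  with assms have ab: "0 < b - a" by simp
  define I where "I = integral {a..b} f"
  have "0 \<le> integral {a..b} (\<lambda>x. ((b - a) * f x - I)\<^sup>2)"
    by (intro Henstock_Kurzweil_Integration.integral_nonneg integrable_continuous_interval continuous_intros assms) simp
  also have "\<dots> = integral {a..b} (\<lambda>x. (b - a)\<^sup>2 * (f x)\<^sup>2 - 2 * (b - a) * I * f x + I\<^sup>2)"
    by (intro arg_cong[where f="integral {a..b}"] ext) (simp add: power2_eq_square algebra_simps)
  also have "\<dots> = (b - a)\<^sup>2 * integral {a..b} (\<lambda>x. (f x)\<^sup>2) - 2 * (b - a) * I * integral {a..b} f + I\<^sup>2 * (b - a)"
    using assms by (simp add: Henstock_Kurzweil_Integration.integral_add Henstock_Kurzweil_Integration.integral_diff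
        integrable_continuous_interval continuous_intros)
  also have "\<dots> = (b - a) * ((b - a) * integral {a..b} (\<lambda>x. (f x)\<^sup>2) - I\<^sup>2)"
    unfolding I_def[symmetric] by (simp add: power2_eq_square algebra_simps)
  finally show ?thesis using ab by (simp add: zero_le_mult_iff I_def)
qed simp

subsection \<open>Bounds for the Volterra transformation and its inverse\<close>

lemma kern_bounded:
  obtains M where "M > 0"
    "\<And>x y. x \<in> {0..R} \<Longrightarrow> y \<in> {0..R} \<Longrightarrow> \<bar>kern c x y\<bar> \<le> M"
    "\<And>x y. x \<in> {0..R} \<Longrightarrow> y \<in> {0..R} \<Longrightarrow> \<bar>kern_x c x y\<bar> \<le> M"
proof -
  have "compact ((\<lambda>z. kern c (fst z) (snd z)) ` ({0..R} \<times> {0..R}))"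
    "compact ((\<lambda>z. kern_x c (fst z) (snd z)) ` ({0..R} \<times> {0..R}))"
    by (intro compact_continuous_image continuous_intros compact_Times compact_Icc)+
  then obtain K L where "\<forall>y \<in> (\<lambda>z. kern c (fst z) (snd z)) ` ({0..R} \<times> {0..R}). norm y \<le> K"
    "\<forall>y \<in> (\<lambda>z. kern_x c (fst z) (snd z)) ` ({0..R} \<times> {0..R}). norm y \<le> L"
    using compact_imp_bounded bounded_iff by meson
  then have "\<bar>kern c x y\<bar> \<le> max 1 (max K L)" "\<bar>kern_x c x y\<bar> \<le> max 1 (max K L)"
    if "x \<in> {0..R}" "y \<in> {0..R}" for x y
    using that by (force simp: le_max_iff_disj)+
  then show ?thesis using that[of "max 1 (max K L)"] by auto
qed

lemma abs_integral_mult_le: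
  fixes k u :: "real \<Rightarrow> real"
  assumes "continuous_on {a..b} k" "continuous_on {a..b} u"
    and "\<And>y. y \<in> {a..b} \<Longrightarrow> \<bar>k y\<bar> \<le> M"
  shows "\<bar>integral {a..b} (\<lambda>y. k y * u y)\<bar> \<le> M * integral {a..b} (\<lambda>y. \<bar>u y\<bar>)"
proof -
  have "norm (integral {a..b} (\<lambda>y. k y * u y)) \<le> integral {a..b} (\<lambda>y. M * \<bar>u y\<bar>)"
    by (intro integral_norm_bound_integral integrable_continuous_interval continuous_intros assms)
      (use assms(3) in \<open>auto simp: abs_mult intro!: mult_right_mono\<close>)
  then show ?thesis by simp
qed

text \<open>The weight \<open>exp (2 M (s - y))\<close> makes the Volterra operator a contraction with factor \<open>1/2\<close>.\<close>

lemma volt_inverse_bound: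
  assumes M: "M > 0" "\<And>x y. x \<in> {0..R} \<Longrightarrow> y \<in> {0..R} \<Longrightarrow> \<bar>kern c x y\<bar> \<le> M"
    and s: "0 \<le> s" "s \<le> R" and cu: "continuous_on {0..s} u"
    and V: "\<And>x. x \<in> {0..s} \<Longrightarrow> \<bar>volt c s u x\<bar> \<le> V" and x: "x \<in> {0..s}"
  shows "\<bar>u x\<bar> \<le> 2 * exp (2 * M * R) * V"
proof -
  define \<phi> where "\<phi> y = exp (- (2 * M * (s - y))) * \<bar>u y\<bar>" for y
  have "continuous_on {0..s} \<phi>" unfolding \<phi>_def[abs_def] by (intro continuous_intros cu)
  then obtain m where m: "m \<in> {0..s}" "\<And>y. y \<in> {0..s} \<Longrightarrow> \<phi> y \<le> \<phi> m"
    using continuous_attains_sup[of "{0..s}" \<phi>] x by auto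
  have wt: "\<phi> y * exp (2 * M * (s - y)) = \<bar>u y\<bar>" for y
    by (simp add: \<phi>_def exp_minus)
  have u_le: "\<bar>u y\<bar> \<le> \<phi> m * exp (2 * M * (s - y))" if "y \<in> {0..s}" for y
    unfolding wt[symmetric, of y] using m(2)[OF that] by (intro mult_right_mono) auto
  have V0: "0 \<le> V" using V[OF x] by linarith
  have \<phi>0: "0 \<le> \<phi> m" by (simp add: \<phi>_def)
  have sub: "{m..s} \<subseteq> {0..s}" using m by auto
  note cu' = continuous_on_subset[OF cu sub]
  have "\<bar>u m\<bar> \<le> V + M * integral {m..s} (\<lambda>y. \<bar>u y\<bar>)"
  proof -
    have "\<bar>integral {m..s} (\<lambda>y. kern c m y * u y)\<bar> \<le> M * integral {m..s} (\<lambda>y. \<bar>u y\<bar>)"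
      by (intro abs_integral_mult_le continuous_intros cu' M) (use m s in auto)
    then show ?thesis using V[OF m(1)] unfolding volt_def by linarith
  qed
  also have "integral {m..s} (\<lambda>y. \<bar>u y\<bar>) \<le> integral {m..s} (\<lambda>y. \<phi> m * exp (2 * M * (s - y)))"
    by (intro integral_le integrable_continuous_interval continuous_intros cu' u_le) (use m in auto)
  also have "\<dots> = \<phi> m * ((exp (2 * M * (s - m)) - 1) / (2 * M))"
  proof -
    have "((\<lambda>y. exp (2 * M * (s - y))) has_integral
        (- exp (2 * M * (s - s)) / (2 * M)) - (- exp (2 * M * (s - m)) / (2 * M))) {m..s}"
    proof (rule fundamental_theorem_of_calculus)
      show "((\<lambda>y. - exp (2 * M * (s - y)) / (2 * M)) has_vector_derivative exp (2 * M * (s - y))) (at y within {m..s})" for y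
        unfolding has_real_derivative_iff_has_vector_derivative[symmetric]
        using M(1) by (auto intro!: derivative_eq_intros)
    qed (use m in auto)
    then have "integral {m..s} (\<lambda>y. exp (2 * M * (s - y))) = (exp (2 * M * (s - m)) - 1) / (2 * M)"
      by (simp add: integral_unique diff_divide_distrib)
    then show ?thesis by simp
  qed
  finally have "\<bar>u m\<bar> \<le> V + M * (\<phi> m * ((exp (2 * M * (s - m)) - 1) / (2 * M)))"
    using M(1) by simp
  also have "\<dots> = V + \<phi> m * (exp (2 * M * (s - m)) - 1) / 2" using M(1) by simp
  also have "\<dots> \<le> V + \<phi> m * exp (2 * M * (s - m)) / 2" using \<phi>0 by (simp add: right_diff_distrib)
  also have "\<phi> m * exp (2 * M * (s - m)) = \<bar>u m\<bar>" by (rule wt)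
  finally have um: "\<bar>u m\<bar> \<le> 2 * V" by simp
  \<comment> \<open>Removing the weight: it is at most 1 at the maximum point and at least exp (- 2
    M R) at x.\<close>
  have "\<phi> m \<le> 1 * \<bar>u m\<bar>" unfolding \<phi>_def using M(1) m by (intro mult_right_mono) auto
  with um have "\<phi> m \<le> 2 * V" by simp
  moreover have "exp (2 * M * (s - x)) \<le> exp (2 * M * R)" using M(1) x s by simp
  ultimately have "\<phi> m * exp (2 * M * (s - x)) \<le> 2 * V * exp (2 * M * R)" using V0 by (intro mult_mono) auto
  with u_le[OF x] show ?thesis by (simp add: mult_ac)
qed

lemma square_sum3_le: "(a + b + c)\<^sup>2 \<le> 3 * (a\<^sup>2 + b\<^sup>2 + c\<^sup>2)" for a b c :: real
proof -
  have "3 * (a\<^sup>2 + b\<^sup>2 + c\<^sup>2) - (a + b + c)\<^sup>2 = (a - b)\<^sup>2 + (b - c)\<^sup>2 + (a - c)\<^sup>2"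
    by (simp add: power2_eq_square algebra_simps)
  then show ?thesis by (smt (verit) zero_le_power2)
qed

lemma square_sum_le: "(a + b)\<^sup>2 \<le> 2 * a\<^sup>2 + 2 * b\<^sup>2" for a b :: real
  using sum_squares_bound[of a b] by (simp add: power2_sum)

text \<open>w(0) = 0 and Cauchy-Schwarz bound sup |w| by the Dirichlet energy of w,
  \<open>volt_inverse_bound\<close> passes to sup |u|, and solving the formula for w_x for u' does
  the rest. K is fixed before s, since the kernel bounds hold on the whole square of side R.\<close>

lemma H1_le_volt_x:
  assumes R: "R > 0"
  obtains K where "K \<ge> 1"
    "\<And>s u u'. 0 < s \<Longrightarrow> s \<le> R \<Longrightarrow> u 0 = 0 \<Longrightarrow>
      (\<And>x. x \<in> {0..s} \<Longrightarrow> (u has_real_derivative u' x) (at x within {0..s})) \<Longrightarrow>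
      continuous_on {0..s} u' \<Longrightarrow>
      integral {0..s} (\<lambda>x. (u x)\<^sup>2) + integral {0..s} (\<lambda>x. (u' x)\<^sup>2)
        \<le> K * integral {0..s} (\<lambda>x. (volt_x c s u u' x)\<^sup>2)"
proof -
  obtain M where M: "M > 0"
    "\<And>x y. x \<in> {0..R} \<Longrightarrow> y \<in> {0..R} \<Longrightarrow> \<bar>kern c x y\<bar> \<le> M"
    "\<And>x y. x \<in> {0..R} \<Longrightarrow> y \<in> {0..R} \<Longrightarrow> \<bar>kern_x c x y\<bar> \<le> M"
    using kern_bounded by blast
  \<comment> \<open>L D bounds u^2 pointwise: the squared constant of
    \<open>volt_inverse_bound\<close> times R from Cauchy-Schwarz. N gathers what this contributes
    to the integrals of u^2 and u'^2.\<close>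
  define L where "L = 4 * (exp (2 * M * R))\<^sup>2 * R"
  define N where "N = R * (1 + 3 * (M\<^sup>2 + (M * R)\<^sup>2))"
  have L: "L \<ge> 0" "N \<ge> 0" using R by (simp_all add: L_def N_def)
  have "integral {0..s} (\<lambda>x. (u x)\<^sup>2) + integral {0..s} (\<lambda>x. (u' x)\<^sup>2)
        \<le> (3 + N * L) * integral {0..s} (\<lambda>x. (volt_x c s u u' x)\<^sup>2)"
    if s: "0 < s" "s \<le> R" and u0: "u 0 = 0"
      and u: "\<And>x. x \<in> {0..s} \<Longrightarrow> (u has_real_derivative u' x) (at x within {0..s})"
      and cu': "continuous_on {0..s} u'" for s u u'
  proof -
    have cu: "continuous_on {0..s} u" by (rule DERIV_continuous_on, erule u)
    have cv: "continuous_on {0..s} (volt_x c s u u')"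
      unfolding volt_x_def[abs_def] by (intro continuous_intros continuous_on_kern_integral cu cu')
    define D where "D = integral {0..s} (\<lambda>x. (volt_x c s u u' x)\<^sup>2)"
    have D0: "D \<ge> 0" unfolding D_def
      by (intro Henstock_Kurzweil_Integration.integral_nonneg integrable_continuous_interval continuous_intros cv) simp
    have V: "\<bar>volt c s u x\<bar> \<le> sqrt (R * D)" if x: "x \<in> {0..s}" for x
    proof -
      have sub: "{0..x} \<subseteq> {0..s}" using x by auto
      note cv' = continuous_on_subset[OF cv sub]
      have "(volt_x c s u u' has_integral volt c s u x - volt c s u 0) {0..x}"
      proof (rule fundamental_theorem_of_calculus)
        fix y assume y: "y \<in> {0..x}"
        then have "y \<in> {0..s}" using x by auto
        from DERIV_subset[OF DERIV_volt[where u' = u', OF cu this u[OF this]] sub]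
        show "(volt c s u has_vector_derivative volt_x c s u u' y) (at y within {0..x})"
          unfolding has_real_derivative_iff_has_vector_derivative[symmetric] .
      qed (use x in auto)
      moreover have "volt c s u 0 = 0" using u0 by (simp add: volt_def)
      ultimately have "(volt c s u x)\<^sup>2 = (integral {0..x} (volt_x c s u u'))\<^sup>2"
        by (simp add: integral_unique)
      also have "\<dots> \<le> (x - 0) * integral {0..x} (\<lambda>x. (volt_x c s u u' x)\<^sup>2)"
        using x by (intro integral_square_le cv') auto
      also have "\<dots> \<le> R * D"
      proof (rule mult_mono)
        show "integral {0..x} (\<lambda>x. (volt_x c s u u' x)\<^sup>2) \<le> D"
          unfolding D_def using sub
          by (intro integral_subset_le integrable_continuous_interval continuous_intros cv cv') auto
        show "0 \<le> integral {0..x} (\<lambda>x. (volt_x c s u u' x)\<^sup>2)"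
          by (intro Henstock_Kurzweil_Integration.integral_nonneg integrable_continuous_interval continuous_intros cv') simp
      qed (use x s R in auto)
      finally show ?thesis by (simp add: real_le_rsqrt)
    qed
    define v where "v = 2 * exp (2 * M * R) * sqrt (R * D)"
    have v: "\<bar>u x\<bar> \<le> v" if "x \<in> {0..s}" for x
      unfolding v_def by (rule volt_inverse_bound[OF M(1,2) less_imp_le[OF s(1)] s(2) cu V that])
    have v0: "0 \<le> v" using D0 R by (simp add: v_def)
    have v2: "v\<^sup>2 = L * D" using D0 R by (simp add: v_def L_def power_mult_distrib)
    have u2: "(u x)\<^sup>2 \<le> L * D" if "x \<in> {0..s}" for x
      unfolding v2[symmetric] using v[OF that] v0 by (simp add: abs_le_square_iff[symmetric])
    have u'2: "(u' x)\<^sup>2 \<le> 3 * (volt_x c s u u' x)\<^sup>2 + 3 * (M\<^sup>2 + (M * R)\<^sup>2) * (L * D)" if x: "x \<in> {0..s}" for x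
    proof -
      define a where "a = - kern c x x * u x"
      define b where "b = integral {x..s} (\<lambda>y. kern_x c x y * u y)"
      have sub: "{x..s} \<subseteq> {0..s}" using x by auto
      note c' = continuous_on_subset[OF cu sub]
      have "\<bar>a\<bar> \<le> M * v" unfolding a_def abs_mult
        using M(1,2) v[OF x] x s by (intro mult_mono) auto
      then have "a\<^sup>2 \<le> (M * v)\<^sup>2" using M v0 by (simp add: abs_le_square_iff[symmetric])
      moreover have "\<bar>b\<bar> \<le> M * R * v"
      proof -
        have "\<bar>b\<bar> \<le> M * integral {x..s} (\<lambda>y. \<bar>u y\<bar>)"
          unfolding b_def by (intro abs_integral_mult_le continuous_intros c' M(3)) (use x s in auto)
        also have "integral {x..s} (\<lambda>y. \<bar>u y\<bar>) \<le> integral {x..s} (\<lambda>y. v)"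
          by (intro integral_le integrable_continuous_interval continuous_intros c' v) (use x in auto)
        also have "\<dots> \<le> R * v" using x s v0 by (simp add: mult_right_mono)
        finally show ?thesis using M by simp
      qed
      then have "b\<^sup>2 \<le> (M * R * v)\<^sup>2" using M R v0 by (simp add: abs_le_square_iff[symmetric])
      moreover have "u' x = volt_x c s u u' x + a + b" by (simp add: volt_x_def a_def b_def)
      ultimately have "(u' x)\<^sup>2 \<le> 3 * ((volt_x c s u u' x)\<^sup>2 + (M * v)\<^sup>2 + (M * R * v)\<^sup>2)"
        using square_sum3_le[of "volt_x c s u u' x" a b] by simp
      then show ?thesis unfolding v2[symmetric] by (simp add: power_mult_distrib distrib_left distrib_right)
    qed
    have "integral {0..s} (\<lambda>x. (u x)\<^sup>2) \<le> integral {0..s} (\<lambda>x. L * D)"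
      by (intro integral_le integrable_continuous_interval continuous_intros cu u2)
    also have "\<dots> = s * (L * D)" using s by simp
    also have "\<dots> \<le> R * (L * D)" using s L D0 by (intro mult_right_mono) auto
    finally have 1: "integral {0..s} (\<lambda>x. (u x)\<^sup>2) \<le> R * (L * D)" .
    have "integral {0..s} (\<lambda>x. (u' x)\<^sup>2)
        \<le> integral {0..s} (\<lambda>x. 3 * (volt_x c s u u' x)\<^sup>2 + 3 * (M\<^sup>2 + (M * R)\<^sup>2) * (L * D))"
      by (intro integral_le integrable_continuous_interval continuous_intros cu' cv u'2)
    also have "\<dots> = 3 * D + s * (3 * (M\<^sup>2 + (M * R)\<^sup>2) * (L * D))"
      unfolding D_def using s
      by (subst Henstock_Kurzweil_Integration.integral_add)
        (auto intro!: integrable_continuous_interval continuous_intros cv)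
    also have "\<dots> \<le> 3 * D + R * (3 * (M\<^sup>2 + (M * R)\<^sup>2) * (L * D))"
      using s L D0 by (intro add_left_mono mult_right_mono) auto
    finally have "integral {0..s} (\<lambda>x. (u' x)\<^sup>2) \<le> 3 * D + R * (3 * (M\<^sup>2 + (M * R)\<^sup>2) * (L * D))" .
    with 1 show ?thesis unfolding D_def[symmetric] by (simp add: N_def algebra_simps)
  qed
  then show ?thesis using that[of "3 + N * L"] L by auto
qed

section \<open>The Sobolev norm with values in the extended reals, and the energy at time 0\<close>

lemma L2_sqnorm_continuous:
  assumes "continuous_on {0..l} u"
  shows "L2_sqnorm l u = ennreal (integral {0..l} (\<lambda>x. (u x)\<^sup>2))"
proof -
  have i: "set_integrable lborel {0..l} (\<lambda>x. (u x)\<^sup>2)"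
    by (intro borel_integrable_atLeastAtMost' continuous_intros assms)
  have "L2_sqnorm l u = (\<integral>\<^sup>+x. ennreal (indicator {0..l} x *\<^sub>R (u x)\<^sup>2) \<partial>lborel)"
    unfolding L2_sqnorm_def by (intro nn_integral_cong) (simp add: indicator_def)
  also have "\<dots> = ennreal (LINT x:{0..l}|lborel. (u x)\<^sup>2)"
    using i unfolding set_lebesgue_integral_def set_integrable_def
    by (intro nn_integral_eq_integral) (auto simp: indicator_def)
  also have "(LINT x:{0..l}|lborel. (u x)\<^sup>2) = integral {0..l} (\<lambda>x. (u x)\<^sup>2)"
    using i by (rule set_borel_integral_eq_integral)
  finally show ?thesis .
qed

lemma weak_deriv_on_C1:
  assumes u: "\<And>x. x \<in> {0..l} \<Longrightarrow> (u has_real_derivative u' x) (at x within {0..l})"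
    and cu': "continuous_on {0..l} u'"
  shows "weak_deriv_on l u u'"
  unfolding weak_deriv_on_def
proof (intro conjI ballI)
  show "set_integrable lborel {0..l} u'" by (rule borel_integrable_atLeastAtMost'[OF cu'])
  fix x assume x: "x \<in> {0..l}"
  then have sub: "{0..x} \<subseteq> {0..l}" by auto
  have "(LINT y:{0..x}|lborel. u' y) = integral {0..x} u'"
    by (intro set_borel_integral_eq_integral borel_integrable_atLeastAtMost' continuous_on_subset[OF cu' sub])
  also have "\<dots> = u x - u 0"
  proof (intro integral_unique fundamental_theorem_of_calculus)
    fix y assume "y \<in> {0..x}"
    with sub have "y \<in> {0..l}" by blast
    from DERIV_subset[OF u[OF this] sub]
    show "(u has_vector_derivative u' y) (at y within {0..x})"
      unfolding has_real_derivative_iff_has_vector_derivative[symmetric] .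
  qed (use x in auto)
  finally show "u x = u 0 + (LINT y:{0..x}|lborel. u' y)" by simp
qed

lemma L2_sqnorm_finite:
  assumes g: "set_integrable lborel {0..l} g" and fin: "L2_sqnorm l g < \<infinity>"
  shows "set_integrable lborel {0..l} (\<lambda>x. (g x)\<^sup>2)"
    "L2_sqnorm l g = ennreal (LINT x:{0..l}|lborel. (g x)\<^sup>2)"
proof -
  have eq: "indicator {0..l} x *\<^sub>R (g x)\<^sup>2 = (indicator {0..l} x *\<^sub>R g x)\<^sup>2" for x
    by (simp add: indicator_def)
  have m: "(\<lambda>x. indicator {0..l} x *\<^sub>R (g x)\<^sup>2) \<in> borel_measurable lborel"
    unfolding eq using g unfolding set_integrable_def
    by (intro borel_measurable_power borel_measurable_integrable)
  have 1: "L2_sqnorm l g = (\<integral>\<^sup>+x. ennreal (indicator {0..l} x *\<^sub>R (g x)\<^sup>2) \<partial>lborel)"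
    unfolding L2_sqnorm_def by (intro nn_integral_cong) (simp add: indicator_def)
  show i: "set_integrable lborel {0..l} (\<lambda>x. (g x)\<^sup>2)"
    unfolding set_integrable_def
    by (rule integrableI_nonneg[OF m]) (use fin 1 in \<open>auto simp: indicator_def\<close>)
  show "L2_sqnorm l g = ennreal (LINT x:{0..l}|lborel. (g x)\<^sup>2)"
    unfolding 1 set_lebesgue_integral_def using i unfolding set_integrable_def
    by (intro nn_integral_eq_integral) (auto simp: indicator_def)
qed

text \<open>The transform inherits a weak derivative from u, and \<open>yosida_le_weak\<close>
  applies to it. The constant is chosen before s and \<mu>, which makes it usable as the bound of
  \<open>dirichlet_decay\<close>.\<close>

lemma yosida_volt_le_H1:
  assumes R: "R > 0"
  obtains C where "C \<ge> 1"
    "\<And>s u g \<mu> z zx. 0 < s \<Longrightarrow> s \<le> R \<Longrightarrow> continuous_on {0..s} u \<Longrightarrow> u 0 = 0 \<Longrightarrow> u s = 0 \<Longrightarrow>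
      weak_deriv_on s u g \<Longrightarrow> L2_sqnorm s g < \<infinity> \<Longrightarrow> 0 < \<mu> \<Longrightarrow> yosida_resolvent \<mu> s (volt c s u) z zx \<Longrightarrow>
      2 * yosida \<mu> s (volt c s u) z
        \<le> C * (integral {0..s} (\<lambda>x. (u x)\<^sup>2) + (LINT x:{0..s}|lborel. (g x)\<^sup>2))"
proof -
  obtain M where M: "M > 0"
    "\<And>x y. x \<in> {0..R} \<Longrightarrow> y \<in> {0..R} \<Longrightarrow> \<bar>kern c x y\<bar> \<le> M"
    "\<And>x y. x \<in> {0..R} \<Longrightarrow> y \<in> {0..R} \<Longrightarrow> \<bar>kern_x c x y\<bar> \<le> M"
    using kern_bounded by blast
  define N where "N = 4 * M\<^sup>2 * (1 + R\<^sup>2)"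
  have N: "N \<ge> 0" by (simp add: N_def)
  have "2 * yosida \<mu> s (volt c s u) z
        \<le> (2 + N) * (integral {0..s} (\<lambda>x. (u x)\<^sup>2) + (LINT x:{0..s}|lborel. (g x)\<^sup>2))"
    if s: "0 < s" "s \<le> R" and cu: "continuous_on {0..s} u" and u0: "u 0 = 0" "u s = 0"
      and wd: "weak_deriv_on s u g" and fin: "L2_sqnorm s g < \<infinity>"
      and mu: "0 < \<mu>" and res: "yosida_resolvent \<mu> s (volt c s u) z zx" for s u g \<mu> z zx
  proof -
    \<comment> \<open>The derivative of the integral part of the transform. It exists classically,
      because the kernel is smooth and u is continuous; only g is weak.\<close>
    define r where "r x = kern c x x * u x - integral {x..s} (\<lambda>y. kern_x c x y * u y)" for x
    have cr: "continuous_on {0..s} r"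
      unfolding r_def[abs_def] by (intro continuous_intros cu continuous_on_kern_integral)
    have cv: "continuous_on {0..s} (volt c s u)"
      unfolding volt_def[abs_def] by (intro continuous_intros cu continuous_on_kern_integral)
    have g: "set_integrable lborel {0..s} g"
      and gu: "\<And>x. x \<in> {0..s} \<Longrightarrow> u x = u 0 + (LINT y:{0..x}|lborel. g y)"
      using wd unfolding weak_deriv_on_def by blast+
    note g2 = L2_sqnorm_finite(1)[OF g fin]
    have r: "set_integrable lborel {0..s} r" "set_integrable lborel {0..s} (\<lambda>x. (r x)\<^sup>2)"
      by (intro borel_integrable_atLeastAtMost' continuous_intros cr)+
    have "weak_deriv_on s (\<lambda>x. - integral {x..s} (\<lambda>y. kern c x y * u y)) r"
    proof (rule weak_deriv_on_C1[OF _ cr])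
      fix x assume x: "x \<in> {0..s}"
      show "((\<lambda>x. - integral {x..s} (\<lambda>y. kern c x y * u y)) has_real_derivative r x) (at x within {0..s})"
        using DERIV_minus[OF DERIV_kern_integral(1)[OF cu x]] by (simp add: r_def)
    qed
    then have rk: "\<And>x. x \<in> {0..s} \<Longrightarrow> - integral {x..s} (\<lambda>y. kern c x y * u y)
        = - integral {0..s} (\<lambda>y. kern c 0 y * u y) + (LINT y:{0..x}|lborel. r y)"
      unfolding weak_deriv_on_def by blast
    have vw: "volt c s u x = volt c s u 0 + (LINT y:{0..x}|lborel. g y + r y)" if x: "x \<in> {0..s}" for x
    proof -
      have sub: "{0..x} \<subseteq> {0..s}" "{0..x} \<in> sets lborel" using x by auto
      have "(LINT y:{0..x}|lborel. g y + r y) = (LINT y:{0..x}|lborel. g y) + (LINT y:{0..x}|lborel. r y)"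
        by (intro set_integral_add set_integrable_subset[OF g] set_integrable_subset[OF r(1)] sub)
      then show ?thesis using gu[OF x] rk[OF x] by (simp add: volt_def)
    qed
    have bnd: "set_integrable lborel {0..s} (\<lambda>x. 2 * (g x)\<^sup>2 + 2 * (r x)\<^sup>2)"
      using g2 r(2) by auto
    have sum_int: "set_integrable lborel {0..s} (\<lambda>x. g x + r x)" using g r(1) by auto
    have eq: "indicator {0..s} x *\<^sub>R (g x + r x)\<^sup>2 = (indicator {0..s} x *\<^sub>R (g x + r x))\<^sup>2" for x
      by (simp add: indicator_def)
    have sq_int: "set_integrable lborel {0..s} (\<lambda>x. (g x + r x)\<^sup>2)"
      unfolding set_integrable_def
    proof (rule Bochner_Integration.integrable_bound)
      show "integrable lborel (\<lambda>x. indicat_real {0..s} x *\<^sub>R (2 * (g x)\<^sup>2 + 2 * (r x)\<^sup>2))"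
        using bnd by (simp add: set_integrable_def)
      show "(\<lambda>x. indicat_real {0..s} x *\<^sub>R (g x + r x)\<^sup>2) \<in> borel_measurable lborel"
        unfolding eq using sum_int unfolding set_integrable_def
        by (intro borel_measurable_power borel_measurable_integrable)
      show "AE x in lborel. norm (indicat_real {0..s} x *\<^sub>R (g x + r x)\<^sup>2)
          \<le> norm (indicat_real {0..s} x *\<^sub>R (2 * (g x)\<^sup>2 + 2 * (r x)\<^sup>2))"
        using square_sum_le by (auto simp: indicator_def)
    qed
    have "volt c s u 0 = 0" "volt c s u s = 0" using u0 by (simp_all add: volt_def)
    then have "2 * yosida \<mu> s (volt c s u) z \<le> (LINT x:{0..s}|lborel. (g x + r x)\<^sup>2)"
      by (intro yosida_le_weak[OF mu less_imp_le[OF s(1)] res cv sum_int sq_int vw])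
    also have "\<dots> \<le> (LINT x:{0..s}|lborel. 2 * (g x)\<^sup>2 + 2 * (r x)\<^sup>2)"
      by (intro set_integral_mono sq_int bnd square_sum_le)
    also have "\<dots> = 2 * (LINT x:{0..s}|lborel. (g x)\<^sup>2) + 2 * (LINT x:{0..s}|lborel. (r x)\<^sup>2)"
      using g2 r(2) by (subst set_integral_add) auto
    also have "(LINT x:{0..s}|lborel. (r x)\<^sup>2) = integral {0..s} (\<lambda>x. (r x)\<^sup>2)"
      using r(2) by (rule set_borel_integral_eq_integral)
    also have "\<dots> \<le> integral {0..s} (\<lambda>x. 2 * M\<^sup>2 * (u x)\<^sup>2 + 2 * M\<^sup>2 * (R * integral {0..s} (\<lambda>x. (u x)\<^sup>2)))"
    proof (intro integral_le integrable_continuous_interval continuous_intros cr cu)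
      fix x assume x: "x \<in> {0..s}"
      have sub: "{x..s} \<subseteq> {0..s}" using x by auto
      note cu' = continuous_on_subset[OF cu sub]
      define a where "a = kern c x x * u x"
      define b where "b = - integral {x..s} (\<lambda>y. kern_x c x y * u y)"
      have "\<bar>a\<bar> \<le> M * \<bar>u x\<bar>" unfolding a_def abs_mult
        using M(2) x s by (intro mult_right_mono) auto
      then have a2: "a\<^sup>2 \<le> (M * \<bar>u x\<bar>)\<^sup>2" using M by (simp add: abs_le_square_iff[symmetric])
      have "\<bar>b\<bar> \<le> M * integral {x..s} (\<lambda>y. \<bar>u y\<bar>)"
        unfolding b_def abs_minus_cancel by (intro abs_integral_mult_le continuous_intros cu' M(3)) (use x s in auto)
      also have "integral {x..s} (\<lambda>y. \<bar>u y\<bar>) \<le> integral {0..s} (\<lambda>y. \<bar>u y\<bar>)"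
        using sub by (intro integral_subset_le integrable_continuous_interval continuous_intros cu cu') auto
      finally have "\<bar>b\<bar> \<le> M * integral {0..s} (\<lambda>y. \<bar>u y\<bar>)" using M by simp
      then have "\<bar>b\<bar>\<^sup>2 \<le> (M * integral {0..s} (\<lambda>y. \<bar>u y\<bar>))\<^sup>2" by (rule power_mono) simp
      also have "\<dots> = M\<^sup>2 * (integral {0..s} (\<lambda>y. \<bar>u y\<bar>))\<^sup>2" by (rule power_mult_distrib)
      also have "(integral {0..s} (\<lambda>y. \<bar>u y\<bar>))\<^sup>2 \<le> (s - 0) * integral {0..s} (\<lambda>x. \<bar>u x\<bar>\<^sup>2)"
        using s by (intro integral_square_le continuous_intros cu) auto
      also have "\<dots> \<le> R * integral {0..s} (\<lambda>x. (u x)\<^sup>2)"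
        using s by (auto intro!: mult_right_mono Henstock_Kurzweil_Integration.integral_nonneg
            integrable_continuous_interval continuous_intros cu)
      finally have b2: "b\<^sup>2 \<le> M\<^sup>2 * (R * integral {0..s} (\<lambda>x. (u x)\<^sup>2))" using M by simp
      have "(r x)\<^sup>2 = (a + b)\<^sup>2" by (simp add: r_def a_def b_def)
      also have "\<dots> \<le> 2 * a\<^sup>2 + 2 * b\<^sup>2" by (rule square_sum_le)
      finally show "(r x)\<^sup>2 \<le> 2 * M\<^sup>2 * (u x)\<^sup>2 + 2 * M\<^sup>2 * (R * integral {0..s} (\<lambda>x. (u x)\<^sup>2))"
        using a2 b2 by (simp add: power_mult_distrib)
    qed
    also have "\<dots> = 2 * M\<^sup>2 * integral {0..s} (\<lambda>x. (u x)\<^sup>2) + s * (2 * M\<^sup>2 * (R * integral {0..s} (\<lambda>x. (u x)\<^sup>2)))"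
      using s by (subst Henstock_Kurzweil_Integration.integral_add)
        (auto intro!: integrable_continuous_interval continuous_intros cu)
    also have "\<dots> \<le> 2 * M\<^sup>2 * integral {0..s} (\<lambda>x. (u x)\<^sup>2) + R * (2 * M\<^sup>2 * (R * integral {0..s} (\<lambda>x. (u x)\<^sup>2)))"
      using s R by (intro add_left_mono mult_right_mono mult_nonneg_nonneg
          Henstock_Kurzweil_Integration.integral_nonneg integrable_continuous_interval continuous_intros cu) auto
    finally have "2 * yosida \<mu> s (volt c s u) z
       \<le> 2 * (LINT x:{0..s}|lborel. (g x)\<^sup>2) + N * integral {0..s} (\<lambda>x. (u x)\<^sup>2)"
      by (simp add: N_def power2_eq_square algebra_simps)
    also have "\<dots> \<le> (2 + N) * (LINT x:{0..s}|lborel. (g x)\<^sup>2) + (2 + N) * integral {0..s} (\<lambda>x. (u x)\<^sup>2)"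
    proof (intro add_mono mult_right_mono)
      show "0 \<le> (LINT x:{0..s}|lborel. (g x)\<^sup>2)"
        unfolding set_lebesgue_integral_def by (rule Bochner_Integration.integral_nonneg) simp
      show "0 \<le> integral {0..s} (\<lambda>x. (u x)\<^sup>2)"
        by (intro Henstock_Kurzweil_Integration.integral_nonneg integrable_continuous_interval continuous_intros cu) simp
    qed (use N in auto)
    finally show ?thesis by (simp add: distrib_left)
  qed
  then show ?thesis using that[of "2 + N"] N by auto
qed

subsection \<open>Maximum principle\<close>

text \<open>Rescaling x by s t presents the region as a continuous image of a rectangle.\<close>

lemma compact_under_graph:
  fixes s :: "real \<Rightarrow> real"
  assumes "continuous_on {a..b} s" and pos: "\<And>t. t \<in> {a..b} \<Longrightarrow> 0 < s t"
  shows "compact {(x, t). a \<le> t \<and> t \<le> b \<and> 0 \<le> x \<and> x \<le> s t}"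
proof -
  have "compact ((\<lambda>z. (fst z * s (snd z), snd z)) ` ({0..1} \<times> {a..b}))"
    by (intro compact_continuous_image continuous_intros compact_Times compact_Icc
        continuous_on_compose2[OF assms(1)]) auto
  also have "(\<lambda>z. (fst z * s (snd z), snd z)) ` ({0..1} \<times> {a..b}) = {(x, t). a \<le> t \<and> t \<le> b \<and> 0 \<le> x \<and> x \<le> s t}"
  proof (intro equalityI subsetI)
    fix p assume "p \<in> {(x, t). a \<le> t \<and> t \<le> b \<and> 0 \<le> x \<and> x \<le> s t}"
    then obtain x t where p: "p = (x, t)" "t \<in> {a..b}" "0 \<le> x" "x \<le> s t" by auto
    then have "(x / s t, t) \<in> {0..1} \<times> {a..b}" "x / s t * s t = x" using pos[OF p(2)] by auto
    then show "p \<in> (\<lambda>z. (fst z * s (snd z), snd z)) ` ({0..1} \<times> {a..b})"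
      using p(1) by (intro image_eqI[of _ _ "(x / s t, t)"]) auto
  next
    fix p assume "p \<in> (\<lambda>z. (fst z * s (snd z), snd z)) ` ({0..1} \<times> {a..b})"
    then obtain z where z: "z \<in> {0..1} \<times> {a..b}" "p = (fst z * s (snd z), snd z)" by blast
    define q t where "q = fst z" and "t = snd z"
    have p: "p = (q * s t, t)" "t \<in> {a..b}" "0 \<le> q" "q \<le> 1"
      using z by (auto simp: q_def t_def)
    have "q * s t \<le> 1 * s t" using p pos[OF p(2)] by (intro mult_right_mono) auto
    then show "p \<in> {(x, t). a \<le> t \<and> t \<le> b \<and> 0 \<le> x \<and> x \<le> s t}" using p pos[OF p(2)] by auto
  qed
  finally show ?thesis .
qed

text \<open>f' vanishes at x. If f'' were negative, f' would be negative just to the right of x, and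
  the mean value theorem would give smaller values of f there. Differentiability of f' at x alone
  suffices.\<close>

lemma second_derivative_at_minimum:
  fixes f f' :: "real \<Rightarrow> real"
  assumes x: "a < x" "x < b"
    and f: "\<And>y. y \<in> {a..b} \<Longrightarrow> (f has_real_derivative f' y) (at y within {a..b})"
    and f': "(f' has_real_derivative f'') (at x within {a..b})"
    and min: "\<And>y. y \<in> {a..b} \<Longrightarrow> f x \<le> f y"
  shows "0 \<le> f''"
proof (rule ccontr)
  assume "\<not> 0 \<le> f''"
  have fat: "(f has_real_derivative f' y) (at y)" if "a < y" "y < b" for y
    using f[of y] that by (simp add: at_within_Icc_at)
  have f'at: "(f' has_real_derivative f'') (at x)" using f' x by (simp add: at_within_Icc_at)
  have f'x: "f' x = 0"
  proof (rule DERIV_local_min[OF fat[OF x]])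
    show "0 < min (x - a) (b - x)" using x by simp
    show "\<forall>y. \<bar>x - y\<bar> < min (x - a) (b - x) \<longrightarrow> f x \<le> f y"
      by (intro allI impI min) (simp add: abs_less_iff)
  qed
  obtain d where d: "d > 0" "\<And>h. 0 < h \<Longrightarrow> h < d \<Longrightarrow> f' (x + h) < f' x"
    using DERIV_neg_dec_right[OF f'at] \<open>\<not> 0 \<le> f''\<close> by auto
  define h where "h = min d (b - x) / 2"
  have h: "0 < h" "h < d" "x + h < b" using d(1) x by (auto simp: h_def min_def field_simps)
  obtain z where z: "x < z" "z < x + h" "f (x + h) - f x = (x + h - x) * f' z"
    using MVT2[of x "x + h" f f'] fat h x by auto
  have "f' z < 0" using d(2)[of "z - x"] z h f'x by auto
  then have "h * f' z < 0" using h by (intro mult_pos_neg)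
  then have "f (x + h) < f x" using z(3) by simp
  moreover have "f x \<le> f (x + h)" using min x h by simp
  ultimately show False by simp
qed

text \<open>Weak maximum principle; the added term \<open>\<epsilon> t\<close> turns the minimum into a strict one.\<close>

lemma heat_min_principle:
  assumes \<alpha>: "\<alpha> > 0" and s: "continuous_on {0..} s" and s_pos: "\<And>t. 0 \<le> t \<Longrightarrow> 0 < s t"
    and cl: "classical_on s T Tx Txx Tt"
    and pde: "\<And>t x. 0 < t \<Longrightarrow> x \<in> {0..s t} \<Longrightarrow> Tt x t = \<alpha> * Txx x t"
    and left: "\<And>t. 0 < t \<Longrightarrow> m \<le> T 0 t" and right: "\<And>t. 0 < t \<Longrightarrow> m \<le> T (s t) t"
    and init: "\<And>x. x \<in> {0..s 0} \<Longrightarrow> m \<le> T x 0"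
    and t0: "0 \<le> t0" and x0: "x0 \<in> {0..s t0}"
  shows "m \<le> T x0 t0"
proof (rule ccontr)
  assume less: "\<not> m \<le> T x0 t0"
  have contT: "continuous_on {(x, t). 0 \<le> t \<and> 0 \<le> x \<and> x \<le> s t} (\<lambda>(x, t). T x t)"
    and dx: "\<And>t x. 0 < t \<Longrightarrow> x \<in> {0..s t} \<Longrightarrow> ((\<lambda>y. T y t) has_real_derivative Tx x t) (at x within {0..s t})"
    and dxx: "\<And>t x. 0 < t \<Longrightarrow> x \<in> {0..s t} \<Longrightarrow> ((\<lambda>y. Tx y t) has_real_derivative Txx x t) (at x within {0..s t})"
    and dt: "\<And>t x. 0 < t \<Longrightarrow> x \<in> {0<..<s t} \<Longrightarrow> ((\<lambda>r. T x r) has_real_derivative Tt x t) (at t)"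
    using cl unfolding classical_on_def by blast+
  \<comment> \<open>The perturbation at t0 costs at most half of the violation; t0 + 1 keeps the
    denominator positive when t0 = 0.\<close>
  define \<epsilon> where "\<epsilon> = (m - T x0 t0) / 2 / (t0 + 1)"
  have \<epsilon>: "\<epsilon> > 0" using less t0 by (simp add: \<epsilon>_def)
  have "\<epsilon> * t0 \<le> \<epsilon> * (t0 + 1)" using \<epsilon> by simp
  also have "\<dots> = (m - T x0 t0) / 2"
    using nonzero_eq_divide_eq[of "t0 + 1" \<epsilon> "(m - T x0 t0) / 2"] \<epsilon>_def t0 by simp
  finally have below: "T x0 t0 + \<epsilon> * t0 < m" using less by (simp add: field_simps)
  define \<Omega> where "\<Omega> = {(x, t). 0 \<le> t \<and> t \<le> t0 \<and> 0 \<le> x \<and> x \<le> s t}"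
  define v where "v = (\<lambda>p. T (fst p) (snd p) + \<epsilon> * snd p)"
  have "compact \<Omega>"
    unfolding \<Omega>_def by (rule compact_under_graph) (auto intro: continuous_on_subset[OF s] s_pos)
  moreover have "continuous_on \<Omega> v"
    unfolding v_def using continuous_on_subset[OF contT, of \<Omega>]
    by (intro continuous_intros) (auto simp: \<Omega>_def case_prod_unfold)
  moreover have in0: "(x0, t0) \<in> \<Omega>" using x0 t0 by (auto simp: \<Omega>_def)
  ultimately obtain p where p: "p \<in> \<Omega>" "\<And>q. q \<in> \<Omega> \<Longrightarrow> v p \<le> v q"
    using continuous_attains_inf[of \<Omega> v] by blast
  obtain x1 t1 where p_eq: "p = (x1, t1)" by (cases p)
  have r1: "0 \<le> t1" "t1 \<le> t0" "0 \<le> x1" "x1 \<le> s t1" using p(1) by (auto simp: \<Omega>_def p_eq)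
  have min1: "T x1 t1 + \<epsilon> * t1 \<le> T x t + \<epsilon> * t" if "0 \<le> t" "t \<le> t0" "0 \<le> x" "x \<le> s t" for x t
    using p(2)[of "(x, t)"] that by (simp add: v_def p_eq \<Omega>_def)
  have "T x1 t1 + \<epsilon> * t1 < m" using min1[of t0 x0] x0 t0 below by simp
  moreover have "0 \<le> \<epsilon> * t1" using \<epsilon> r1 by simp
  ultimately have T1: "T x1 t1 < m" by linarith
  have t1: "0 < t1" using T1 init[of x1] r1 by (cases "t1 = 0") auto
  have x1: "0 < x1" "x1 < s t1" using T1 left[OF t1] right[OF t1] r1 by (auto simp: less_le)
  have "0 \<le> Txx x1 t1"
  proof (rule second_derivative_at_minimum[OF x1 dx[OF t1] dxx[OF t1]])
    show "T x1 t1 \<le> T y t1" if "y \<in> {0..s t1}" for y using min1[of t1 y] r1 that by simp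
  qed (use x1 in auto)
  then have Tt: "0 \<le> Tt x1 t1" using pde[OF t1, of x1] x1 \<alpha> by simp
  have "((\<lambda>r. T x1 r + \<epsilon> * r) has_real_derivative Tt x1 t1 + \<epsilon>) (at t1)"
    using x1 by (auto intro!: derivative_eq_intros dt t1)
  from DERIV_pos_inc_left[OF this] Tt \<epsilon> obtain d where d: "d > 0"
    "\<And>h. 0 < h \<Longrightarrow> h < d \<Longrightarrow> T x1 (t1 - h) + \<epsilon> * (t1 - h) < T x1 t1 + \<epsilon> * t1"
    by auto
  \<comment> \<open>The comparison at an earlier time needs x1 to lie inside the domain then; x1 < s
    t1 and continuity of s provide this.\<close>
  have "isCont s t1" using continuous_on_interior[OF s, of t1] t1 by simp
  then obtain d' where d': "d' > 0" "\<And>r. \<bar>r - t1\<bar> < d' \<Longrightarrow> \<bar>s r - s t1\<bar> < s t1 - x1"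
    unfolding continuous_at_eps_delta dist_real_def using x1 by (meson diff_gt_0_iff_gt)
  define h where "h = min (min d d') t1 / 2"
  have h: "0 < h" "h < d" "h < d'" "h < t1" using d(1) d'(1) t1 by (auto simp: h_def min_def)
  have "\<bar>s (t1 - h) - s t1\<bar> < s t1 - x1" using d'(2)[of "t1 - h"] h by simp
  then have "T x1 t1 + \<epsilon> * t1 \<le> T x1 (t1 - h) + \<epsilon> * (t1 - h)"
    using r1 h by (intro min1) auto
  with d(2)[OF h(1,2)] show False by simp
qed

text \<open>By the minimum principle T stays above Tm, which it attains at the interface; hence its
  one-sided slope there is at most 0, and the Stefan condition makes the interface speed
  nonnegative.\<close>

lemma stefan_interface_mono:
  assumes \<alpha>: "\<alpha> > 0" and \<beta>: "\<beta> > 0" and sol: "stefan_solution \<alpha> \<beta> Tm Tc s0 T0 s T"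
    and init: "\<And>x. x \<in> {0..s0} \<Longrightarrow> Tm \<le> T0 x" and Tc: "\<And>t. 0 < t \<Longrightarrow> 0 \<le> Tc t"
    and rt: "0 \<le> r" "r \<le> t"
  shows "s r \<le> s t"
proof -
  obtain Tx Txx Tt where cs: "continuous_on {0..} s" and s_pos: "\<And>t. 0 \<le> t \<Longrightarrow> 0 < s t"
    and s0: "s 0 = s0" "\<And>x. x \<in> {0..s0} \<Longrightarrow> T x 0 = T0 x"
    and cl: "classical_on s T Tx Txx Tt"
    and pde: "\<And>t x. 0 < t \<Longrightarrow> x \<in> {0..s t} \<Longrightarrow> Tt x t = \<alpha> * Txx x t"
    and bc: "\<And>t. 0 < t \<Longrightarrow> T 0 t = Tm + Tc t" "\<And>t. 0 < t \<Longrightarrow> T (s t) t = Tm"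
    and ds: "\<And>t. 0 < t \<Longrightarrow> (s has_real_derivative - \<beta> * Tx (s t) t) (at t)"
    using sol unfolding stefan_solution_def by blast
  have nonneg: "Tm \<le> T x t" if "0 \<le> t" "x \<in> {0..s t}" for x t
    by (rule heat_min_principle[OF \<alpha> cs s_pos cl pde _ _ _ that]) (use bc Tc init s0 in auto)
  have slope: "Tx (s t) t \<le> 0" if t: "0 < t" for t
  proof (rule ccontr)
    assume "\<not> Tx (s t) t \<le> 0"
    have st: "s t > 0" using s_pos t by simp
    have "((\<lambda>y. T y t) has_real_derivative Tx (s t) t) (at (s t) within {0..s t})"
      using cl t st unfolding classical_on_def by simp
    from has_real_derivative_pos_inc_left[OF this] \<open>\<not> Tx (s t) t \<le> 0\<close>
    obtain d where d: "d > 0" "\<And>h. 0 < h \<Longrightarrow> s t - h \<in> {0..s t} \<Longrightarrow> h < d \<Longrightarrow> T (s t - h) t < T (s t) t"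
      by auto
    define h where "h = min d (s t) / 2"
    have h: "0 < h" "h < d" "h < s t" using d(1) st by (auto simp: h_def min_def)
    then have "T (s t - h) t < Tm" using d(2)[of h] bc(2)[OF t] by simp
    moreover have "Tm \<le> T (s t - h) t" using nonneg[of t "s t - h"] t h by simp
    ultimately show False by simp
  qed
  \<comment> \<open>s is differentiable at positive times only; continuity at the ends of the
    interval covers r = 0.\<close>
  show ?thesis
  proof (rule DERIV_nonneg_imp_increasing_open[OF rt(2)])
    show "\<exists>y. (s has_real_derivative y) (at x) \<and> 0 \<le> y" if "r < x" "x < t" for x
      using ds[of x] slope[of x] \<beta> rt that by (intro exI[of _ "- \<beta> * Tx (s x) x"]) (auto simp: mult_nonneg_nonpos)
    show "continuous_on {r..t} s" using cs rt by (auto elim!: continuous_on_subset)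
  qed
qed

subsection \<open>The observer error\<close>

lemma volt_diff:
  assumes "continuous_on {x..s} a" "continuous_on {x..s} b"
  shows "volt c s (\<lambda>y. a y - b y) x = volt c s a x - volt c s b x"
proof -
  have "integral {x..s} (\<lambda>y. kern c x y * (a y - b y)) = integral {x..s} (\<lambda>y. kern c x y * a y - kern c x y * b y)"
    by (simp add: right_diff_distrib)
  also have "\<dots> = integral {x..s} (\<lambda>y. kern c x y * a y) - integral {x..s} (\<lambda>y. kern c x y * b y)"
    by (intro Henstock_Kurzweil_Integration.integral_diff integrable_continuous_interval continuous_intros assms)
  finally show ?thesis by (simp add: volt_def)
qed

lemma volt_cmult: "volt c s (\<lambda>y. k * a y) x = k * volt c s a x"
proof -
  have "(\<lambda>y. kern c x y * (k * a y)) = (\<lambda>y. k * (kern c x y * a y))" by (simp add: mult_ac)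
  then show ?thesis by (simp add: volt_def right_diff_distrib)
qed

lemma volt_bound:
  assumes M: "M > 0" "\<And>x y. x \<in> {0..R} \<Longrightarrow> y \<in> {0..R} \<Longrightarrow> \<bar>kern c x y\<bar> \<le> M"
    and s: "s \<le> R" "x \<in> {0..s}" and a: "continuous_on {x..s} a"
    and e: "\<And>y. y \<in> {x..s} \<Longrightarrow> \<bar>a y\<bar> \<le> e"
  shows "\<bar>volt c s a x\<bar> \<le> (1 + M * R) * e"
proof -
  have e0: "0 \<le> e" using e[of x] s by auto
  have "\<bar>integral {x..s} (\<lambda>y. kern c x y * a y)\<bar> \<le> M * integral {x..s} (\<lambda>y. \<bar>a y\<bar>)"
    by (intro abs_integral_mult_le continuous_intros a M) (use s in auto)
  also have "integral {x..s} (\<lambda>y. \<bar>a y\<bar>) \<le> integral {x..s} (\<lambda>y. e)"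
    by (intro integral_le integrable_continuous_interval continuous_intros a e)
  also have "\<dots> \<le> R * e" using s e0 by (simp add: mult_right_mono)
  finally have "\<bar>integral {x..s} (\<lambda>y. kern c x y * a y)\<bar> \<le> M * (R * e)" using M by simp
  moreover have "\<bar>a x\<bar> \<le> e" using e s by auto
  ultimately show ?thesis unfolding volt_def by (simp add: distrib_right mult.assoc)
qed

text \<open>The linear error equation detached from the Stefan problem: the interface is a given
  nondecreasing function, bounded by R and differentiable at positive times, and the gain appears as
  the kernel P.\<close>

locale error_system =
  fixes s s' :: "real \<Rightarrow> real" and u ux uxx ut :: "real \<Rightarrow> real \<Rightarrow> real" and \<alpha> c R :: real
  assumes \<alpha>: "\<alpha> > 0" and c: "c > 0"
    and s_cont: "continuous_on {0..} s"
    and s_pos: "\<And>t. 0 \<le> t \<Longrightarrow> 0 < s t"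
    and s_mono: "\<And>r t. 0 \<le> r \<Longrightarrow> r \<le> t \<Longrightarrow> s r \<le> s t"
    and s_le: "\<And>t. 0 \<le> t \<Longrightarrow> s t \<le> R"
    and s_deriv: "\<And>t. 0 < t \<Longrightarrow> (s has_real_derivative s' t) (at t)"
    and u_cl: "classical_on s u ux uxx ut"
    and u_left: "\<And>t. 0 \<le> t \<Longrightarrow> u 0 t = 0" and u_right: "\<And>t. 0 \<le> t \<Longrightarrow> u (s t) t = 0"
    and u_pde: "\<And>t x. 0 < t \<Longrightarrow> x \<in> {0..s t} \<Longrightarrow> ut x t = \<alpha> * (uxx x t + kern_inv c x (s t) * ux (s t) t)"
begin

lemma u_cont: "continuous_on {(x, t). 0 \<le> t \<and> 0 \<le> x \<and> x \<le> s t} (\<lambda>(x, t). u x t)"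
  and ux_cont: "continuous_on {(x, t). 0 < t \<and> 0 \<le> x \<and> x \<le> s t} (\<lambda>(x, t). ux x t)"
  and uxx_cont: "continuous_on {(x, t). 0 < t \<and> 0 \<le> x \<and> x \<le> s t} (\<lambda>(x, t). uxx x t)"
  and ut_cont: "continuous_on {(x, t). 0 < t \<and> 0 \<le> x \<and> x \<le> s t} (\<lambda>(x, t). ut x t)"
  and u_DERIV: "\<And>t x. 0 < t \<Longrightarrow> x \<in> {0..s t} \<Longrightarrow> ((\<lambda>y. u y t) has_real_derivative ux x t) (at x within {0..s t})"
  and ux_DERIV: "\<And>t x. 0 < t \<Longrightarrow> x \<in> {0..s t} \<Longrightarrow> ((\<lambda>y. ux y t) has_real_derivative uxx x t) (at x within {0..s t})"
  and u_time: "\<And>t x. 0 < t \<Longrightarrow> x \<in> {0<..<s t} \<Longrightarrow> ((\<lambda>r. u x r) has_real_derivative ut x t) (at t)"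
  using u_cl unfolding classical_on_def by blast+

lemma slice_cont:
  assumes "continuous_on A (\<lambda>(x, t). f x t)" "S \<times> {t} \<subseteq> A"
  shows "continuous_on S (\<lambda>x. f x t)"
proof -
  have "continuous_on S (\<lambda>x. case (x, t) of (x, t) \<Rightarrow> f x t)"
    by (rule continuous_on_compose2[OF assms(1)]) (use assms(2) in \<open>auto intro!: continuous_intros\<close>)
  then show ?thesis by simp
qed

lemma slices:
  shows u_slice: "\<And>t. 0 \<le> t \<Longrightarrow> continuous_on {0..s t} (\<lambda>x. u x t)"
    and ux_slice: "\<And>t. 0 < t \<Longrightarrow> continuous_on {0..s t} (\<lambda>x. ux x t)"
    and uxx_slice: "\<And>t. 0 < t \<Longrightarrow> continuous_on {0..s t} (\<lambda>x. uxx x t)"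
    and ut_slice: "\<And>t. 0 < t \<Longrightarrow> continuous_on {0..s t} (\<lambda>x. ut x t)"
  by (rule slice_cont[OF u_cont] slice_cont[OF ux_cont] slice_cont[OF uxx_cont] slice_cont[OF ut_cont]; auto)+

definition U :: "real \<Rightarrow> real \<Rightarrow> real" where "U t x = (if x \<le> s t then u x t else 0)"

lemma U_cont: "continuous_on ({0..R} \<times> {0..}) (\<lambda>z. U (snd z) (fst z))"
proof -
  \<comment> \<open>Cutting time off at 0 makes s continuous on the whole plane, so the two pieces
    on which U is glued are closed.\<close>
  have sm: "continuous_on UNIV (\<lambda>z::real \<times> real. s (max 0 (snd z)))"
    by (rule continuous_on_compose2[OF s_cont]) (auto intro!: continuous_intros)
  define A where "A = {z::real \<times> real. fst z \<in> {0..R} \<and> 0 \<le> snd z \<and> fst z \<le> s (max 0 (snd z))}"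
  define B where "B = {z::real \<times> real. fst z \<in> {0..R} \<and> 0 \<le> snd z \<and> s (max 0 (snd z)) \<le> fst z}"
  have "continuous_on (A \<union> B) (\<lambda>z. if fst z \<le> s (snd z) then u (fst z) (snd z) else 0)"
  proof (rule continuous_on_cases)
    show "closed A" "closed B"
      unfolding A_def B_def atLeastAtMost_iff
      by (intro closed_Collect_conj closed_Collect_le continuous_intros sm)+
    have "continuous_on A (\<lambda>(x, t). u x t)"
      by (rule continuous_on_subset[OF u_cont]) (auto simp: A_def)
    then show "continuous_on A (\<lambda>z. u (fst z) (snd z))" by (simp add: case_prod_unfold)
    show "\<forall>z. z \<in> A \<and> \<not> fst z \<le> s (snd z) \<or> z \<in> B \<and> fst z \<le> s (snd z) \<longrightarrow> u (fst z) (snd z) = 0"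
    proof (intro allI impI)
      fix z assume "z \<in> A \<and> \<not> fst z \<le> s (snd z) \<or> z \<in> B \<and> fst z \<le> s (snd z)"
      then have "0 \<le> snd z" "fst z = s (snd z)" by (auto simp: A_def B_def)
      then show "u (fst z) (snd z) = 0" using u_right by simp
    qed
  qed simp
  moreover have "A \<union> B = {0..R} \<times> {0..}" by (auto simp: A_def B_def)
  ultimately show ?thesis by (simp add: U_def)
qed

lemma U_slice: "0 \<le> t \<Longrightarrow> continuous_on {0..R} (U t)"
proof -
  assume "0 \<le> t"
  then have "continuous_on {0..R} (\<lambda>x. U (snd (x, t)) (fst (x, t)))"
    by (intro continuous_on_compose2[OF U_cont] continuous_intros) auto
  then show ?thesis by simp
qed

lemma U_time_cont:
  assumes t: "0 \<le> t" and e: "0 < e"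
  obtains \<delta> where "\<delta> > 0" "\<And>r x. 0 \<le> r \<Longrightarrow> \<bar>r - t\<bar> < \<delta> \<Longrightarrow> x \<in> {0..R} \<Longrightarrow> \<bar>U r x - U t x\<bar> \<le> e"
proof -
  have "uniformly_continuous_on ({0..R} \<times> {0..t + 1}) (\<lambda>z. U (snd z) (fst z))"
    by (intro compact_uniformly_continuous continuous_on_subset[OF U_cont] compact_Times compact_Icc) auto
  then obtain \<delta> where \<delta>: "\<delta> > 0" "\<And>z w. z \<in> {0..R} \<times> {0..t + 1} \<Longrightarrow> w \<in> {0..R} \<times> {0..t + 1} \<Longrightarrow>
      dist w z < \<delta> \<Longrightarrow> dist (U (snd w) (fst w)) (U (snd z) (fst z)) < e"
    using e unfolding uniformly_continuous_on_def by meson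
  have "\<bar>U r x - U t x\<bar> \<le> e" if "0 \<le> r" "\<bar>r - t\<bar> < min 1 \<delta>" "x \<in> {0..R}" for r x
  proof -
    have "r \<le> t + 1" using that by linarith
    then show ?thesis
      using \<delta>(2)[of "(x, t)" "(x, r)"] that t by (simp add: dist_Pair_Pair dist_real_def)
  qed
  then show ?thesis using that[of "min 1 \<delta>"] \<delta>(1) by simp
qed

text \<open>The upper limit is R rather than s t: U vanishes beyond the interface, so the values
  agree on \<open>{0..s t}\<close> (\<open>W_eq\<close>), while one and the same bounded linear
  operator acts at all times.\<close>

definition W :: "real \<Rightarrow> real \<Rightarrow> real" where "W t = volt c R (U t)"

lemma W_eq:
  assumes t: "0 \<le> t" and x: "x \<in> {0..s t}"
  shows "W t x = volt c (s t) (\<lambda>x. u x t) x"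
proof -
  have sR: "s t \<le> R" by (rule s_le[OF t])
  have i: "(\<lambda>y. kern c x y * U t y) integrable_on {x..R}"
    using x by (intro integrable_continuous_interval continuous_intros continuous_on_subset[OF U_slice[OF t]]) auto
  have "integral {x..R} (\<lambda>y. kern c x y * U t y)
     = integral {x..s t} (\<lambda>y. kern c x y * U t y) + integral {s t..R} (\<lambda>y. kern c x y * U t y)"
    using x sR i by (intro Henstock_Kurzweil_Integration.integral_combine[symmetric]) auto
  also have "integral {s t..R} (\<lambda>y. kern c x y * U t y) = integral {s t..R} (\<lambda>y. 0)"
    using u_right[OF t] by (intro Henstock_Kurzweil_Integration.integral_cong) (auto simp: U_def)
  also have "integral {x..s t} (\<lambda>y. kern c x y * U t y) = integral {x..s t} (\<lambda>y. kern c x y * u y t)"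
    by (intro Henstock_Kurzweil_Integration.integral_cong) (auto simp: U_def)
  finally show ?thesis using x by (simp add: W_def volt_def U_def)
qed

lemma W_outside:
  assumes t: "0 \<le> t" and x: "s t \<le> x" "x \<le> R"
  shows "W t x = 0"
proof -
  have "integral {x..R} (\<lambda>y. kern c x y * U t y) = integral {x..R} (\<lambda>y. 0)"
  proof (rule Henstock_Kurzweil_Integration.integral_cong)
    fix y assume y: "y \<in> {x..R}"
    have "U t y = 0" using y x u_right[OF t] by (cases "y = s t") (auto simp: U_def)
    then show "kern c x y * U t y = 0" by simp
  qed
  then show ?thesis using u_right[OF t] x by (auto simp: W_def volt_def U_def)
qed

lemma W_cont: "0 \<le> t \<Longrightarrow> continuous_on {0..R} (W t)"
  unfolding W_def volt_def[abs_def] by (intro continuous_intros U_slice continuous_on_kern_integral)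

lemma R_pos: "R > 0"
  using s_pos[of 0] s_le[of 0] by simp

lemma W_time_cont:
  assumes t: "0 \<le> t" and e: "0 < e"
  shows "\<exists>\<delta>>0. \<forall>r. 0 \<le> r \<and> \<bar>r - t\<bar> < \<delta> \<longrightarrow> (\<forall>x\<in>{0..R}. \<bar>W r x - W t x\<bar> \<le> e)"
proof -
  obtain M where M: "M > 0" "\<And>x y. x \<in> {0..R} \<Longrightarrow> y \<in> {0..R} \<Longrightarrow> \<bar>kern c x y\<bar> \<le> M"
    and "\<And>x y. x \<in> {0..R} \<Longrightarrow> y \<in> {0..R} \<Longrightarrow> \<bar>kern_x c x y\<bar> \<le> M"
    using kern_bounded[where R = R and c = c] by blast
  have MR: "1 + M * R > 0" using M R_pos by (simp add: add_pos_pos)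
  obtain \<delta> where \<delta>: "\<delta> > 0"
    "\<And>r x. 0 \<le> r \<Longrightarrow> \<bar>r - t\<bar> < \<delta> \<Longrightarrow> x \<in> {0..R} \<Longrightarrow> \<bar>U r x - U t x\<bar> \<le> e / (1 + M * R)"
    using U_time_cont[OF t divide_pos_pos[OF e MR]] by blast
  have "\<bar>W r x - W t x\<bar> \<le> e" if r: "0 \<le> r" "\<bar>r - t\<bar> < \<delta>" and x: "x \<in> {0..R}" for r x
  proof -
    have sub: "{x..R} \<subseteq> {0..R}" using x by auto
    note cU = continuous_on_subset[OF U_slice[OF r(1)] sub] continuous_on_subset[OF U_slice[OF t] sub]
    have "W r x - W t x = volt c R (\<lambda>y. U r y - U t y) x"
      unfolding W_def by (rule volt_diff[OF cU, symmetric])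
    also have "\<bar>\<dots>\<bar> \<le> (1 + M * R) * (e / (1 + M * R))"
      by (rule volt_bound[OF M order_refl x continuous_on_diff[OF cU]]) (use \<delta>(2)[OF r] sub in auto)
    also have "\<dots> = e" using MR by simp
    finally show ?thesis .
  qed
  with \<delta>(1) show ?thesis by blast
qed

lemma compact_region:
  assumes "0 < t"
  shows "compact {(x, r). t \<le> r \<and> r \<le> t + 1 \<and> 0 \<le> x \<and> x \<le> s r}"
  by (rule compact_under_graph) (use assms in \<open>auto intro: s_pos continuous_on_subset[OF s_cont]\<close>)

text \<open>On the interior, the mean value theorem in time and uniform continuity of
  \<open>ut\<close> near time t. The endpoints 0 and s t, where no time derivative is available,
  follow by taking the closure.\<close>

lemma u_step:
  assumes t: "0 < t" and e: "0 < e"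
  obtains \<delta> where "\<delta> > 0" "\<And>h x. 0 < h \<Longrightarrow> h < \<delta> \<Longrightarrow> x \<in> {0..s t} \<Longrightarrow>
    \<bar>u x (t + h) - u x t - h * ut x t\<bar> \<le> e * h"
proof -
  define K where "K = {(x, r). t \<le> r \<and> r \<le> t + 1 \<and> 0 \<le> x \<and> x \<le> s r}"
  have "uniformly_continuous_on K (\<lambda>(x, t). ut x t)"
    unfolding K_def by (intro compact_uniformly_continuous compact_region t continuous_on_subset[OF ut_cont])
      (use t in auto)
  then obtain \<delta> where \<delta>: "\<delta> > 0" "\<And>z w. z \<in> K \<Longrightarrow> w \<in> K \<Longrightarrow> dist w z < \<delta> \<Longrightarrow>
      dist (case w of (x, t) \<Rightarrow> ut x t) (case z of (x, t) \<Rightarrow> ut x t) < e"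
    using e unfolding uniformly_continuous_on_def by meson
  have "\<bar>u x (t + h) - u x t - h * ut x t\<bar> \<le> e * h" if h: "0 < h" "h < min 1 \<delta>" and x: "x \<in> {0..s t}" for h x
  proof -
    have st: "0 < s t" "s t \<le> s (t + h)" using s_pos[of t] s_mono[of t "t + h"] t h by auto
    define f where "f x = \<bar>u x (t + h) - u x t - h * ut x t\<bar>" for x
    have "f x \<le> e * h"
    proof (rule continuous_le_on_closure[of "{0<..<s t}" f])
      have cl: "closure {0<..<s t} = {0..s t}" using st by simp
      show "continuous_on (closure {0<..<s t}) f"
        unfolding cl f_def[abs_def] using t h st
        by (intro continuous_intros continuous_on_subset[OF u_slice[of "t + h"]] u_slice ut_slice) auto
      show "x \<in> closure {0<..<s t}" unfolding cl by (rule x)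
      fix y assume y: "y \<in> {0<..<s t}"
      \<comment> \<open>A point inside the domain at time t stays inside, because the interface does
        not recede; this is why only forward increments are treated.\<close>
      have "((\<lambda>r. u y r) has_real_derivative ut y r) (at r)" if "t \<le> r" for r
        using that t y s_mono[of t r] by (intro u_time) auto
      then obtain z where z: "t < z" "z < t + h" "u y (t + h) - u y t = (t + h - t) * ut y z"
        using MVT2[of t "t + h" "u y" "ut y"] h by auto
      have "(y, z) \<in> K" "(y, t) \<in> K" using y z h t s_mono[of t z] by (auto simp: K_def)
      moreover have "dist (y, z) (y, t) < \<delta>" using z h by (simp add: dist_Pair_Pair dist_real_def)
      ultimately have "\<bar>ut y z - ut y t\<bar> < e" using \<delta>(2)[of "(y, t)" "(y, z)"] by (simp add: dist_real_def)
      then have "h * \<bar>ut y z - ut y t\<bar> \<le> h * e" using h by (intro mult_left_mono) auto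
      moreover have "f y = \<bar>h * (ut y z - ut y t)\<bar>" unfolding f_def z(3) by (simp add: algebra_simps)
      ultimately show "f y \<le> e * h" using h by (simp add: abs_mult mult.commute)
    qed
    then show ?thesis by (simp add: f_def)
  qed
  then show ?thesis using that[of "min 1 \<delta>"] \<delta>(1) by simp
qed

text \<open>The strip has width O(h) since s is differentiable, and u vanishes at its far end while
  u_x is bounded nearby. Hence u is O(h) on the strip too.\<close>

lemma u_strip:
  assumes t: "0 < t"
  obtains C \<delta> where "C > 0" "\<delta> > 0" "\<And>h. 0 < h \<Longrightarrow> h < \<delta> \<Longrightarrow> s (t + h) - s t \<le> C * h"
    "\<And>h x. 0 < h \<Longrightarrow> h < \<delta> \<Longrightarrow> x \<in> {s t..s (t + h)} \<Longrightarrow> \<bar>u x (t + h)\<bar> \<le> C * h"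
proof -
  define K where "K = {(x, r). t \<le> r \<and> r \<le> t + 1 \<and> 0 \<le> x \<and> x \<le> s r}"
  have "compact ((\<lambda>(x, t). ux x t) ` K)"
    unfolding K_def by (intro compact_continuous_image compact_region t continuous_on_subset[OF ux_cont])
      (use t in auto)
  then obtain L where L: "\<forall>y \<in> (\<lambda>(x, t). ux x t) ` K. norm y \<le> L"
    using compact_imp_bounded bounded_iff by blast
  define L' where "L' = max 1 L"
  have L': "\<bar>ux x r\<bar> \<le> L'" if "t \<le> r" "r \<le> t + 1" "0 \<le> x" "x \<le> s r" for x r
  proof -
    have "(x, r) \<in> K" using that by (simp add: K_def)
    then have "norm (ux x r) \<le> L" using L by force
    then show ?thesis by (simp add: L'_def)
  qed
  define B where "B = \<bar>s' t\<bar> + 1"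
  have "((\<lambda>h. (s (t + h) - s t) / h) \<longlongrightarrow> s' t) (at 0)"
    using s_deriv[OF t] by (simp add: DERIV_def)
  then have "\<forall>\<^sub>F h in at 0. (s (t + h) - s t) / h < B"
    by (rule order_tendstoD) (simp add: B_def)
  then obtain d where d: "d > 0" "\<And>h. h \<noteq> 0 \<Longrightarrow> dist h 0 < d \<Longrightarrow> (s (t + h) - s t) / h < B"
    unfolding eventually_at by auto
  have B: "s (t + h) - s t \<le> B * h" if "0 < h" "h < d" for h
    using d(2)[of h] that by (simp add: pos_divide_less_eq)
  define C where "C = L' * B"
  have LB: "L' \<ge> 1" "B \<ge> 1" by (auto simp: L'_def B_def)
  have BC: "B \<le> C" using mult_right_mono[of 1 L' B] LB by (simp add: C_def)
  show ?thesis
  proof (rule that[of C "min 1 d"])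
    show "C > 0" "min 1 d > 0" using BC LB d by auto
    fix h assume h: "0 < h" "h < min 1 d"
    show "s (t + h) - s t \<le> C * h"
      using order_trans[OF B[of h] mult_right_mono[OF BC, of h]] h by simp
    fix x assume x: "x \<in> {s t..s (t + h)}"
    have st: "0 < s t" "0 < t + h" using s_pos t h by auto
    have "norm (u x (t + h) - u (s (t + h)) (t + h)) \<le> L' * norm (x - s (t + h))"
    proof (rule field_differentiable_bound)
      show "((\<lambda>x. u x (t + h)) has_field_derivative ux y (t + h)) (at y within {0..s (t + h)})"
        if "y \<in> {0..s (t + h)}" for y
        using u_DERIV[of "t + h" y] st that by simp
      show "norm (ux y (t + h)) \<le> L'" if "y \<in> {0..s (t + h)}" for y
        using L'[of "t + h" y] h that by simp
    qed (use x st in auto)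
    also have "\<dots> \<le> L' * (B * h)"
      using x B[of h] h LB by (intro mult_left_mono) auto
    finally show "\<bar>u x (t + h)\<bar> \<le> C * h" using u_right[of "t + h"] st by (simp add: C_def mult.assoc)
  qed
qed

definition W' :: "real \<Rightarrow> real \<Rightarrow> real" where
  "W' t = volt_x c (s t) (\<lambda>x. u x t) (\<lambda>x. ux x t)"

definition W'' :: "real \<Rightarrow> real \<Rightarrow> real" where
  "W'' t = volt_xx c (s t) (\<lambda>x. u x t) (\<lambda>x. ux x t) (\<lambda>x. uxx x t)"

lemma W_DERIV:
  assumes t: "0 < t" and x: "x \<in> {0..s t}"
  shows "(W t has_real_derivative W' t x) (at x within {0..s t})"
    "(W' t has_real_derivative W'' t x) (at x within {0..s t})"
proof -
  have t0: "0 \<le> t" using t by simp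
  have "(volt c (s t) (\<lambda>x. u x t) has_real_derivative W' t x) (at x within {0..s t})"
    unfolding W'_def by (rule DERIV_volt[where u' = "\<lambda>x. ux x t", OF u_slice[OF t0] x u_DERIV[OF t x]])
  then show "(W t has_real_derivative W' t x) (at x within {0..s t})"
    by (rule has_field_derivative_transform_within[where d = 1]) (use x W_eq[OF t0] in auto)
  show "(W' t has_real_derivative W'' t x) (at x within {0..s t})"
    unfolding W'_def W''_def by (rule DERIV_volt_x[where u' = "\<lambda>x. ux x t" and u'' = "\<lambda>x. uxx x t", OF u_slice[OF t0] x u_DERIV[OF t x] ux_DERIV[OF t x]])
qed

text \<open>Identifies the right-hand side of the damped heat equation with the transform of
  \<open>ut\<close> for a frozen interface, the form in which forward increments of u can be
  inserted.\<close>

lemma W''_eq: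
  assumes t: "0 < t" and x: "x \<in> {0..s t}"
  shows "\<alpha> * W'' t x - \<alpha> * c * W t x = volt c (s t) (\<lambda>x. ut x t) x"
proof -
  have t0: "0 \<le> t" using t by simp
  have "\<alpha> * W'' t x - \<alpha> * c * W t x = \<alpha> * (W'' t x - c * volt c (s t) (\<lambda>x. u x t) x)"
    by (simp add: W_eq[OF t0 x] right_diff_distrib mult.assoc)
  also have "W'' t x - c * volt c (s t) (\<lambda>x. u x t) x
      = volt c (s t) (\<lambda>x. uxx x t + kern_inv c x (s t) * ux (s t) t) x"
    unfolding W''_def
    by (rule volt_intertwines[OF c x u_DERIV[OF t] ux_DERIV[OF t] uxx_slice[OF t] u_right[OF t0], symmetric])
  also have "\<alpha> * \<dots> = volt c (s t) (\<lambda>x. \<alpha> * (uxx x t + kern_inv c x (s t) * ux (s t) t)) x"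
    by (rule volt_cmult[symmetric])
  also have "\<dots> = volt c (s t) (\<lambda>x. ut x t) x"
  proof -
    have "integral {x..s t} (\<lambda>y. kern c x y * (\<alpha> * (uxx y t + kern_inv c y (s t) * ux (s t) t)))
        = integral {x..s t} (\<lambda>y. kern c x y * ut y t)"
      using x u_pde[OF t] by (intro Henstock_Kurzweil_Integration.integral_cong) auto
    then show ?thesis using u_pde[OF t x] by (simp add: volt_def)
  qed
  finally show ?thesis .
qed

text \<open>Read off from \<open>W''_eq\<close>: the transform of the continuous function
  \<open>ut\<close> is continuous, so the integral with \<open>kern_xx\<close> need not be
  examined.\<close>

lemma W''_cont:
  assumes t: "0 < t"
  shows "continuous_on {0..s t} (W'' t)"
proof (rule continuous_on_eq)
  have t0: "0 \<le> t" using t by simp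
  have sub: "{0..s t} \<subseteq> {0..R}" using s_le[OF t0] by auto
  show "continuous_on {0..s t} (\<lambda>x. c * W t x + volt c (s t) (\<lambda>x. ut x t) x / \<alpha>)"
    unfolding volt_def using \<alpha>
    by (intro continuous_intros continuous_on_subset[OF W_cont[OF t0] sub] continuous_on_kern_integral ut_slice[OF t]) auto
  show "c * W t x + volt c (s t) (\<lambda>x. ut x t) x / \<alpha> = W'' t x" if "x \<in> {0..s t}" for x
    using W''_eq[OF t that] \<alpha> by (simp add: field_simps)
qed

text \<open>Up to the remainder of \<open>u_step\<close>, which the transform maps boundedly, the
  increment of W differs from the prediction by the integral \<open>J\<close> over the new strip.
  Width and integrand of \<open>J\<close> are both O(h), so it is negligible.\<close>

lemma W_step:
  assumes t: "0 < t" and e: "0 < e"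
  shows "\<exists>\<delta>>0. \<forall>h. 0 < h \<and> h < \<delta> \<longrightarrow>
      (\<forall>x\<in>{0..s t}. \<bar>W (t + h) x - W t x - h * (\<alpha> * W'' t x - \<alpha> * c * W t x)\<bar> \<le> e * h) \<and>
      integral {s t..s (t + h)} (\<lambda>x. (W (t + h) x)\<^sup>2) \<le> e * h"
proof -
  have t0: "0 \<le> t" using t by simp
  obtain M where M: "M > 0" "\<And>x y. x \<in> {0..R} \<Longrightarrow> y \<in> {0..R} \<Longrightarrow> \<bar>kern c x y\<bar> \<le> M"
    and "\<And>x y. x \<in> {0..R} \<Longrightarrow> y \<in> {0..R} \<Longrightarrow> \<bar>kern_x c x y\<bar> \<le> M"
    using kern_bounded[where R = R and c = c] by blast
  have MR: "1 + M * R > 0" using M R_pos by (simp add: add_pos_pos)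
  obtain C \<delta>1 where C: "C > 0" "\<delta>1 > 0" "\<And>h. 0 < h \<Longrightarrow> h < \<delta>1 \<Longrightarrow> s (t + h) - s t \<le> C * h"
    "\<And>h x. 0 < h \<Longrightarrow> h < \<delta>1 \<Longrightarrow> x \<in> {s t..s (t + h)} \<Longrightarrow> \<bar>u x (t + h)\<bar> \<le> C * h"
    using u_strip[OF t] by blast
  define e1 where "e1 = e / 2 / (1 + M * R)"
  have e1: "e1 > 0" "(1 + M * R) * e1 = e / 2"
  proof -
    show "e1 > 0" using e MR by (simp add: e1_def)
    have "e1 * (1 + M * R) = e / 2" using MR by (subst nonzero_eq_divide_eq[symmetric]) (auto simp: e1_def)
    then show "(1 + M * R) * e1 = e / 2" by (simp only: mult.commute)
  qed
  obtain \<delta>2 where \<delta>2: "\<delta>2 > 0" "\<And>h x. 0 < h \<Longrightarrow> h < \<delta>2 \<Longrightarrow> x \<in> {0..s t} \<Longrightarrow>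
    \<bar>u x (t + h) - u x t - h * ut x t\<bar> \<le> e1 * h"
    using u_step[OF t e1(1)] by blast
  \<comment> \<open>P and Q are the coefficients of h^2 in the bounds for \<open>J\<close> and for
    the mass of W on the strip; \<delta> turns one factor h into e / 2 and e respectively.\<close>
  define P where "P = M * C * C"
  define Q where "Q = R * ((1 + M * R) * C)\<^sup>2"
  have PQ: "P > 0" "Q > 0" using M C R_pos MR by (simp_all add: P_def Q_def)
  define \<delta> where "\<delta> = min (min \<delta>1 \<delta>2) (min (e / 2 / P) (e / Q))"
  have \<delta>: "\<delta> > 0" using C(2) \<delta>2(1) e PQ by (simp add: \<delta>_def)
  have "(\<forall>x\<in>{0..s t}. \<bar>W (t + h) x - W t x - h * (\<alpha> * W'' t x - \<alpha> * c * W t x)\<bar> \<le> e * h) \<and>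
      integral {s t..s (t + h)} (\<lambda>x. (W (t + h) x)\<^sup>2) \<le> e * h" if h: "0 < h" "h < \<delta>" for h
  proof (intro conjI ballI)
    have "h < \<delta>1" "h < \<delta>2" "h * P < e / 2" "h * Q < e"
      using h unfolding \<delta>_def pos_less_divide_eq[OF PQ(1), symmetric] pos_less_divide_eq[OF PQ(2), symmetric]
      by simp_all
    then have h': "h < \<delta>1" "h < \<delta>2" "P * h \<le> e / 2" "Q * h \<le> e"
      by (simp_all only: mult.commute[of h] less_imp_le)
    have th: "0 \<le> t + h" "t \<le> t + h" using t h by auto
    have ss: "s t \<le> s (t + h)" "s (t + h) \<le> R" "0 < s t"
      using s_mono[OF t0 th(2)] s_le[OF th(1)] s_pos[OF t0] by auto
    note uth = u_slice[OF th(1)]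
    show "\<bar>W (t + h) x - W t x - h * (\<alpha> * W'' t x - \<alpha> * c * W t x)\<bar> \<le> e * h" if x: "x \<in> {0..s t}" for x
    proof -
      have subs: "{x..s t} \<subseteq> {0..s (t + h)}" "{x..s t} \<subseteq> {0..s t}" "{s t..s (t + h)} \<subseteq> {0..s (t + h)}" "{x..s (t + h)} \<subseteq> {0..s (t + h)}"
        using x ss by auto
      note cs = continuous_on_subset[OF uth subs(1)] continuous_on_subset[OF u_slice[OF t0] subs(2)]
        continuous_on_subset[OF ut_slice[OF t] subs(2)] continuous_on_subset[OF uth subs(3)] continuous_on_subset[OF uth subs(4)]
      define J where "J = integral {s t..s (t + h)} (\<lambda>y. kern c x y * u y (t + h))"
      have "integral {x..s (t + h)} (\<lambda>y. kern c x y * u y (t + h))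
          = integral {x..s t} (\<lambda>y. kern c x y * u y (t + h)) + J"
        unfolding J_def using x ss
        by (intro Henstock_Kurzweil_Integration.integral_combine[symmetric] integrable_continuous_interval
            continuous_intros cs) auto
      then have "W (t + h) x = volt c (s t) (\<lambda>y. u y (t + h)) x - J"
        using W_eq[OF th(1), of x] x ss by (simp add: volt_def)
      moreover have "W t x = volt c (s t) (\<lambda>y. u y t) x" by (rule W_eq[OF t0 x])
      moreover have "h * (\<alpha> * W'' t x - \<alpha> * c * W t x) = volt c (s t) (\<lambda>y. h * ut y t) x"
        unfolding W''_eq[OF t x] by (rule volt_cmult[symmetric])
      moreover have "volt c (s t) (\<lambda>y. u y (t + h) - u y t - h * ut y t) x
         = volt c (s t) (\<lambda>y. u y (t + h)) x - volt c (s t) (\<lambda>y. u y t) x - volt c (s t) (\<lambda>y. h * ut y t) x"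
        by (subst volt_diff, intro continuous_intros cs, intro continuous_intros cs)
          (simp add: volt_diff[OF cs(1,2)])
      ultimately have "W (t + h) x - W t x - h * (\<alpha> * W'' t x - \<alpha> * c * W t x)
        = volt c (s t) (\<lambda>y. u y (t + h) - u y t - h * ut y t) x - J" by simp
      moreover have "\<bar>volt c (s t) (\<lambda>y. u y (t + h) - u y t - h * ut y t) x\<bar> \<le> (1 + M * R) * (e1 * h)"
        by (intro volt_bound[OF M] continuous_intros cs \<delta>2(2)[OF h(1) h'(2)]) (use x ss in auto)
      moreover have "\<bar>J\<bar> \<le> P * h * h"
      proof -
        have "\<bar>J\<bar> \<le> M * integral {s t..s (t + h)} (\<lambda>y. \<bar>u y (t + h)\<bar>)"
          unfolding J_def by (intro abs_integral_mult_le continuous_intros cs M) (use x ss in auto)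
        also have "integral {s t..s (t + h)} (\<lambda>y. \<bar>u y (t + h)\<bar>) \<le> integral {s t..s (t + h)} (\<lambda>y. C * h)"
          by (intro integral_le integrable_continuous_interval continuous_intros cs C(4)[OF h(1) h'(1)])
        also have "\<dots> = (s (t + h) - s t) * (C * h)" using ss by simp
        also have "\<dots> \<le> C * h * (C * h)"
          using C(3)[OF h(1) h'(1)] C(1) h by (intro mult_right_mono) auto
        finally show ?thesis using M by (simp add: P_def mult_ac)
      qed
      moreover have "P * h * h \<le> e / 2 * h" using h'(3) h by (intro mult_right_mono) auto
      moreover have "(1 + M * R) * (e1 * h) = e / 2 * h" by (simp only: mult.assoc[symmetric] e1(2))
      ultimately show ?thesis by linarith
    qed
    have sub: "{s t..s (t + h)} \<subseteq> {0..R}" using ss by auto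
    have "integral {s t..s (t + h)} (\<lambda>x. (W (t + h) x)\<^sup>2)
        \<le> integral {s t..s (t + h)} (\<lambda>x. ((1 + M * R) * (C * h))\<^sup>2)"
    proof (intro integral_le integrable_continuous_interval continuous_intros continuous_on_subset[OF W_cont[OF th(1)] sub])
      fix x assume x: "x \<in> {s t..s (t + h)}"
      have sub': "{x..s (t + h)} \<subseteq> {0..s (t + h)}" using x ss by auto
      have x': "x \<in> {0..s (t + h)}" using x ss by auto
      have "\<bar>W (t + h) x\<bar> \<le> (1 + M * R) * (C * h)"
        unfolding W_eq[OF th(1) x']
        by (rule volt_bound[OF M ss(2) x' continuous_on_subset[OF uth sub']])
          (use x in \<open>auto intro!: C(4)[OF h(1) h'(1)]\<close>)
      then show "(W (t + h) x)\<^sup>2 \<le> ((1 + M * R) * (C * h))\<^sup>2"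
        using MR C(1) h by (simp add: abs_le_square_iff[symmetric])
    qed
    also have "\<dots> = (s (t + h) - s t) * ((1 + M * R) * (C * h))\<^sup>2" using ss by simp
    also have "\<dots> \<le> R * ((1 + M * R) * (C * h))\<^sup>2" using ss by (intro mult_right_mono) auto
    also have "\<dots> = Q * h * h" by (simp add: Q_def power2_eq_square mult_ac)
    also have "\<dots> \<le> e * h" using h'(4) h by (intro mult_right_mono) auto
    finally show "integral {s t..s (t + h)} (\<lambda>x. (W (t + h) x)\<^sup>2) \<le> e * h" .
  qed
  with \<delta> show ?thesis by blast
qed

sublocale growing_flow s W W' W'' \<alpha> "\<alpha> * c" R
proof
  show "W t 0 = 0" if "0 < t" for t
    using W_eq[of t 0] u_left[of t] s_pos[of t] that by (simp add: volt_def)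
qed (use \<alpha> c in \<open>auto intro: s_pos s_mono s_le W_cont W_outside W_time_cont W_DERIV W''_cont W_step\<close>)

end

subsection \<open>Exponential stability\<close>

lemma const_at_0:
  fixes f :: "real \<Rightarrow> real"
  assumes "continuous_on {0..} f" "\<And>t. 0 < t \<Longrightarrow> f t = k"
  shows "f 0 = k"
proof (rule continuous_constant_on_closure[of "{0<..}" f])
  show "continuous_on (closure {0<..}) f" using assms(1) by simp
qed (use assms(2) in auto)

lemma classical_on_diff:
  assumes u: "classical_on s u ux uxx ut" and v: "classical_on s v vx vxx vt"
  shows "classical_on s (\<lambda>x t. u x t - v x t) (\<lambda>x t. ux x t - vx x t) (\<lambda>x t. uxx x t - vxx x t) (\<lambda>x t. ut x t - vt x t)"
proof -
  have d: "continuous_on A (\<lambda>(x, t). f x t - g x t)"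
    if "continuous_on A (\<lambda>(x, t). f x t)" "continuous_on A (\<lambda>(x, t). g x t)" for A and f g :: "real \<Rightarrow> real \<Rightarrow> real"
    using continuous_on_diff[OF that] by (simp add: case_prod_unfold)
  show ?thesis
    using u v unfolding classical_on_def by (auto intro!: d derivative_intros)
qed

text \<open>Dividing by c and subtracting l isolates the infimum, which is legitimate because both
  are finite and c is not 0. An empty A, meaning that no weak derivative exists, needs no separate
  treatment.\<close>

lemma ennreal_le_INF_add:
  fixes c l x :: ennreal
  assumes "c \<noteq> 0" "c \<noteq> \<infinity>" "l \<noteq> \<infinity>" and le: "\<And>g. g \<in> A \<Longrightarrow> x \<le> c * (l + f g)"
  shows "x \<le> c * (l + (INF g\<in>A. f g))"
proof -
  have "x / c \<le> l + f g" if "g \<in> A" for g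
    using le[OF that] assms(1,2) by (simp add: divide_le_posI_ennreal mult.commute zero_less_iff_neq_zero)
  then have "x / c - l \<le> (INF g\<in>A. f g)"
    using assms(3) by (intro INF_greatest) (auto simp: ennreal_minus_le_iff top.not_eq_extremum)
  then have "x / c \<le> l + (INF g\<in>A. f g)"
    using assms(3) by (auto simp: ennreal_minus_le_iff top.not_eq_extremum)
  then have "c * (x / c) \<le> c * (l + (INF g\<in>A. f g))" by (rule mult_left_mono) simp
  moreover have "c * (x / c) = x" using assms(1,2)
    by (simp add: ennreal_times_divide mult.commute[of c] mult_divide_eq_ennreal)
  ultimately show ?thesis by simp
qed

text \<open>D = K C, the product of the constants for leaving and entering the transformed variable,
  fixed before the system and even before \<alpha>; only c and R determine it.\<close>

lemma H1_decay:
  assumes R: "R > 0"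
  obtains D where "D \<ge> 1"
    "\<And>s s' u ux uxx ut \<alpha> t. error_system s s' u ux uxx ut \<alpha> c R \<Longrightarrow> 0 \<le> t \<Longrightarrow>
      H1_sqnorm (s t) (\<lambda>x. u x t)
        \<le> ennreal D * H1_sqnorm (s 0) (\<lambda>x. u x 0) * ennreal (exp (- (2 * (\<alpha> * c)) * t))"
proof -
  obtain K where K: "K \<ge> 1"
    "\<And>s u u'. 0 < s \<Longrightarrow> s \<le> R \<Longrightarrow> u 0 = 0 \<Longrightarrow>
      (\<And>x. x \<in> {0..s} \<Longrightarrow> (u has_real_derivative u' x) (at x within {0..s})) \<Longrightarrow>
      continuous_on {0..s} u' \<Longrightarrow>
      integral {0..s} (\<lambda>x. (u x)\<^sup>2) + integral {0..s} (\<lambda>x. (u' x)\<^sup>2)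
        \<le> K * integral {0..s} (\<lambda>x. (volt_x c s u u' x)\<^sup>2)"
    using H1_le_volt_x[OF R, where c = c] by blast
  obtain C where C: "C \<ge> 1"
    "\<And>s u g \<mu> z zx. 0 < s \<Longrightarrow> s \<le> R \<Longrightarrow> continuous_on {0..s} u \<Longrightarrow> u 0 = 0 \<Longrightarrow> u s = 0 \<Longrightarrow>
      weak_deriv_on s u g \<Longrightarrow> L2_sqnorm s g < \<infinity> \<Longrightarrow> 0 < \<mu> \<Longrightarrow> yosida_resolvent \<mu> s (volt c s u) z zx \<Longrightarrow>
      2 * yosida \<mu> s (volt c s u) z
        \<le> C * (integral {0..s} (\<lambda>x. (u x)\<^sup>2) + (LINT x:{0..s}|lborel. (g x)\<^sup>2))"
    using yosida_volt_le_H1[OF R, where c = c] by blast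
  have KC: "K * C \<ge> 1" using mult_mono[of 1 K 1 C] K(1) C(1) by simp
  have "H1_sqnorm (s t) (\<lambda>x. u x t)
        \<le> ennreal (K * C) * H1_sqnorm (s 0) (\<lambda>x. u x 0) * ennreal (exp (- (2 * (\<alpha> * c)) * t))"
    if sys: "error_system s s' u ux uxx ut \<alpha> c R" and t0: "0 \<le> t" for s s' u ux uxx ut \<alpha> t
  proof (cases "t = 0")
    case True
    \<comment> \<open>At t = 0 no classical derivative is at hand, but D \<ge> 1 suffices.\<close>
    have "1 * H1_sqnorm (s 0) (\<lambda>x. u x 0) \<le> ennreal (K * C) * H1_sqnorm (s 0) (\<lambda>x. u x 0)"
      using ennreal_leI[OF KC] by (intro mult_right_mono) auto
    then show ?thesis using True by simp
  next
    case False
    with t0 have t: "0 < t" by simp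
    interpret error_system s s' u ux uxx ut \<alpha> c R by (rule sys)
    define e where "e = exp (- (2 * (\<alpha> * c)) * t)"
    have e: "e > 0" by (simp add: e_def)
    define I where "I = integral {0..s 0} (\<lambda>x. (u x 0)\<^sup>2)"
    have I: "L2_sqnorm (s 0) (\<lambda>x. u x 0) = ennreal I" "0 \<le> I"
      unfolding I_def
      by (intro L2_sqnorm_continuous u_slice order_refl)
        (intro Henstock_Kurzweil_Integration.integral_nonneg integrable_continuous_interval continuous_intros u_slice; simp)
    define V where "V = integral {0..s t} (\<lambda>x. (W' t x)\<^sup>2)"
    \<comment> \<open>At a positive time one weak derivative, the classical one, bounds the infimum
      from above. At time 0 the infimum stands on the larger side, so every weak derivative has to
      be treated.\<close>
    have "H1_sqnorm (s t) (\<lambda>x. u x t) \<le> L2_sqnorm (s t) (\<lambda>x. u x t) + L2_sqnorm (s t) (\<lambda>x. ux x t)"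
      unfolding H1_sqnorm_def
      by (intro add_left_mono INF_lower CollectI weak_deriv_on_C1 u_DERIV ux_slice t)
    also have "\<dots> = ennreal (integral {0..s t} (\<lambda>x. (u x t)\<^sup>2) + integral {0..s t} (\<lambda>x. (ux x t)\<^sup>2))"
      by (simp add: L2_sqnorm_continuous u_slice[OF t0] ux_slice[OF t]
          Henstock_Kurzweil_Integration.integral_nonneg integrable_continuous_interval continuous_intros)
    also have "\<dots> \<le> ennreal (K * V)"
      unfolding V_def W'_def
      by (intro ennreal_leI K(2) s_pos s_le u_left u_DERIV ux_slice t t0)
    finally have 1: "H1_sqnorm (s t) (\<lambda>x. u x t) \<le> ennreal (K * V)" .
    have main: "H1_sqnorm (s t) (\<lambda>x. u x t)
        \<le> ennreal (K * C * e) * (L2_sqnorm (s 0) (\<lambda>x. u x 0) + L2_sqnorm (s 0) g)"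
      if g: "weak_deriv_on (s 0) (\<lambda>x. u x 0) g" for g
    proof (cases "L2_sqnorm (s 0) g = \<infinity>")
      case True
      then show ?thesis using K(1) C(1) e by (simp add: ennreal_mult_eq_top_iff)
    next
      case False
      then have fin: "L2_sqnorm (s 0) g < \<infinity>" by (simp add: top.not_eq_extremum)
      define J where "J = (LINT x:{0..s 0}|lborel. (g x)\<^sup>2)"
      have J: "L2_sqnorm (s 0) g = ennreal J"
        unfolding J_def using g fin by (intro L2_sqnorm_finite) (simp_all add: weak_deriv_on_def)
      have J0: "0 \<le> J"
        unfolding J_def set_lebesgue_integral_def by (rule Bochner_Integration.integral_nonneg) simp
      have "yosida \<mu> (s 0) (W 0) z \<le> C * (I + J) / 2"
        if mu: "0 < \<mu>" and res: "yosida_resolvent \<mu> (s 0) (W 0) z zx" for \<mu> z zx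
      proof -
        have eq: "W 0 x = volt c (s 0) (\<lambda>x. u x 0) x" if "x \<in> {0..s 0}" for x
          using W_eq[of 0 x] that by simp
        have res': "yosida_resolvent \<mu> (s 0) (volt c (s 0) (\<lambda>x. u x 0)) z zx"
          using res eq unfolding yosida_resolvent_def by simp
        have "yosida \<mu> (s 0) (W 0) z = yosida \<mu> (s 0) (volt c (s 0) (\<lambda>x. u x 0)) z"
          unfolding yosida_def
          by (intro arg_cong2[where f="(/)"] refl Henstock_Kurzweil_Integration.integral_cong) (simp add: eq)
        also have "2 * \<dots> \<le> C * (I + J)"
          unfolding I_def J_def
          by (rule C(2)[OF s_pos s_le u_slice u_left u_right g fin mu res']) simp_all
        finally show ?thesis by simp
      qed
      from dirichlet_decay[OF this t] have "V \<le> 2 * (C * (I + J) / 2) * exp (- 2 * (\<alpha> * c) * t)"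
        unfolding V_def .
      also have "\<dots> = C * (I + J) * e" by (simp add: e_def)
      finally have "K * V \<le> K * (C * (I + J) * e)" using K(1) by (intro mult_left_mono) auto
      then have "ennreal (K * V) \<le> ennreal (K * C * e * (I + J))" by (intro ennreal_leI) (simp add: mult_ac)
      also have "\<dots> = ennreal (K * C * e) * (ennreal I + ennreal J)"
        using K(1) C(1) e I(2) J0 by (simp add: ennreal_mult ennreal_plus)
      finally show ?thesis using 1 by (simp add: I J)
    qed
    have "H1_sqnorm (s t) (\<lambda>x. u x t) \<le> ennreal (K * C * e) * H1_sqnorm (s 0) (\<lambda>x. u x 0)"
      unfolding H1_sqnorm_def[of "s 0"]
      by (rule ennreal_le_INF_add) (use K(1) C(1) e main I in \<open>auto simp: mult_pos_pos\<close>)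
    also have "ennreal (K * C * e) = ennreal (K * C) * ennreal e"
      using KC e by (simp add: ennreal_mult)
    finally show ?thesis by (simp add: e_def mult_ac)
  qed
  then show ?thesis using that[OF KC] by blast
qed

theorem corollary2:
  fixes \<alpha> \<beta> Tm lam sr :: real
  assumes "\<alpha> > 0" and "\<beta> > 0" and "lam > 0"
  shows "\<exists>D>0. \<exists>b>0.
    \<forall>(Tc :: real \<Rightarrow> real) (s0 :: real) (T0 :: real \<Rightarrow> real) (s :: real \<Rightarrow> real)
     (T :: real \<Rightarrow> real \<Rightarrow> real) (Th0 :: real \<Rightarrow> real) (Th :: real \<Rightarrow> real \<Rightarrow> real).
      s0 > 0 \<longrightarrow>
      (\<exists>H. \<forall>x\<in>{0..s0}. 0 \<le> T0 x - Tm \<and> T0 x - Tm \<le> H * (s0 - x)) \<longrightarrow>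
      stefan_solution \<alpha> \<beta> Tm Tc s0 T0 s T \<longrightarrow>
      observer_solution \<alpha> \<beta> lam Tm Tc s Th0 Th \<longrightarrow>
      (\<forall>t>0. Tc t > 0 \<and> s t < sr) \<longrightarrow>
      (\<forall>t\<ge>0. H1_sqnorm (s t) (\<lambda>x. T x t - Th x t)
         \<le> ennreal D * H1_sqnorm (s 0) (\<lambda>x. T x 0 - Th x 0) * ennreal (exp (- b * t)))"
proof -
  \<comment> \<open>The constants must be chosen before any solution is given, when sr > 0 is not
    yet known; the maximum keeps R positive.\<close>
  define R where "R = max 1 sr"
  have R: "R > 0" by (simp add: R_def)
  obtain D where D: "D \<ge> 1"
    "\<And>s s' u ux uxx ut \<alpha>' t. error_system s s' u ux uxx ut \<alpha>' (lam / \<alpha>) R \<Longrightarrow> 0 \<le> t \<Longrightarrow>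
      H1_sqnorm (s t) (\<lambda>x. u x t)
        \<le> ennreal D * H1_sqnorm (s 0) (\<lambda>x. u x 0) * ennreal (exp (- (2 * (\<alpha>' * (lam / \<alpha>))) * t))"
    using H1_decay[OF R, where c = "lam / \<alpha>"] by blast
  show ?thesis
  proof (rule exI[of _ D], intro conjI exI[of _ "2 * lam"] allI impI)
    show "D > 0" using D(1) by simp
    show "2 * lam > 0" using assms by simp
    fix Tc s0 T0 s T Th0 Th and t :: real
    assume s0: "0 < s0" and H: "\<exists>H. \<forall>x\<in>{0..s0}. 0 \<le> T0 x - Tm \<and> T0 x - Tm \<le> H * (s0 - x)"
      and stefan: "stefan_solution \<alpha> \<beta> Tm Tc s0 T0 s T"
      and observer: "observer_solution \<alpha> \<beta> lam Tm Tc s Th0 Th"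
      and ctrl: "\<forall>t>0. Tc t > 0 \<and> s t < sr" and t: "0 \<le> t"
    obtain Tx Txx Tt where cs: "continuous_on {0..} s" and s_pos: "\<And>t. 0 \<le> t \<Longrightarrow> 0 < s t"
      and clT: "classical_on s T Tx Txx Tt"
      and T_pde: "\<And>t x. 0 < t \<Longrightarrow> x \<in> {0..s t} \<Longrightarrow> Tt x t = \<alpha> * Txx x t"
      and T_bc: "\<And>t. 0 < t \<Longrightarrow> T 0 t = Tm + Tc t" "\<And>t. 0 < t \<Longrightarrow> T (s t) t = Tm"
      and ds: "\<And>t. 0 < t \<Longrightarrow> (s has_real_derivative - \<beta> * Tx (s t) t) (at t)"
      using stefan unfolding stefan_solution_def by blast
    obtain Thx Thxx Tht where clTh: "classical_on s Th Thx Thxx Tht"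
      and Th_pde: "\<And>t x. 0 < t \<Longrightarrow> x \<in> {0..s t} \<Longrightarrow>
         Tht x t = \<alpha> * Thxx x t - observer_gain \<alpha> lam x (s t) * (deriv s t / \<beta> + Thx (s t) t)"
      and Th_bc: "\<And>t. 0 < t \<Longrightarrow> Th 0 t = Tm + Tc t" "\<And>t. 0 < t \<Longrightarrow> Th (s t) t = Tm"
      using observer unfolding observer_solution_def by blast
    have mono: "s r \<le> s t" if "0 \<le> r" "r \<le> t" for r t
      by (rule stefan_interface_mono[OF assms(1,2) stefan _ _ that]) (use H ctrl in \<open>force+\<close>)
    have le_R: "s t \<le> R" if "0 \<le> t" for t
    proof -
      \<comment> \<open>The setpoint bound is assumed for positive times only; monotonicity carries
        it to t = 0.\<close>
      have "s t \<le> s (t + 1)" using mono that by simp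
      also have "\<dots> < sr" using ctrl that by simp
      finally show ?thesis by (simp add: R_def)
    qed
    have cl: "classical_on s (\<lambda>x t. T x t - Th x t) (\<lambda>x t. Tx x t - Thx x t)
        (\<lambda>x t. Txx x t - Thxx x t) (\<lambda>x t. Tt x t - Tht x t)"
      by (rule classical_on_diff[OF clT clTh])
    then have cu: "continuous_on {(x, t). 0 \<le> t \<and> 0 \<le> x \<and> x \<le> s t} (\<lambda>(x, t). T x t - Th x t)"
      unfolding classical_on_def by blast
    have "error_system s (\<lambda>t. - \<beta> * Tx (s t) t) (\<lambda>x t. T x t - Th x t) (\<lambda>x t. Tx x t - Thx x t)
        (\<lambda>x t. Txx x t - Thxx x t) (\<lambda>x t. Tt x t - Tht x t) \<alpha> (lam / \<alpha>) R"
    proof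
      \<comment> \<open>The boundary conditions are imposed for t > 0; continuity up to time 0
        extends them, so that the initial error vanishes at both ends as the regularized energy
        requires.\<close>
      have "continuous_on {0..} (\<lambda>t. case (0, t) of (x, t) \<Rightarrow> T x t - Th x t)"
        by (rule continuous_on_compose2[OF cu]) (auto intro!: continuous_intros less_imp_le[OF s_pos])
      then have "T 0 0 - Th 0 0 = 0"
        using const_at_0[of "\<lambda>t. T 0 t - Th 0 t" 0] T_bc Th_bc by simp
      then show "T 0 t - Th 0 t = 0" if "0 \<le> t" for t
        using that T_bc(1)[of t] Th_bc(1)[of t] by (cases "t = 0") auto
      have "continuous_on {0..} (\<lambda>t. case (s t, t) of (x, t) \<Rightarrow> T x t - Th x t)"
        by (rule continuous_on_compose2[OF cu]) (auto intro!: continuous_intros cs less_imp_le[OF s_pos])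
      then have "T (s 0) 0 - Th (s 0) 0 = 0"
        using const_at_0[of "\<lambda>t. T (s t) t - Th (s t) t" 0] T_bc Th_bc by simp
      then show "T (s t) t - Th (s t) t = 0" if "0 \<le> t" for t
        using that T_bc(2)[of t] Th_bc(2)[of t] by (cases "t = 0") auto
      show "Tt x t - Tht x t = \<alpha> * (Txx x t - Thxx x t + kern_inv (lam / \<alpha>) x (s t) * (Tx (s t) t - Thx (s t) t))"
        if t: "0 < t" and x: "x \<in> {0..s t}" for t x
      proof -
        have "deriv s t = - \<beta> * Tx (s t) t" by (rule DERIV_imp_deriv[OF ds[OF t]])
        then have 1: "deriv s t / \<beta> + Thx (s t) t = - (Tx (s t) t - Thx (s t) t)"
          using assms by simp
        have 2: "observer_gain \<alpha> lam x (s t) = - (\<alpha> * kern_inv (lam / \<alpha>) x (s t))"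
          using observer_gain_eq[of \<alpha> lam x "s t"] assms x by (simp add: kern_inv_def)
        show ?thesis unfolding T_pde[OF t x] Th_pde[OF t x] 1 2 by (simp add: algebra_simps)
      qed
    qed (use assms cs s_pos mono le_R ds cl in auto)
    from D(2)[OF this t] show "H1_sqnorm (s t) (\<lambda>x. T x t - Th x t)
         \<le> ennreal D * H1_sqnorm (s 0) (\<lambda>x. T x 0 - Th x 0) * ennreal (exp (- (2 * lam) * t))"
      using assms by simp
  qed
qed

end
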